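(* Suppose that $\dot A$ and $\dot B$ are prime, closed, densely defined symmetric operators with deficiency indices $(1,1)$ in Hilbert spaces $\mathcal H_A$ and $\mathcal H_B$. Assume that $A$ and $B$ are self-adjoint extensions of $\dot A$ and $\dot B$, and that $\widehat A$ and $\widehat B$ are maximal dissipative extensions of $\dot A$ and $\dot B$, respectively, with $\widehat A\ne(\widehat A)^*$, $\widehat B\ne(\widehat B)^*$. Then: (i) the triples $(\dot A,\widehat A,A)$ and $(\dot B,\widehat B,B)$ are unitarily equivalent if and only if their characteristic functions $S_A=S(\dot A,\widehat A,A)$ and $S_B=S(\dot B,\widehat B,B)$ coincide (on $\mathbb C_+$); (ii) the triple $(\dot A,\widehat A,A)$ is unitarily equivalent to the model triple $(\dot{\mathcal B},\widehat{\mathcal B},\mathcal B)$ in $L^2(\mathbb R;d\mu)$ with parameter $S=S_A$, where $\mu$ is the representing measure for the Weyl–Titchmarsh function $M=M(\dot A,A)$ of the pair $(\dot A,A)$.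
   Context: $\mathbb C_+$ is the open upper half-plane; inner products are linear in the first argument. A symmetric operator $\dot A$ is prime if there is no nonzero closed subspace invariant under $\dot A$ such that the restriction of $\dot A$ to it is self-adjoint. A maximal dissipative extension $\widehat A$ of $\dot A$ is a maximal operator extending $\dot A$ with $\operatorname{Im}(\widehat Af,f)\ge0$ on $\operatorname{Dom}(\widehat A)$; it satisfies $\dot A\subset\widehat A\subset(\dot A)^*$. Unitary equivalence of triples: there is a unitary map $\mathcal U$ from $\mathcal H_A$ onto $\mathcal H_B$ with $\dot B=\mathcal U\dot A\mathcal U^{-1}$, $\widehat B=\mathcal U\widehat A\mathcal U^{-1}$, $B=\mathcal UA\mathcal U^{-1}$. Characteristic function of a triple $(\dot A,\widehat A,A)$: choose $g_\pm\in\operatorname{Ker}((\dot A)^*\mp iI)$, $\|g_\pm\|=1$, with $g_+-g_-\in\operatorname{Dom}(A)$, and let $\kappa$, $|\kappa|<1$, be such that $g_+-\kappa g_-\in\operatorname{Dom}(\widehat A)$. The Livšic function of $(\dot A,A)$ is $$s(z)=\frac{z-i}{z+i}\cdot\frac{(g_z,g_-)}{(g_z,g_+)},\quad z\in\mathbb C_+,\quad 0\ne g_z\in\operatorname{Ker}((\dot A)^*-zI)\text{ arbitrary},$$ and $$S(z)=\frac{s(z)-\kappa}{\overline\kappa\,s(z)-1},\quad z\in\mathbb C_+ .$$ (In particular $S(i)=\kappa$.) Weyl–Titchmarsh function of $(\dot A,A)$: $M(z)=((Az+I)(A-zI)^{-1}g_+,g_+)$, $z\in\mathbb C_+$. Its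 representing measure is the infinite Borel measure $\mu$ on $\mathbb R$ with $\int_{\mathbb R}\frac{d\mu(\lambda)}{1+\lambda^2}=1$ and $$M(z)=\int_{\mathbb R}\left(\frac1{\lambda-z}-\frac{\lambda}{1+\lambda^2}\right)d\mu(\lambda).$$ Model triple in $L^2(\mathbb R;d\mu)$ with parameter $S$: $\mathcal B$ is multiplication by the independent variable on $\operatorname{Dom}(\mathcal B)=\{f\in L^2(\mathbb R;d\mu):\int\lambda^2|f|^2d\mu<\infty\}$; $\dot{\mathcal B}$ is its restriction to $\operatorname{Dom}(\dot{\mathcal B})=\{f\in\operatorname{Dom}(\mathcal B):\int_{\mathbb R}f\,d\mu=0\}$; $\widehat{\mathcal B}$ is the restriction of $(\dot{\mathcal B})^*$ to $$\operatorname{Dom}(\widehat{\mathcal B})=\operatorname{Dom}(\dot{\mathcal B})\dot+\operatorname{span}\left\{\frac1{\cdot-i}-S(i)\frac1{\cdot+i}\right\}.$$ *)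

theory Defs
  imports "HOL-Analysis.Analysis"
begin

section \<open>Complex Hilbert spaces\<close>

text \<open>
  Hilbert spaces carry an explicit carrier set, so that closed subspaces and the spaces
  \<open>L\<^sup>2(\<mu>)\<close> (whose elements depend on the measure \<open>\<mu>\<close>) are covered by the same notion.
\<close>

record 'a hspace =
  hcarrier :: "'a set"
  hzero :: "'a"
  hadd :: "'a \<Rightarrow> 'a \<Rightarrow> 'a"
  hscale :: "complex \<Rightarrow> 'a \<Rightarrow> 'a"
  hinner :: "'a \<Rightarrow> 'a \<Rightarrow> complex"

definition hdiff :: "('a, 'b) hspace_scheme \<Rightarrow> 'a \<Rightarrow> 'a \<Rightarrow> 'a" where
  "hdiff H f g = hadd H f (hscale H (-1) g)"

definition hnorm :: "('a, 'b) hspace_scheme \<Rightarrow> 'a \<Rightarrow> real" where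
  "hnorm H f = sqrt (Re (hinner H f f))"

text \<open>
  The locale \<open>Metric_space\<close> requires nonnegativity and symmetry of the distance function on
  the whole type; hence the value \<open>0\<close> outside the carrier.
\<close>

definition hdist :: "('a, 'b) hspace_scheme \<Rightarrow> 'a \<Rightarrow> 'a \<Rightarrow> real" where
  "hdist H f g =
    (if f \<in> hcarrier H \<and> g \<in> hcarrier H then hnorm H (hdiff H f g) else 0)"

definition htopology :: "('a, 'b) hspace_scheme \<Rightarrow> 'a topology" where
  "htopology H = Metric_space.mtopology (hcarrier H) (hdist H)"

text \<open>The inner product is linear in the first argument.\<close>

locale hilbert_space =
  fixes H :: "('a, 'b) hspace_scheme"
  assumes zero_closed: "hzero H \<in> hcarrier H"
    and add_closed: "\<lbrakk>f \<in> hcarrier H; g \<in> hcarrier H\<rbrakk> \<Longrightarrow> hadd H f g \<in> hcarrier H"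
    and scale_closed: "f \<in> hcarrier H \<Longrightarrow> hscale H c f \<in> hcarrier H"
    and add_assoc: "\<lbrakk>f \<in> hcarrier H; g \<in> hcarrier H; h \<in> hcarrier H\<rbrakk>
      \<Longrightarrow> hadd H (hadd H f g) h = hadd H f (hadd H g h)"
    and add_commute: "\<lbrakk>f \<in> hcarrier H; g \<in> hcarrier H\<rbrakk> \<Longrightarrow> hadd H f g = hadd H g f"
    and add_zero: "f \<in> hcarrier H \<Longrightarrow> hadd H (hzero H) f = f"
    and add_neg: "f \<in> hcarrier H \<Longrightarrow> hadd H f (hscale H (-1) f) = hzero H"
    and scale_one: "f \<in> hcarrier H \<Longrightarrow> hscale H 1 f = f"
    and scale_scale: "f \<in> hcarrier H \<Longrightarrow> hscale H c (hscale H d f) = hscale H (c * d) f"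
    and scale_add_right: "\<lbrakk>f \<in> hcarrier H; g \<in> hcarrier H\<rbrakk>
      \<Longrightarrow> hscale H c (hadd H f g) = hadd H (hscale H c f) (hscale H c g)"
    and scale_add_left: "f \<in> hcarrier H
      \<Longrightarrow> hscale H (c + d) f = hadd H (hscale H c f) (hscale H d f)"
    and inner_add_left: "\<lbrakk>f \<in> hcarrier H; g \<in> hcarrier H; h \<in> hcarrier H\<rbrakk>
      \<Longrightarrow> hinner H (hadd H f g) h = hinner H f h + hinner H g h"
    and inner_scale_left: "\<lbrakk>f \<in> hcarrier H; g \<in> hcarrier H\<rbrakk>
      \<Longrightarrow> hinner H (hscale H c f) g = c * hinner H f g"
    and inner_commute: "\<lbrakk>f \<in> hcarrier H; g \<in> hcarrier H\<rbrakk>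
      \<Longrightarrow> hinner H f g = cnj (hinner H g f)"
    and inner_nonneg: "f \<in> hcarrier H \<Longrightarrow> 0 \<le> Re (hinner H f f)"
    and inner_definite: "\<lbrakk>f \<in> hcarrier H; hinner H f f = 0\<rbrakk> \<Longrightarrow> f = hzero H"
    and complete: "Metric_space.mcomplete (hcarrier H) (hdist H)"

definition closed_subspace :: "('a, 'b) hspace_scheme \<Rightarrow> 'a set \<Rightarrow> bool" where
  "closed_subspace H N \<longleftrightarrow>
    N \<subseteq> hcarrier H \<and> hzero H \<in> N \<and>
    (\<forall>f\<in>N. \<forall>g\<in>N. hadd H f g \<in> N) \<and> (\<forall>c. \<forall>f\<in>N. hscale H c f \<in> N) \<and>
    closedin (htopology H) N"

definition one_dimensional :: "('a, 'b) hspace_scheme \<Rightarrow> 'a set \<Rightarrow> bool" where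
  "one_dimensional H N \<longleftrightarrow>
    (\<exists>g\<in>hcarrier H. g \<noteq> hzero H \<and> N = range (\<lambda>c. hscale H c g))"

definition unitary_map ::
    "('a, 'b) hspace_scheme \<Rightarrow> ('c, 'd) hspace_scheme \<Rightarrow> ('a \<Rightarrow> 'c) \<Rightarrow> bool" where
  "unitary_map H K U \<longleftrightarrow>
    U ` hcarrier H = hcarrier K \<and>
    (\<forall>f\<in>hcarrier H. \<forall>g\<in>hcarrier H. U (hadd H f g) = hadd K (U f) (U g)) \<and>
    (\<forall>c. \<forall>f\<in>hcarrier H. U (hscale H c f) = hscale K c (U f)) \<and>
    (\<forall>f\<in>hcarrier H. \<forall>g\<in>hcarrier H. hinner K (U f) (U g) = hinner H f g)"


section \<open>Unbounded operators\<close>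

text \<open>
  An operator is identified with its graph: \<open>(f, g) \<in> T\<close> means \<open>f \<in> Dom T\<close> and \<open>T f = g\<close>.
  Thus \<open>Domain T\<close> is the domain of \<open>T\<close>, \<open>T \<subseteq> T'\<close> says that \<open>T'\<close> extends \<open>T\<close>, and equality of
  graphs is equality of operators, domains included.
\<close>

type_synonym 'a operator = "('a \<times> 'a) set"

definition linear_operator :: "('a, 'b) hspace_scheme \<Rightarrow> 'a operator \<Rightarrow> bool" where
  "linear_operator H T \<longleftrightarrow>
    T \<subseteq> hcarrier H \<times> hcarrier H \<and> single_valued T \<and> (hzero H, hzero H) \<in> T \<and>
    (\<forall>(f, f')\<in>T. \<forall>(g, g')\<in>T. (hadd H f g, hadd H f' g') \<in> T) \<and>
    (\<forall>c. \<forall>(f, f')\<in>T. (hscale H c f, hscale H c f') \<in> T)"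

definition op_apply :: "'a operator \<Rightarrow> 'a \<Rightarrow> 'a" where
  "op_apply T f = (THE g. (f, g) \<in> T)"

definition restrict_op :: "'a operator \<Rightarrow> 'a set \<Rightarrow> 'a operator" where
  "restrict_op T D = {(f, g) \<in> T. f \<in> D}"

definition op_scale :: "('a, 'b) hspace_scheme \<Rightarrow> complex \<Rightarrow> 'a operator \<Rightarrow> 'a operator" where
  "op_scale H c T = {(f, hscale H c g) | f g. (f, g) \<in> T}"

text \<open>The operator \<open>T + c I\<close>.\<close>

definition op_shift :: "('a, 'b) hspace_scheme \<Rightarrow> 'a operator \<Rightarrow> complex \<Rightarrow> 'a operator" where
  "op_shift H T c = {(f, hadd H g (hscale H c f)) | f g. (f, g) \<in> T}"

definition op_kernel :: "('a, 'b) hspace_scheme \<Rightarrow> 'a operator \<Rightarrow> 'a set" where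
  "op_kernel H T = {f. (f, hzero H) \<in> T}"

definition densely_defined :: "('a, 'b) hspace_scheme \<Rightarrow> 'a operator \<Rightarrow> bool" where
  "densely_defined H T \<longleftrightarrow> htopology H closure_of Domain T = hcarrier H"

definition closed_operator :: "('a, 'b) hspace_scheme \<Rightarrow> 'a operator \<Rightarrow> bool" where
  "closed_operator H T \<longleftrightarrow> closedin (prod_topology (htopology H) (htopology H)) T"

text \<open>The Hilbert space adjoint; the graph of an operator if \<open>T\<close> is densely defined.\<close>

definition adjoint_op :: "('a, 'b) hspace_scheme \<Rightarrow> 'a operator \<Rightarrow> 'a operator" where
  "adjoint_op H T = {(g, h). g \<in> hcarrier H \<and> h \<in> hcarrier H \<and>
    (\<forall>(f, f')\<in>T. hinner H f' g = hinner H f h)}"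

definition symmetric_operator :: "('a, 'b) hspace_scheme \<Rightarrow> 'a operator \<Rightarrow> bool" where
  "symmetric_operator H T \<longleftrightarrow>
    linear_operator H T \<and> (\<forall>(f, f')\<in>T. \<forall>(g, g')\<in>T. hinner H f' g = hinner H f g')"

definition self_adjoint :: "('a, 'b) hspace_scheme \<Rightarrow> 'a operator \<Rightarrow> bool" where
  "self_adjoint H T \<longleftrightarrow> linear_operator H T \<and> densely_defined H T \<and> adjoint_op H T = T"

definition dissipative :: "('a, 'b) hspace_scheme \<Rightarrow> 'a operator \<Rightarrow> bool" where
  "dissipative H T \<longleftrightarrow> linear_operator H T \<and> (\<forall>(f, f')\<in>T. 0 \<le> Im (hinner H f' f))"

definition self_adjoint_extension ::
    "('a, 'b) hspace_scheme \<Rightarrow> 'a operator \<Rightarrow> 'a operator \<Rightarrow> bool" where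
  "self_adjoint_extension H T A \<longleftrightarrow> T \<subseteq> A \<and> self_adjoint H A"

definition maximal_dissipative_extension ::
    "('a, 'b) hspace_scheme \<Rightarrow> 'a operator \<Rightarrow> 'a operator \<Rightarrow> bool" where
  "maximal_dissipative_extension H T D \<longleftrightarrow>
    T \<subseteq> D \<and> dissipative H D \<and> (\<forall>D'. dissipative H D' \<and> D \<subseteq> D' \<longrightarrow> D' = D)"

text \<open>The space \<open>Ker (T\<^sup>* - z I)\<close>.\<close>

definition defect_space :: "('a, 'b) hspace_scheme \<Rightarrow> 'a operator \<Rightarrow> complex \<Rightarrow> 'a set" where
  "defect_space H T z = op_kernel H (op_shift H (adjoint_op H T) (- z))"

definition deficiency_indices_1_1 :: "('a, 'b) hspace_scheme \<Rightarrow> 'a operator \<Rightarrow> bool" where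
  "deficiency_indices_1_1 H T \<longleftrightarrow>
    one_dimensional H (defect_space H T \<i>) \<and> one_dimensional H (defect_space H T (- \<i>))"

text \<open>
  The restriction of \<open>T\<close> to a subspace \<open>N\<close> has domain \<open>Dom T \<inter> N\<close> and is considered as an
  operator in the Hilbert space \<open>N\<close>; in particular its self-adjointness includes the density
  of \<open>Dom T \<inter> N\<close> in \<open>N\<close>.
\<close>

definition prime_operator :: "('a, 'b) hspace_scheme \<Rightarrow> 'a operator \<Rightarrow> bool" where
  "prime_operator H T \<longleftrightarrow>
    \<not> (\<exists>N. closed_subspace H N \<and> N \<noteq> {hzero H} \<and> (\<forall>(f, g)\<in>T. f \<in> N \<longrightarrow> g \<in> N) \<and>
        self_adjoint (H\<lparr>hcarrier := N\<rparr>) (restrict_op T N))"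


section \<open>Unitary equivalence of triples\<close>

text \<open>The operator \<open>U T U\<^sup>-\<^sup>1\<close>.\<close>

definition op_conjugate :: "('a \<Rightarrow> 'c) \<Rightarrow> 'a operator \<Rightarrow> 'c operator" where
  "op_conjugate U T = {(U f, U g) | f g. (f, g) \<in> T}"

fun triples_unitarily_equivalent ::
    "('a, 'b) hspace_scheme \<Rightarrow> 'a operator \<times> 'a operator \<times> 'a operator \<Rightarrow>
     ('c, 'd) hspace_scheme \<Rightarrow> 'c operator \<times> 'c operator \<times> 'c operator \<Rightarrow> bool" where
  "triples_unitarily_equivalent H (T, D, A) K (T', D', A') \<longleftrightarrow>
    (\<exists>U. unitary_map H K U \<and>
      T' = op_conjugate U T \<and> D' = op_conjugate U D \<and> A' = op_conjugate U A)"


section \<open>Livsic, characteristic and Weyl-Titchmarsh functions\<close>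

text \<open>
  The free choices of \<open>g\<^sub>\<plusminus>\<close>, \<open>\<kappa>\<close> and \<open>g\<^sub>z\<close> are made with the choice operator. The functions below
  do not depend on them: \<open>g\<^sub>+ - g\<^sub>- \<in> Dom A\<close> determines the pair \<open>(g\<^sub>+, g\<^sub>-)\<close> up to a common
  unimodular factor.
\<close>

definition deficiency_pair ::
    "('a, 'b) hspace_scheme \<Rightarrow> 'a operator \<Rightarrow> 'a operator \<Rightarrow> 'a \<times> 'a" where
  "deficiency_pair H T A = (SOME (gp, gm).
    gp \<in> defect_space H T \<i> \<and> gm \<in> defect_space H T (- \<i>) \<and>
    hnorm H gp = 1 \<and> hnorm H gm = 1 \<and> hdiff H gp gm \<in> Domain A)"

definition g_plus :: "('a, 'b) hspace_scheme \<Rightarrow> 'a operator \<Rightarrow> 'a operator \<Rightarrow> 'a" where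
  "g_plus H T A = fst (deficiency_pair H T A)"

definition g_minus :: "('a, 'b) hspace_scheme \<Rightarrow> 'a operator \<Rightarrow> 'a operator \<Rightarrow> 'a" where
  "g_minus H T A = snd (deficiency_pair H T A)"

definition von_neumann_parameter ::
    "('a, 'b) hspace_scheme \<Rightarrow> 'a operator \<Rightarrow> 'a operator \<Rightarrow> 'a operator \<Rightarrow> complex" where
  "von_neumann_parameter H T D A = (SOME \<kappa>. cmod \<kappa> < 1 \<and>
    hdiff H (g_plus H T A) (hscale H \<kappa> (g_minus H T A)) \<in> Domain D)"

definition livsic_function ::
    "('a, 'b) hspace_scheme \<Rightarrow> 'a operator \<Rightarrow> 'a operator \<Rightarrow> complex \<Rightarrow> complex" where
  "livsic_function H T A z =
    (let gz = (SOME g. g \<in> defect_space H T z \<and> g \<noteq> hzero H)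
     in (z - \<i>) / (z + \<i>) * (hinner H gz (g_minus H T A) / hinner H gz (g_plus H T A)))"

definition characteristic_function ::
    "('a, 'b) hspace_scheme \<Rightarrow> 'a operator \<Rightarrow> 'a operator \<Rightarrow> 'a operator \<Rightarrow>
     complex \<Rightarrow> complex" where
  "characteristic_function H T D A z =
    (let s = livsic_function H T A z; \<kappa> = von_neumann_parameter H T D A
     in (s - \<kappa>) / (cnj \<kappa> * s - 1))"

text \<open>\<open>M(z) = ((z A + I) (A - z I)\<^sup>-\<^sup>1 g\<^sub>+, g\<^sub>+)\<close>; relational composition is in diagrammatic order.\<close>

definition weyl_function ::
    "('a, 'b) hspace_scheme \<Rightarrow> 'a operator \<Rightarrow> 'a operator \<Rightarrow> complex \<Rightarrow> complex" where
  "weyl_function H T A z =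
    hinner H
      (op_apply ((op_shift H A (- z))\<inverse> O op_shift H (op_scale H z A) 1) (g_plus H T A))
      (g_plus H T A)"

definition representing_measure :: "(complex \<Rightarrow> complex) \<Rightarrow> real measure \<Rightarrow> bool" where
  "representing_measure M \<mu> \<longleftrightarrow>
    sets \<mu> = sets borel \<and> emeasure \<mu> UNIV = \<infinity> \<and>
    (\<integral>\<^sup>+ t. ennreal (1 / (1 + t\<^sup>2)) \<partial>\<mu>) = 1 \<and>
    (\<forall>z. Im z > 0 \<longrightarrow>
      M z = (\<integral> t. 1 / (complex_of_real t - z) - complex_of_real (t / (1 + t\<^sup>2)) \<partial>\<mu>))"


section \<open>The model triple\<close>

definition l2_functions :: "real measure \<Rightarrow> (real \<Rightarrow> complex) set" where
  "l2_functions \<mu> = {f \<in> borel_measurable \<mu>. integrable \<mu> (\<lambda>t. (cmod (f t))\<^sup>2)}"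

definition l2_rel :: "real measure \<Rightarrow> ((real \<Rightarrow> complex) \<times> (real \<Rightarrow> complex)) set" where
  "l2_rel \<mu> = {(f, g). f \<in> l2_functions \<mu> \<and> g \<in> l2_functions \<mu> \<and> (AE t in \<mu>. f t = g t)}"

definition l2_class :: "real measure \<Rightarrow> (real \<Rightarrow> complex) \<Rightarrow> (real \<Rightarrow> complex) set" where
  "l2_class \<mu> f = l2_rel \<mu> `` {f}"

definition l2_rep :: "(real \<Rightarrow> complex) set \<Rightarrow> real \<Rightarrow> complex" where
  "l2_rep X = (SOME f. f \<in> X)"

text \<open>The operations of \<open>L\<^sup>2(\<mu>)\<close> do not depend on the representatives.\<close>

definition L2 :: "real measure \<Rightarrow> (real \<Rightarrow> complex) set hspace" where
  "L2 \<mu> = \<lparr>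
    hcarrier = l2_functions \<mu> // l2_rel \<mu>,
    hzero = l2_class \<mu> (\<lambda>t. 0),
    hadd = (\<lambda>X Y. l2_class \<mu> (\<lambda>t. l2_rep X t + l2_rep Y t)),
    hscale = (\<lambda>c X. l2_class \<mu> (\<lambda>t. c * l2_rep X t)),
    hinner = (\<lambda>X Y. \<integral> t. l2_rep X t * cnj (l2_rep Y t) \<partial>\<mu>)\<rparr>"

definition model_A :: "real measure \<Rightarrow> (real \<Rightarrow> complex) set operator" where
  "model_A \<mu> = {(l2_class \<mu> f, l2_class \<mu> (\<lambda>t. of_real t * f t)) | f.
    f \<in> l2_functions \<mu> \<and> integrable \<mu> (\<lambda>t. t\<^sup>2 * (cmod (f t))\<^sup>2)}"

text \<open>
  The functions in \<open>Dom (model_A \<mu>)\<close> are \<open>\<mu>\<close>-integrable if \<open>1 / (1 + t\<^sup>2)\<close> is, so the condition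
  on the integral is meaningful on that domain.
\<close>

definition model_sym :: "real measure \<Rightarrow> (real \<Rightarrow> complex) set operator" where
  "model_sym \<mu> =
    restrict_op (model_A \<mu>) {l2_class \<mu> f | f. f \<in> l2_functions \<mu> \<and> (\<integral> t. f t \<partial>\<mu>) = 0}"

definition model_diss ::
    "real measure \<Rightarrow> (complex \<Rightarrow> complex) \<Rightarrow> (real \<Rightarrow> complex) set operator" where
  "model_diss \<mu> S =
    (let h = l2_class \<mu> (\<lambda>t. 1 / (of_real t - \<i>) - S \<i> * (1 / (of_real t + \<i>)))
     in restrict_op (adjoint_op (L2 \<mu>) (model_sym \<mu>))
          {hadd (L2 \<mu>) f (hscale (L2 \<mu>) c h) | f c. f \<in> Domain (model_sym \<mu>)})"

end

theory Submission
  imports Defs "HOL-Probability.Levy"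
begin

text \<open>
  Let \<open>R z\<close> be the resolvent of the self-adjoint extension \<open>A\<close> of \<open>T\<close>, and for non-real \<open>z\<close> put
  \<open>\<gamma> z = gp + (z - \<i>) R z gp\<close>, where \<open>gp\<close> spans the deficiency space at \<open>\<i>\<close>. Then \<open>\<gamma> z\<close> spans the
  deficiency space at \<open>z\<close>, and \<open>\<gamma> (- \<i>) = gm\<close>. The resolvent identity reads
  \<open>R w (\<gamma> z) = (\<gamma> z - \<gamma> w) / (z - w)\<close> and yields (\<open>gram\<close>)

    \<open>(z - cnj w) (\<gamma> z, \<gamma> w) = M z - M (cnj w)\<close>

  with the Weyl-Titchmarsh function \<open>M\<close>. So \<open>M\<close> determines the Gram matrix of the family \<open>\<gamma>\<close>.

  If \<open>T\<close> is prime, the family is total (\<open>prime_total\<close>): its orthogonal complement reduces \<open>A\<close>, and \<open>A\<close>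
  agrees with \<open>T\<close> there. Two total families with equal Gram matrices are carried to each other by a
  unitary map (\<open>unitary_extension\<close>). The whole triple can be recovered from the family and one number:
  \<^item> \<open>A\<close> from its resolvent at \<open>\<i>\<close>, which acts on the family by the formula above;
  \<^item> \<open>T\<close> as the part of \<open>A\<close> where \<open>(A - \<i>) f\<close> is orthogonal to \<open>\<gamma> (- \<i>)\<close> (\<open>T_iff\<close>);
  \<^item> the dissipative extension as the restriction of the adjoint of \<open>T\<close> to the domain of \<open>T\<close> extended
    by \<open>\<gamma> \<i> - \<kappa> \<gamma> (- \<i>)\<close>, with a unique \<open>\<kappa>\<close> in the open unit disc (\<open>maximal_dissipative_parameter\<close>).

  Hence \<open>M\<close> and \<open>\<kappa>\<close> determine the triple up to unitary equivalence (\<open>resolvent_models_equivalent\<close>).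

  For the first part of the theorem, the Gram formula with \<open>w = \<i>\<close> and \<open>w = - \<i>\<close> expresses the Livsic
  function as the Cayley transform \<open>(M - \<i>) / (M + \<i>)\<close>, and the characteristic function is its image
  under a Moebius map of the disc with parameter \<open>\<kappa>\<close>. As \<open>M \<i> = \<i>\<close>, its value at \<open>\<i>\<close> is \<open>\<kappa>\<close>; so it
  determines \<open>\<kappa>\<close>, then \<open>M\<close> on the upper half-plane, and by reflection \<open>M\<close> on the lower one.

  For the second part, the functions \<open>1 / (t - z)\<close> in \<open>L\<^sup>2(\<mu>)\<close> take the place of \<open>\<gamma> z\<close>. Partial fractions
  replace the resolvent identity, and the integral representation of \<open>M\<close> says that the Gram matrices
  are equal. The analytic content is that \<open>L\<^sup>2(\<mu>)\<close> is complete (\<open>hilbert_space_L2\<close>) and that these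
  functions are total in it (\<open>kernel_total\<close>): powers of them approximate exponentials, and a function
  is determined by its Fourier transform.
\<close>

section \<open>Inner product spaces with a carrier set\<close>

text \<open>
  The axioms of \<^locale>\<open>hilbert_space\<close> except completeness. For subspaces and for \<open>L\<^sup>2(\<mu>)\<close> these come
  first, and completeness is then proved in terms of the resulting notion of convergence.
\<close>

locale inner_product_space =
  fixes H :: "('a, 'b) hspace_scheme"
  assumes zero_closed: "hzero H \<in> hcarrier H"
    and add_closed: "\<lbrakk>f \<in> hcarrier H; g \<in> hcarrier H\<rbrakk> \<Longrightarrow> hadd H f g \<in> hcarrier H"
    and scale_closed: "f \<in> hcarrier H \<Longrightarrow> hscale H c f \<in> hcarrier H"
    and add_assoc: "\<lbrakk>f \<in> hcarrier H; g \<in> hcarrier H; h \<in> hcarrier H\<rbrakk>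
      \<Longrightarrow> hadd H (hadd H f g) h = hadd H f (hadd H g h)"
    and add_commute: "\<lbrakk>f \<in> hcarrier H; g \<in> hcarrier H\<rbrakk> \<Longrightarrow> hadd H f g = hadd H g f"
    and add_zero: "f \<in> hcarrier H \<Longrightarrow> hadd H (hzero H) f = f"
    and add_neg: "f \<in> hcarrier H \<Longrightarrow> hadd H f (hscale H (-1) f) = hzero H"
    and scale_one: "f \<in> hcarrier H \<Longrightarrow> hscale H 1 f = f"
    and scale_scale: "f \<in> hcarrier H \<Longrightarrow> hscale H c (hscale H d f) = hscale H (c * d) f"
    and scale_add_right: "\<lbrakk>f \<in> hcarrier H; g \<in> hcarrier H\<rbrakk>
      \<Longrightarrow> hscale H c (hadd H f g) = hadd H (hscale H c f) (hscale H c g)"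
    and scale_add_left: "f \<in> hcarrier H
      \<Longrightarrow> hscale H (c + d) f = hadd H (hscale H c f) (hscale H d f)"
    and inner_add_left: "\<lbrakk>f \<in> hcarrier H; g \<in> hcarrier H; h \<in> hcarrier H\<rbrakk>
      \<Longrightarrow> hinner H (hadd H f g) h = hinner H f h + hinner H g h"
    and inner_scale_left: "\<lbrakk>f \<in> hcarrier H; g \<in> hcarrier H\<rbrakk>
      \<Longrightarrow> hinner H (hscale H c f) g = c * hinner H f g"
    and inner_commute: "\<lbrakk>f \<in> hcarrier H; g \<in> hcarrier H\<rbrakk>
      \<Longrightarrow> hinner H f g = cnj (hinner H g f)"
    and inner_nonneg: "f \<in> hcarrier H \<Longrightarrow> 0 \<le> Re (hinner H f f)"
    and inner_definite: "\<lbrakk>f \<in> hcarrier H; hinner H f f = 0\<rbrakk> \<Longrightarrow> f = hzero H"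
begin

abbreviation V :: "'a set" where "V \<equiv> hcarrier H"
abbreviation plus_H (infixl "\<oplus>" 65) where "x \<oplus> y \<equiv> hadd H x y"
abbreviation minus_H (infixl "\<ominus>" 65) where "x \<ominus> y \<equiv> hdiff H x y"
abbreviation scale_H (infixr "\<odot>" 75) where "c \<odot> x \<equiv> hscale H c x"
abbreviation inner_H ("\<langle>_,/ _\<rangle>") where "\<langle>x, y\<rangle> \<equiv> hinner H x y"
abbreviation norm_H where "norm_H x \<equiv> hnorm H x"

lemmas carrier_closed [simp] = zero_closed add_closed scale_closed

lemma diff_closed [simp]: "\<lbrakk>x \<in> V; y \<in> V\<rbrakk> \<Longrightarrow> x \<ominus> y \<in> V"
  by (simp add: hdiff_def)

lemma inner_add_right: "\<lbrakk>x \<in> V; y \<in> V; z \<in> V\<rbrakk> \<Longrightarrow> \<langle>x, y \<oplus> z\<rangle> = \<langle>x, y\<rangle> + \<langle>x, z\<rangle>"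
  using inner_commute[of x "y \<oplus> z"] inner_commute[of x y] inner_commute[of x z]
  by (simp add: inner_add_left)

lemma inner_scale_right: "\<lbrakk>x \<in> V; y \<in> V\<rbrakk> \<Longrightarrow> \<langle>x, c \<odot> y\<rangle> = cnj c * \<langle>x, y\<rangle>"
  using inner_commute[of x "c \<odot> y"] inner_commute[of x y] by (simp add: inner_scale_left)

lemma inner_diff_left: "\<lbrakk>x \<in> V; y \<in> V; z \<in> V\<rbrakk> \<Longrightarrow> \<langle>x \<ominus> y, z\<rangle> = \<langle>x, z\<rangle> - \<langle>y, z\<rangle>"
  by (simp add: hdiff_def inner_add_left inner_scale_left)

lemma inner_diff_right: "\<lbrakk>x \<in> V; y \<in> V; z \<in> V\<rbrakk> \<Longrightarrow> \<langle>x, y \<ominus> z\<rangle> = \<langle>x, y\<rangle> - \<langle>x, z\<rangle>"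
  by (simp add: hdiff_def inner_add_right inner_scale_right)

lemma scale_zero_left: "x \<in> V \<Longrightarrow> 0 \<odot> x = hzero H"
  using add_neg[of x] scale_add_left[of x 1 "-1"] scale_one[of x] by simp

lemma inner_zero_left [simp]: "x \<in> V \<Longrightarrow> \<langle>hzero H, x\<rangle> = 0"
  using inner_scale_left[of x x 0] scale_zero_left[of x] by simp

lemma inner_zero_right [simp]: "x \<in> V \<Longrightarrow> \<langle>x, hzero H\<rangle> = 0"
  using inner_commute[of x "hzero H"] by simp

lemmas inner_simps = inner_add_left inner_add_right inner_scale_left inner_scale_right
  inner_diff_left inner_diff_right

lemma inner_self: "x \<in> V \<Longrightarrow> \<langle>x, x\<rangle> = of_real ((norm_H x)\<^sup>2)"
proof -
  assume x: "x \<in> V"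
  have "Im \<langle>x, x\<rangle> = 0"
    using arg_cong[OF inner_commute[OF x x], of Im] by simp
  then show ?thesis
    using inner_nonneg[OF x] by (simp add: hnorm_def complex_eq_iff)
qed

lemma norm_nonneg [simp]: "x \<in> V \<Longrightarrow> 0 \<le> norm_H x"
  by (simp add: hnorm_def inner_nonneg)

lemma norm_zero [simp]: "norm_H (hzero H) = 0"
  by (simp add: hnorm_def)

lemma norm_eq_zero: "x \<in> V \<Longrightarrow> norm_H x = 0 \<longleftrightarrow> x = hzero H"
  using inner_definite[of x] inner_self[of x] by auto

lemma norm_le_zero: "x \<in> V \<Longrightarrow> norm_H x \<le> 0 \<longleftrightarrow> x = hzero H"
  using norm_nonneg[of x] norm_eq_zero[of x] by linarith

text \<open>
  The carrier is not a type, so the simplifier cannot normalise linear combinations of vectors.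
  Testing against all vectors moves every vector identity into the complex numbers.
\<close>

lemma eqI_inner:
  assumes "x \<in> V" "y \<in> V" "\<And>v. v \<in> V \<Longrightarrow> \<langle>x, v\<rangle> = \<langle>y, v\<rangle>"
  shows "x = y"
proof -
  have "\<langle>x \<ominus> y, x \<ominus> y\<rangle> = 0"
    using assms by (simp add: inner_diff_left)
  then have "x \<ominus> y = hzero H"
    using assms inner_definite by simp
  moreover have "(x \<ominus> y) \<oplus> y = x"
    using assms add_zero[of x] add_neg[of y] add_commute[of x "hzero H"]
    by (simp add: hdiff_def add_assoc add_commute[of "(-1) \<odot> y" y])
  ultimately show ?thesis using add_zero[of y] assms by simp
qed

lemma diff_eq_zero_iff: "\<lbrakk>x \<in> V; y \<in> V\<rbrakk> \<Longrightarrow> x \<ominus> y = hzero H \<longleftrightarrow> x = y"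
  using add_neg[of y] inner_diff_left[of x y] by (auto simp: hdiff_def[of H y y] intro!: eqI_inner)

lemma norm_scale: "x \<in> V \<Longrightarrow> norm_H (c \<odot> x) = cmod c * norm_H x"
proof -
  assume x: "x \<in> V"
  have "\<langle>c \<odot> x, c \<odot> x\<rangle> = of_real ((cmod c * norm_H x)\<^sup>2)"
    using x complex_norm_square[of c] inner_self[of x]
    by (simp add: inner_simps power_mult_distrib)
  then show ?thesis using x by (simp add: hnorm_def[of H "c \<odot> x"])
qed

lemma norm_diff_sym: "\<lbrakk>x \<in> V; y \<in> V\<rbrakk> \<Longrightarrow> norm_H (x \<ominus> y) = norm_H (y \<ominus> x)"
proof -
  assume "x \<in> V" "y \<in> V"
  then have "x \<ominus> y = (-1) \<odot> (y \<ominus> x)"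
    by (intro eqI_inner) (simp_all add: inner_simps)
  then show ?thesis using \<open>x \<in> V\<close> \<open>y \<in> V\<close> by (simp add: norm_scale)
qed

text \<open>
  The length of the component of \<open>x\<close> orthogonal to \<open>y\<close>: its nonnegativity is the Cauchy-Schwarz
  inequality, and its being smaller than \<open>x\<close> makes best approximations orthogonal.
\<close>

lemma norm_residual:
  assumes x: "x \<in> V" and y: "y \<in> V" "norm_H y \<noteq> 0"
  shows "(norm_H (x \<ominus> (\<langle>x, y\<rangle> / of_real ((norm_H y)\<^sup>2)) \<odot> y))\<^sup>2
    = (norm_H x)\<^sup>2 - (cmod \<langle>x, y\<rangle>)\<^sup>2 / (norm_H y)\<^sup>2"
proof -
  let ?n = "of_real ((norm_H y)\<^sup>2) :: complex"
  define c where "c = \<langle>x, y\<rangle> / ?n"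
  have n: "?n \<noteq> 0" using y by simp
  have "of_real ((norm_H (x \<ominus> c \<odot> y))\<^sup>2) = \<langle>x \<ominus> c \<odot> y, x \<ominus> c \<odot> y\<rangle>"
    using x y by (simp add: inner_self)
  also have "\<dots> = \<langle>x, x\<rangle> - cnj c * \<langle>x, y\<rangle> - c * (cnj \<langle>x, y\<rangle> - cnj c * \<langle>y, y\<rangle>)"
    using x y inner_commute[OF y(1) x] by (simp add: inner_simps algebra_simps)
  also have "\<dots> = of_real ((norm_H x)\<^sup>2) - cnj \<langle>x, y\<rangle> * \<langle>x, y\<rangle> / ?n"
    using n by (simp add: inner_self x y c_def field_simps del: of_real_power)
  also have "\<dots> = of_real ((norm_H x)\<^sup>2 - (cmod \<langle>x, y\<rangle>)\<^sup>2 / (norm_H y)\<^sup>2)"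
    using complex_norm_square[of "\<langle>x, y\<rangle>"] by (simp add: mult.commute)
  finally show ?thesis unfolding c_def of_real_eq_iff .
qed

lemma cauchy_schwarz:
  assumes x: "x \<in> V" and y: "y \<in> V"
  shows "cmod \<langle>x, y\<rangle> \<le> norm_H x * norm_H y"
proof (cases "norm_H y = 0")
  case True
  then show ?thesis using x y norm_eq_zero by auto
next
  case False
  have "0 \<le> (norm_H x)\<^sup>2 - (cmod \<langle>x, y\<rangle>)\<^sup>2 / (norm_H y)\<^sup>2"
    unfolding norm_residual[OF x y False, symmetric] by simp
  then have "(cmod \<langle>x, y\<rangle>)\<^sup>2 / (norm_H y)\<^sup>2 * (norm_H y)\<^sup>2 \<le> (norm_H x)\<^sup>2 * (norm_H y)\<^sup>2"
    by (intro mult_right_mono) auto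
  then have "(cmod \<langle>x, y\<rangle>)\<^sup>2 \<le> (norm_H x * norm_H y)\<^sup>2"
    using False by (simp add: power_mult_distrib)
  then show ?thesis by (rule power2_le_imp_le) (use x y in simp)
qed

lemma norm_add_square:
  "\<lbrakk>x \<in> V; y \<in> V\<rbrakk> \<Longrightarrow> (norm_H (x \<oplus> y))\<^sup>2 = (norm_H x)\<^sup>2 + (norm_H y)\<^sup>2 + 2 * Re \<langle>x, y\<rangle>"
  using inner_commute[of x y] inner_nonneg[of x] inner_nonneg[of y] inner_nonneg[of "x \<oplus> y"]
  by (simp add: hnorm_def inner_simps)

lemma norm_triangle: "\<lbrakk>x \<in> V; y \<in> V\<rbrakk> \<Longrightarrow> norm_H (x \<oplus> y) \<le> norm_H x + norm_H y"
proof -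
  assume xy: "x \<in> V" "y \<in> V"
  have "(norm_H (x \<oplus> y))\<^sup>2 \<le> (norm_H x + norm_H y)\<^sup>2"
    using cauchy_schwarz[OF xy] complex_Re_le_cmod[of "\<langle>x, y\<rangle>"] norm_add_square[OF xy]
    by (simp add: power2_sum)
  then show ?thesis by (rule power2_le_imp_le) (use xy in simp)
qed

lemma norm_triangle_diff:
  assumes "x \<in> V" "y \<in> V" "z \<in> V"
  shows "norm_H (x \<ominus> z) \<le> norm_H (x \<ominus> y) + norm_H (y \<ominus> z)"
proof -
  have "x \<ominus> z = (x \<ominus> y) \<oplus> (y \<ominus> z)"
    using assms by (intro eqI_inner) (simp_all add: inner_simps)
  then show ?thesis using norm_triangle[of "x \<ominus> y" "y \<ominus> z"] assms by simp
qed

sublocale metric: Metric_space "hcarrier H" "hdist H"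
proof
  show "0 \<le> hdist H x y" for x y by (simp add: hdist_def)
  show "hdist H x y = hdist H y x" for x y by (simp add: hdist_def norm_diff_sym)
  show "hdist H x y = 0 \<longleftrightarrow> x = y" if "x \<in> V" "y \<in> V" for x y
    using that by (simp add: hdist_def norm_eq_zero diff_eq_zero_iff)
  show "hdist H x z \<le> hdist H x y + hdist H y z" if "x \<in> V" "y \<in> V" "z \<in> V" for x y z
    using that norm_triangle_diff by (simp add: hdist_def)
qed

definition converges :: "(nat \<Rightarrow> 'a) \<Rightarrow> 'a \<Rightarrow> bool" where
  "converges s x \<longleftrightarrow> range s \<subseteq> V \<and> x \<in> V \<and> (\<lambda>n. norm_H (s n \<ominus> x)) \<longlonglongrightarrow> 0"

lemma converges_limitin: "range s \<subseteq> V \<Longrightarrow> converges s x \<longleftrightarrow> limitin (htopology H) s x sequentially"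
proof -
  assume s: "range s \<subseteq> V"
  have "hdist H (s n) x = norm_H (s n \<ominus> x)" if "x \<in> V" for n
    using s that by (auto simp: hdist_def image_subset_iff)
  then show ?thesis
    using s by (auto simp: converges_def htopology_def metric.limitin_metric_dist_null image_subset_iff
        cong: conj_cong)
qed

lemma converges_cauchy:
  assumes "converges s x" "e > 0"
  shows "\<exists>N. \<forall>m\<ge>N. \<forall>n\<ge>N. norm_H (s m \<ominus> s n) < e"
proof -
  have V: "s n \<in> V" "x \<in> V" for n using assms by (auto simp: converges_def)
  obtain N where N: "\<And>n. n \<ge> N \<Longrightarrow> norm_H (s n \<ominus> x) < e / 2"
    using order_tendstoD(2)[of "\<lambda>n. norm_H (s n \<ominus> x)" 0 sequentially "e / 2"] assms
    by (auto simp: converges_def eventually_sequentially)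
  have "norm_H (s m \<ominus> s n) < e" if "m \<ge> N" "n \<ge> N" for m n
    using N[OF that(1)] N[OF that(2)] norm_triangle_diff[OF V(1)[of m] V(2) V(1)[of n]]
      norm_diff_sym[OF V(2) V(1)[of n]] by simp
  then show ?thesis by blast
qed

lemma converges_inner_left:
  assumes "converges s x" "y \<in> V"
  shows "(\<lambda>n. \<langle>s n, y\<rangle>) \<longlonglongrightarrow> \<langle>x, y\<rangle>"
proof -
  have V: "s n \<in> V" "x \<in> V" for n using assms by (auto simp: converges_def)
  have "(\<lambda>n. norm_H (s n \<ominus> x) * norm_H y) \<longlonglongrightarrow> 0"
    using assms by (auto simp: converges_def intro: tendsto_mult_left_zero)
  moreover have "norm (\<langle>s n, y\<rangle> - \<langle>x, y\<rangle>) \<le> norm_H (s n \<ominus> x) * norm_H y" for n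
    using cauchy_schwarz[of "s n \<ominus> x" y] V assms(2) by (simp add: inner_diff_left)
  ultimately have "(\<lambda>n. \<langle>s n, y\<rangle> - \<langle>x, y\<rangle>) \<longlonglongrightarrow> 0"
    by (rule Lim_null_comparison[OF always_eventually[OF allI], rotated])
  then show ?thesis by (simp add: LIM_zero_iff)
qed

lemma converges_inner_right:
  assumes "converges s x" "y \<in> V"
  shows "(\<lambda>n. \<langle>y, s n\<rangle>) \<longlonglongrightarrow> \<langle>y, x\<rangle>"
proof -
  have V: "s n \<in> V" "x \<in> V" for n using assms by (auto simp: converges_def)
  show ?thesis
    using tendsto_cnj[OF converges_inner_left[OF assms]]
    by (simp add: inner_commute[OF V(2) assms(2), symmetric] inner_commute[OF V(1) assms(2), symmetric]
        inner_commute[OF assms(2) V(1)] inner_commute[OF assms(2) V(2)])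
qed

lemma converges_inner:
  assumes "converges s x" "converges t y"
  shows "(\<lambda>n. \<langle>s n, t n\<rangle>) \<longlonglongrightarrow> \<langle>x, y\<rangle>"
proof -
  have V: "s n \<in> V" "x \<in> V" "t n \<in> V" "y \<in> V" for n using assms by (auto simp: converges_def)
  have b: "\<langle>s n, t n\<rangle> = \<langle>s n \<ominus> x, t n \<ominus> y\<rangle> + \<langle>s n, y\<rangle> + \<langle>x, t n\<rangle> - \<langle>x, y\<rangle>" for n
    using V by (simp add: inner_simps)
  have "(\<lambda>n. norm_H (s n \<ominus> x) * norm_H (t n \<ominus> y)) \<longlonglongrightarrow> 0"
    using assms tendsto_mult[of "\<lambda>n. norm_H (s n \<ominus> x)" 0 _ "\<lambda>n. norm_H (t n \<ominus> y)" 0]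
    by (simp add: converges_def)
  moreover have "norm \<langle>s n \<ominus> x, t n \<ominus> y\<rangle> \<le> norm_H (s n \<ominus> x) * norm_H (t n \<ominus> y)" for n
    by (rule cauchy_schwarz) (simp_all add: V)
  ultimately have "(\<lambda>n. \<langle>s n \<ominus> x, t n \<ominus> y\<rangle>) \<longlonglongrightarrow> 0"
    by (rule Lim_null_comparison[OF always_eventually[OF allI], rotated])
  then have "(\<lambda>n. \<langle>s n, t n\<rangle>) \<longlonglongrightarrow> 0 + \<langle>x, y\<rangle> + \<langle>x, y\<rangle> - \<langle>x, y\<rangle>"
    unfolding b by (intro tendsto_intros converges_inner_left[OF assms(1) V(4)]
        converges_inner_right[OF assms(2) V(2)])
  then show ?thesis by simp
qed

lemma converges_add:
  assumes "converges s x" "converges t y"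
  shows "converges (\<lambda>n. s n \<oplus> t n) (x \<oplus> y)"
proof -
  have V: "s n \<in> V" "x \<in> V" "t n \<in> V" "y \<in> V" for n using assms by (auto simp: converges_def)
  have e: "(s n \<oplus> t n) \<ominus> (x \<oplus> y) = (s n \<ominus> x) \<oplus> (t n \<ominus> y)" for n
    using V by (intro eqI_inner) (simp_all add: inner_simps)
  have "(\<lambda>n. norm_H (s n \<ominus> x) + norm_H (t n \<ominus> y)) \<longlonglongrightarrow> 0"
    using assms tendsto_add[of "\<lambda>n. norm_H (s n \<ominus> x)" 0 _ "\<lambda>n. norm_H (t n \<ominus> y)" 0]
    by (simp add: converges_def)
  moreover have "norm (norm_H ((s n \<oplus> t n) \<ominus> (x \<oplus> y))) \<le> norm_H (s n \<ominus> x) + norm_H (t n \<ominus> y)" for n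
    using norm_triangle[of "s n \<ominus> x" "t n \<ominus> y"] V by (simp add: e)
  ultimately have "(\<lambda>n. norm_H ((s n \<oplus> t n) \<ominus> (x \<oplus> y))) \<longlonglongrightarrow> 0"
    by (rule Lim_null_comparison[OF always_eventually[OF allI], rotated])
  then show ?thesis using V by (auto simp: converges_def)
qed

lemma converges_scale:
  assumes "converges s x"
  shows "converges (\<lambda>n. c \<odot> s n) (c \<odot> x)"
proof -
  have V: "s n \<in> V" "x \<in> V" for n using assms by (auto simp: converges_def)
  have e: "c \<odot> s n \<ominus> c \<odot> x = c \<odot> (s n \<ominus> x)" for n
    using V by (intro eqI_inner) (simp_all add: inner_simps algebra_simps)
  show ?thesis
    using assms V tendsto_mult_right_zero[of "\<lambda>n. norm_H (s n \<ominus> x)" sequentially "cmod c"]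
    by (auto simp: converges_def e norm_scale)
qed

lemma converges_const: "x \<in> V \<Longrightarrow> converges (\<lambda>n. x) x"
  by (auto simp: converges_def diff_eq_zero_iff[THEN iffD2])

text \<open>
  The distance of two points of the carrier is the norm of their difference, so completeness is a
  statement about norms.
\<close>

lemma hilbert_spaceI:
  assumes cau: "\<And>s. \<lbrakk>range s \<subseteq> V; \<And>e. e > 0 \<Longrightarrow> \<exists>N. \<forall>m\<ge>N. \<forall>n\<ge>N. norm_H (s m \<ominus> s n) < e\<rbrakk>
    \<Longrightarrow> \<exists>x. converges s x"
  shows "hilbert_space H"
proof (intro hilbert_space.intro)
  show "metric.mcomplete" unfolding metric.mcomplete_def
  proof (intro allI impI)
    fix s assume s: "metric.MCauchy s"
    then have V: "range s \<subseteq> V" by (simp add: metric.MCauchy_def)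
    have "hdist H (s m) (s n) = norm_H (s m \<ominus> s n)" for m n
      using V by (auto simp: hdist_def image_subset_iff)
    then obtain x where "converges s x"
      using s cau[OF V] unfolding metric.MCauchy_def by auto
    then show "\<exists>x. limitin metric.mtopology s x sequentially"
      using converges_limitin[OF V] by (auto simp: htopology_def)
  qed
qed (fact zero_closed add_closed scale_closed add_assoc add_commute add_zero add_neg scale_one
    scale_scale scale_add_right scale_add_left inner_add_left inner_scale_left inner_commute
    inner_nonneg inner_definite)+

end

sublocale hilbert_space \<subseteq> inner_product_space H
  by (intro inner_product_space.intro)
    (fact zero_closed add_closed scale_closed add_assoc add_commute add_zero add_neg scale_one
      scale_scale scale_add_right scale_add_left inner_add_left inner_scale_left inner_commute
      inner_nonneg inner_definite)+

section \<open>Orthogonal projections in Hilbert spaces\<close>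

context hilbert_space
begin

lemma cauchy_converges:
  assumes s: "range s \<subseteq> V"
    and cau: "\<And>e. e > 0 \<Longrightarrow> \<exists>N. \<forall>m\<ge>N. \<forall>n\<ge>N. norm_H (s m \<ominus> s n) < e"
  shows "\<exists>x. converges s x"
proof -
  have "hdist H (s m) (s n) = norm_H (s m \<ominus> s n)" for m n
    using s by (auto simp: hdist_def image_subset_iff)
  then have "metric.MCauchy s"
    using s cau unfolding metric.MCauchy_def by auto
  then show ?thesis
    using complete converges_limitin[OF s] unfolding metric.mcomplete_def htopology_def by blast
qed

text \<open>
  Not assumed to be topologically closed: domains and ranges of unbounded operators are subspaces
  in this sense.
\<close>

definition subspace :: "'a set \<Rightarrow> bool" where
  "subspace X \<longleftrightarrow> X \<subseteq> V \<and> hzero H \<in> X \<and> (\<forall>x\<in>X. \<forall>y\<in>X. x \<oplus> y \<in> X) \<and> (\<forall>c. \<forall>x\<in>X. c \<odot> x \<in> X)"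

lemma parallelogram:
  assumes "u \<in> V" "v \<in> V"
  shows "(norm_H (u \<ominus> v))\<^sup>2 = 2 * (norm_H u)\<^sup>2 + 2 * (norm_H v)\<^sup>2 - 4 * (norm_H ((1/2) \<odot> (u \<oplus> v)))\<^sup>2"
proof -
  have *: "norm_H ((1/2) \<odot> (u \<oplus> v)) = norm_H (u \<oplus> v) / 2"
    using assms by (simp add: norm_scale)
  have "u \<ominus> v = u \<oplus> (-1) \<odot> v" by (simp add: hdiff_def)
  then show ?thesis
    using assms norm_add_square[of u v] norm_add_square[of u "(-1) \<odot> v"]
    by (simp add: * power_divide norm_scale inner_simps field_simps)
qed

text \<open>
  The orthogonal projection onto the closure of a subspace. Keeping the approximating sequence in
  the statement serves closed subspaces and dense subspaces alike.
\<close>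

lemma orthogonal_projection:
  assumes X: "subspace X" and x: "x \<in> V"
  obtains s p where "range s \<subseteq> X" "converges s p" "\<And>u. u \<in> X \<Longrightarrow> \<langle>x \<ominus> p, u\<rangle> = 0"
proof -
  have XV: "X \<subseteq> V" using X by (simp add: subspace_def)
  define D where "D = (\<lambda>u. (norm_H (x \<ominus> u))\<^sup>2) ` X"
  define d where "d = Inf D"
  have D0: "D \<noteq> {}" using X by (auto simp: D_def subspace_def)
  have Db: "bdd_below D" by (rule bdd_belowI[of _ 0]) (auto simp: D_def)
  have dle: "d \<le> (norm_H (x \<ominus> u))\<^sup>2" if "u \<in> X" for u
    unfolding d_def using that Db by (intro cInf_lower) (auto simp: D_def)
  have "\<exists>u\<in>X. (norm_H (x \<ominus> u))\<^sup>2 < d + 1 / real (Suc n)" for n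
  proof -
    have "Inf D < d + 1 / real (Suc n)" by (simp add: d_def)
    then show ?thesis using cInf_lessD[OF D0] by (auto simp: D_def)
  qed
  then obtain s where sX: "\<And>n. s n \<in> X" and sn: "\<And>n. (norm_H (x \<ominus> s n))\<^sup>2 < d + 1 / real (Suc n)"
    by metis
  have sV: "s n \<in> V" for n using sX XV by auto
  have half: "(norm_H (s m \<ominus> s n))\<^sup>2 \<le> 2 / real (Suc m) + 2 / real (Suc n)" for m n
  proof -
    \<comment> \<open>The midpoint is at distance at least \<open>sqrt d\<close>, so two nearly optimal points are close.\<close>
    have mid: "(1/2) \<odot> (s m \<oplus> s n) \<in> X" using X sX by (simp add: subspace_def)
    have e1: "(x \<ominus> s n) \<ominus> (x \<ominus> s m) = s m \<ominus> s n"
      using x sV by (intro eqI_inner) (simp_all add: inner_simps)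
    have e2: "(1/2) \<odot> ((x \<ominus> s n) \<oplus> (x \<ominus> s m)) = x \<ominus> (1/2) \<odot> (s m \<oplus> s n)"
      using x sV by (intro eqI_inner) (simp_all add: inner_simps algebra_simps)
    show ?thesis
      using parallelogram[of "x \<ominus> s n" "x \<ominus> s m"] dle[OF mid] sn[of m] sn[of n] x sV
      by (simp add: e1 e2)
  qed
  have "\<exists>p. converges s p"
  proof (rule cauchy_converges)
    show "range s \<subseteq> V" using sV by auto
    fix e :: real assume e: "e > 0"
    obtain N where N: "1 / real (Suc N) < e\<^sup>2 / 4"
      using reals_Archimedean[of "e\<^sup>2 / 4"] e by (auto simp: inverse_eq_divide)
    have "norm_H (s m \<ominus> s n) < e" if "m \<ge> N" "n \<ge> N" for m n
    proof -
      have "1 / real (Suc m) \<le> 1 / real (Suc N)" "1 / real (Suc n) \<le> 1 / real (Suc N)"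
        using that by (auto intro!: divide_left_mono)
      then have "(norm_H (s m \<ominus> s n))\<^sup>2 < e\<^sup>2" using half[of m n] N by simp
      then show ?thesis by (rule power2_less_imp_less) (use e in simp)
    qed
    then show "\<exists>N. \<forall>m\<ge>N. \<forall>n\<ge>N. norm_H (s m \<ominus> s n) < e" by blast
  qed
  then obtain p where p: "converges s p" by blast
  have pV: "p \<in> V" using p by (simp add: converges_def)
  have lim: "converges (\<lambda>n. x \<ominus> s n) (x \<ominus> p)"
    unfolding hdiff_def by (intro converges_add converges_const x converges_scale p)
  have npd: "(norm_H (x \<ominus> p))\<^sup>2 \<le> d"
  proof -
    have "(\<lambda>n. Re \<langle>x \<ominus> s n, x \<ominus> s n\<rangle>) \<longlonglongrightarrow> Re \<langle>x \<ominus> p, x \<ominus> p\<rangle>"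
      by (intro tendsto_intros converges_inner lim)
    moreover have "(\<lambda>n. d + 1 / real (Suc n)) \<longlonglongrightarrow> d + 0"
      by (intro tendsto_intros) (use LIMSEQ_inverse_real_of_nat in \<open>simp add: inverse_eq_divide\<close>)
    ultimately show ?thesis
      using sn x sV pV less_imp_le by (intro LIMSEQ_le[of "\<lambda>n. Re \<langle>x \<ominus> s n, x \<ominus> s n\<rangle>"])
         (auto simp: inner_self simp del: of_real_power intro!: exI[of _ 0])
  qed
  have "\<langle>x \<ominus> p, u\<rangle> = 0" if u: "u \<in> X" for u
  proof (cases "norm_H u = 0")
    case True
    then show ?thesis using u XV x pV norm_eq_zero by auto
  next
    case False
    have uV: "u \<in> V" using u XV by auto
    \<comment> \<open>Moving \<open>p\<close> by this multiple of \<open>u\<close> lowers the distance, unless the inner product vanishes.\<close>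
    define c where "c = \<langle>x \<ominus> p, u\<rangle> / of_real ((norm_H u)\<^sup>2)"
    have conv: "converges (\<lambda>n. x \<ominus> (s n \<oplus> c \<odot> u)) (x \<ominus> (p \<oplus> c \<odot> u))"
      unfolding hdiff_def
      by (intro converges_add converges_const x converges_scale p scale_closed uV)
    have ge: "d \<le> Re \<langle>x \<ominus> (s n \<oplus> c \<odot> u), x \<ominus> (s n \<oplus> c \<odot> u)\<rangle>" for n
      using dle[of "s n \<oplus> c \<odot> u"] X sX u x sV uV
      by (simp add: subspace_def inner_self del: of_real_power)
    have "d \<le> Re \<langle>x \<ominus> (p \<oplus> c \<odot> u), x \<ominus> (p \<oplus> c \<odot> u)\<rangle>"
      by (rule LIMSEQ_le_const[where X = "\<lambda>n. Re \<langle>x \<ominus> (s n \<oplus> c \<odot> u), x \<ominus> (s n \<oplus> c \<odot> u)\<rangle>"])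
         (intro tendsto_intros converges_inner conv, use ge in auto)
    also have "x \<ominus> (p \<oplus> c \<odot> u) = (x \<ominus> p) \<ominus> c \<odot> u"
      using x pV uV by (intro eqI_inner) (simp_all add: inner_simps)
    also have "Re \<langle>(x \<ominus> p) \<ominus> c \<odot> u, (x \<ominus> p) \<ominus> c \<odot> u\<rangle> = (norm_H ((x \<ominus> p) \<ominus> c \<odot> u))\<^sup>2"
      using x pV uV by (simp add: inner_self del: of_real_power)
    also have "\<dots> = (norm_H (x \<ominus> p))\<^sup>2 - (cmod \<langle>x \<ominus> p, u\<rangle>)\<^sup>2 / (norm_H u)\<^sup>2"
      unfolding c_def using x pV by (intro norm_residual uV False) simp
    finally have "(cmod \<langle>x \<ominus> p, u\<rangle>)\<^sup>2 / (norm_H u)\<^sup>2 \<le> 0" using npd by simp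
    then have "(cmod \<langle>x \<ominus> p, u\<rangle>)\<^sup>2 \<le> 0" using False by (simp add: divide_le_0_iff)
    then show ?thesis by simp
  qed
  with sX p show thesis by (intro that[of s p]) auto
qed

lemma dense_sequence:
  assumes X: "subspace X" and tot: "\<And>v. \<lbrakk>v \<in> V; \<And>u. u \<in> X \<Longrightarrow> \<langle>v, u\<rangle> = 0\<rbrakk> \<Longrightarrow> v = hzero H"
    and x: "x \<in> V"
  obtains s where "range s \<subseteq> X" "converges s x"
proof -
  obtain s p where sp: "range s \<subseteq> X" "converges s p" "\<And>u. u \<in> X \<Longrightarrow> \<langle>x \<ominus> p, u\<rangle> = 0"
    using orthogonal_projection[OF X x] by blast
  have "p \<in> V" using sp by (simp add: converges_def)
  then have "x = p" using tot[of "x \<ominus> p"] sp(3) x diff_eq_zero_iff by auto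
  then show thesis using sp that by blast
qed

lemma
  assumes "linear_operator H T"
  shows linear_carrier: "(f, f') \<in> T \<Longrightarrow> f \<in> V \<and> f' \<in> V"
    and linear_unique: "\<lbrakk>(f, f') \<in> T; (f, f'') \<in> T\<rbrakk> \<Longrightarrow> f' = f''"
    and linear_zero: "(hzero H, hzero H) \<in> T"
    and linear_add: "\<lbrakk>(f, f') \<in> T; (g, g') \<in> T\<rbrakk> \<Longrightarrow> (f \<oplus> g, f' \<oplus> g') \<in> T"
    and linear_scale: "(f, f') \<in> T \<Longrightarrow> (c \<odot> f, c \<odot> f') \<in> T"
    and linear_diff: "\<lbrakk>(f, f') \<in> T; (g, g') \<in> T\<rbrakk> \<Longrightarrow> (f \<ominus> g, f' \<ominus> g') \<in> T"
  using assms unfolding linear_operator_def single_valued_def hdiff_def by blast+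

lemma subspace_Domain:
  assumes "linear_operator H T"
  shows "subspace (Domain T)"
  unfolding subspace_def
proof (intro conjI ballI allI subsetI)
  show "hzero H \<in> Domain T" using linear_zero[OF assms] by blast
  show "x \<in> V" if "x \<in> Domain T" for x using that linear_carrier[OF assms] by blast
  show "x \<oplus> y \<in> Domain T" if "x \<in> Domain T" "y \<in> Domain T" for x y
    using that linear_add[OF assms] by blast
  show "c \<odot> x \<in> Domain T" if "x \<in> Domain T" for c x
    using that linear_scale[OF assms] by blast
qed

text \<open>
  By the projection theorem a subspace is dense as soon as no vector but zero is orthogonal to it.
\<close>

lemma densely_defined_iff:
  assumes "linear_operator H T"
  shows "densely_defined H T \<longleftrightarrow> (\<forall>v\<in>V. (\<forall>(f, g)\<in>T. \<langle>v, f\<rangle> = 0) \<longrightarrow> v = hzero H)"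
proof -
  have X: "subspace (Domain T)" by (rule subspace_Domain[OF assms])
  then have XV: "Domain T \<subseteq> V" by (simp add: subspace_def)
  have cl: "htopology H closure_of Domain T = {x \<in> V. \<exists>s. range s \<subseteq> Domain T \<and> converges s x}"
  proof -
    have "Domain T \<inter> V = Domain T" using XV by blast
    moreover have "converges s x \<longleftrightarrow> limitin metric.mtopology s x sequentially" if "range s \<subseteq> Domain T" for s x
      using converges_limitin[of s x] that XV by (simp add: htopology_def subset_trans)
    ultimately show ?thesis
      unfolding htopology_def metric.closure_of_sequentially by (simp cong: conj_cong)
  qed
  show ?thesis
  proof
    assume dd: "densely_defined H T"
    show "\<forall>v\<in>V. (\<forall>(f, g)\<in>T. \<langle>v, f\<rangle> = 0) \<longrightarrow> v = hzero H"
    proof (intro ballI impI)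
      fix v assume v: "v \<in> V" and z: "\<forall>(f, g)\<in>T. \<langle>v, f\<rangle> = 0"
      have "v \<in> htopology H closure_of Domain T"
        using dd v by (simp add: densely_defined_def)
      then obtain s where s: "range s \<subseteq> Domain T" "converges s v" unfolding cl by blast
      have "\<langle>v, s n\<rangle> = 0" for n using s(1) z by blast
      then have "\<langle>v, v\<rangle> = 0"
        using converges_inner_right[OF s(2) v] by (simp add: LIMSEQ_const_iff)
      then show "v = hzero H" by (rule inner_definite[OF v])
    qed
  next
    assume *: "\<forall>v\<in>V. (\<forall>(f, g)\<in>T. \<langle>v, f\<rangle> = 0) \<longrightarrow> v = hzero H"
    have "v = hzero H" if "v \<in> V" "\<And>u. u \<in> Domain T \<Longrightarrow> \<langle>v, u\<rangle> = 0" for v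
      using * that by blast
    then have "\<exists>s. range s \<subseteq> Domain T \<and> converges s x" if "x \<in> V" for x
      using dense_sequence[OF X _ that] by metis
    then show "densely_defined H T" unfolding densely_defined_def cl by blast
  qed
qed

lemma closed_operator_sequence:
  assumes "closed_operator H T" "T \<subseteq> V \<times> V"
    and "\<And>n. (s n, t n) \<in> T" "converges s x" "converges t y"
  shows "(x, y) \<in> T"
proof (rule limitin_closedin)
  have "range s \<subseteq> V" "range t \<subseteq> V" using assms(4,5) by (auto simp: converges_def)
  then show "limitin (prod_topology (htopology H) (htopology H)) (\<lambda>n. (s n, t n)) (x, y) sequentially"
    using assms(4,5) by (simp add: limitin_pairwise o_def converges_limitin)
  show "closedin (prod_topology (htopology H) (htopology H)) T"
    using assms(1) by (simp add: closed_operator_def)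
qed (use assms(3) in auto)

end

section \<open>Self-adjoint operators and their resolvents\<close>

context hilbert_space
begin

lemma symmetricD:
  assumes "symmetric_operator H T" "(f, f') \<in> T" "(g, g') \<in> T"
  shows "\<langle>f', g\<rangle> = \<langle>f, g'\<rangle>"
  using assms unfolding symmetric_operator_def by blast

lemma symmetric_linear: "symmetric_operator H T \<Longrightarrow> linear_operator H T"
  by (simp add: symmetric_operator_def)

lemma adjointI:
  assumes "g \<in> V" "h \<in> V" "\<And>f f'. (f, f') \<in> T \<Longrightarrow> \<langle>f', g\<rangle> = \<langle>f, h\<rangle>"
  shows "(g, h) \<in> adjoint_op H T"
  using assms unfolding adjoint_op_def by blast

lemma adjointD:
  assumes "(g, h) \<in> adjoint_op H T"
  shows "g \<in> V" "h \<in> V" "\<And>f f'. (f, f') \<in> T \<Longrightarrow> \<langle>f', g\<rangle> = \<langle>f, h\<rangle>"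
  using assms unfolding adjoint_op_def by blast+

lemma defect_space_iff: "g \<in> defect_space H T z \<longleftrightarrow> (g, z \<odot> g) \<in> adjoint_op H T"
proof
  assume "g \<in> defect_space H T z"
  then obtain h where h: "(g, h) \<in> adjoint_op H T" "hzero H = h \<oplus> (- z) \<odot> g"
    unfolding defect_space_def op_kernel_def op_shift_def by auto
  note c = adjointD(1,2)[OF h(1)]
  have "\<langle>h, v\<rangle> = \<langle>z \<odot> g, v\<rangle>" if "v \<in> V" for v
    using arg_cong[OF h(2), of "\<lambda>x. \<langle>x, v\<rangle>"] c that by (simp add: inner_simps)
  then have "h = z \<odot> g" using c by (intro eqI_inner) simp_all
  then show "(g, z \<odot> g) \<in> adjoint_op H T" using h by simp
next
  assume a: "(g, z \<odot> g) \<in> adjoint_op H T"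
  note c = adjointD(1)[OF a]
  have "hzero H = z \<odot> g \<oplus> (- z) \<odot> g"
    using c by (intro eqI_inner) (simp_all add: inner_simps)
  then show "g \<in> defect_space H T z"
    using a unfolding defect_space_def op_kernel_def op_shift_def by blast
qed

text \<open>
  The form \<open>(f', f)\<close> is real, so \<open>(f' - z f, f)\<close> has the imaginary part \<open>- Im z * \<parallel>f\<parallel>\<^sup>2\<close>.
\<close>

lemma symmetric_lower_bound:
  assumes T: "symmetric_operator H T" and f: "(f, f') \<in> T"
  shows "\<bar>Im z\<bar> * norm_H f \<le> norm_H (f' \<ominus> z \<odot> f)"
proof -
  have V: "f \<in> V" "f' \<in> V" using linear_carrier[OF symmetric_linear[OF T] f] by auto
  have "\<langle>f', f\<rangle> = cnj \<langle>f', f\<rangle>"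
    using symmetricD[OF T f f] inner_commute[of f f'] V by simp
  then have "Im \<langle>f', f\<rangle> = 0" by (metis cnj.sel(2) equal_neg_zero)
  then have "Im \<langle>f' \<ominus> z \<odot> f, f\<rangle> = - Im z * (norm_H f)\<^sup>2"
    using V by (simp add: inner_simps inner_self del: of_real_power)
  then have "\<bar>Im z\<bar> * (norm_H f)\<^sup>2 \<le> cmod \<langle>f' \<ominus> z \<odot> f, f\<rangle>"
    using abs_Im_le_cmod[of "\<langle>f' \<ominus> z \<odot> f, f\<rangle>"] by (simp add: abs_mult)
  also have "\<dots> \<le> norm_H (f' \<ominus> z \<odot> f) * norm_H f"
    by (rule cauchy_schwarz) (simp_all add: V)
  finally have "(\<bar>Im z\<bar> * norm_H f) * norm_H f \<le> norm_H (f' \<ominus> z \<odot> f) * norm_H f"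
    by (simp add: power2_eq_square mult.assoc)
  then show ?thesis using V norm_nonneg[OF V(1)]
    by (cases "norm_H f = 0") auto
qed

text \<open>
  The range of \<open>T - z\<close> is closed, by the lower bound and the closedness of \<open>T\<close>; hence it contains
  every vector orthogonal to its orthogonal complement.
\<close>

lemma symmetric_range:
  assumes T: "symmetric_operator H T" and z: "Im z \<noteq> 0" and y: "y \<in> V"
    and cl: "\<And>s t x y. \<lbrakk>\<And>n. (s n, t n) \<in> T; converges s x; converges t y\<rbrakk> \<Longrightarrow> (x, y) \<in> T"
    and orth: "\<And>u. \<lbrakk>u \<in> V; \<And>f f'. (f, f') \<in> T \<Longrightarrow> \<langle>u, f' \<ominus> z \<odot> f\<rangle> = 0\<rbrakk> \<Longrightarrow> \<langle>y, u\<rangle> = 0"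
  obtains f where "(f, y \<oplus> z \<odot> f) \<in> T"
proof -
  note lin = symmetric_linear[OF T]
  define X where "X = {f' \<ominus> z \<odot> f | f f'. (f, f') \<in> T}"
  have c: "f \<in> V" "f' \<in> V" if "(f, f') \<in> T" for f f' using linear_carrier[OF lin that] by auto
  have X: "subspace X" unfolding subspace_def
  proof (intro conjI ballI allI subsetI)
    show "x \<in> V" if "x \<in> X" for x using that c unfolding X_def by auto
    have "hzero H = hzero H \<ominus> z \<odot> hzero H" by (rule eqI_inner) (simp_all add: inner_simps)
    then show "hzero H \<in> X" using linear_zero[OF lin] unfolding X_def by blast
  next
    fix x y assume "x \<in> X" "y \<in> X"
    then obtain f f' g g' where *: "(f, f') \<in> T" "(g, g') \<in> T" "x = f' \<ominus> z \<odot> f" "y = g' \<ominus> z \<odot> g"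
      unfolding X_def by blast
    have "x \<oplus> y = (f' \<oplus> g') \<ominus> z \<odot> (f \<oplus> g)"
      unfolding * using c[OF *(1)] c[OF *(2)]
      by (intro eqI_inner) (simp_all add: inner_simps algebra_simps)
    then show "x \<oplus> y \<in> X" using linear_add[OF lin *(1,2)] unfolding X_def by blast
  next
    fix a x assume "x \<in> X"
    then obtain f f' where *: "(f, f') \<in> T" "x = f' \<ominus> z \<odot> f" unfolding X_def by blast
    have "a \<odot> x = a \<odot> f' \<ominus> z \<odot> (a \<odot> f)"
      unfolding * using c[OF *(1)] by (intro eqI_inner) (simp_all add: inner_simps algebra_simps)
    then show "a \<odot> x \<in> X" using linear_scale[OF lin *(1)] unfolding X_def by blast
  qed
  obtain s p where s: "range s \<subseteq> X" "converges s p" and perp: "\<And>u. u \<in> X \<Longrightarrow> \<langle>y \<ominus> p, u\<rangle> = 0"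
    using orthogonal_projection[OF X y] by blast
  have pV: "p \<in> V" using s by (simp add: converges_def)
  have "\<forall>n. \<exists>f f'. (f, f') \<in> T \<and> s n = f' \<ominus> z \<odot> f" using s(1) unfolding X_def by blast
  then obtain f f' where ff: "\<And>n. (f n, f' n) \<in> T" "\<And>n. s n = f' n \<ominus> z \<odot> f n" by metis
  have fV: "f n \<in> V" "f' n \<in> V" for n using c[OF ff(1)] by auto
  have "\<exists>x. converges f x"
  proof (rule cauchy_converges)
    show "range f \<subseteq> V" using fV by auto
    fix e :: real assume "e > 0"
    then obtain N where N: "\<And>m n. m \<ge> N \<Longrightarrow> n \<ge> N \<Longrightarrow> norm_H (s m \<ominus> s n) < e * \<bar>Im z\<bar>"
      using converges_cauchy[OF s(2), of "e * \<bar>Im z\<bar>"] z by auto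
    have "norm_H (f m \<ominus> f n) < e" if "m \<ge> N" "n \<ge> N" for m n
    proof -
      have "s m \<ominus> s n = (f' m \<ominus> f' n) \<ominus> z \<odot> (f m \<ominus> f n)"
        unfolding ff(2) using fV by (intro eqI_inner) (simp_all add: inner_simps algebra_simps)
      then have "\<bar>Im z\<bar> * norm_H (f m \<ominus> f n) < e * \<bar>Im z\<bar>"
        using symmetric_lower_bound[OF T linear_diff[OF lin ff(1) ff(1)], of z m n] N[OF that] by simp
      then show ?thesis using z by (simp add: mult.commute)
    qed
    then show "\<exists>N. \<forall>m\<ge>N. \<forall>n\<ge>N. norm_H (f m \<ominus> f n) < e" by blast
  qed
  then obtain g where g: "converges f g" by blast
  have gV: "g \<in> V" using g by (simp add: converges_def)
  have "f' n = s n \<oplus> z \<odot> f n" for n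
    unfolding ff(2) using fV by (intro eqI_inner) (simp_all add: inner_simps)
  then have "f' = (\<lambda>n. s n \<oplus> z \<odot> f n)" by blast
  then have "converges f' (p \<oplus> z \<odot> g)"
    by (simp add: converges_add converges_scale s g)
  then have gT: "(g, p \<oplus> z \<odot> g) \<in> T"
    by (rule cl[OF ff(1) g])
  have "p = (p \<oplus> z \<odot> g) \<ominus> z \<odot> g"
    using pV gV by (intro eqI_inner) (simp_all add: inner_simps)
  then have pX: "p \<in> X" using gT unfolding X_def by blast
  have "\<langle>y, y \<ominus> p\<rangle> = 0"
    by (rule orth) (use y pV perp in \<open>auto simp: X_def\<close>)
  moreover have "\<langle>p, y \<ominus> p\<rangle> = 0"
    using perp[OF pX] inner_commute[of p "y \<ominus> p"] y pV by simp
  ultimately have "\<langle>y \<ominus> p, y \<ominus> p\<rangle> = 0" using y pV by (simp add: inner_diff_left[of y p])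
  then have "y = p" using inner_definite[of "y \<ominus> p"] y pV by (simp add: diff_eq_zero_iff)
  then show thesis using that gT by blast
qed

text \<open>
  Let \<open>(g, h)\<close> belong to the adjoint and solve \<open>f' - \<i> f = h - \<i> g\<close> within \<open>T\<close>. Then \<open>g - f\<close> is
  orthogonal to the range of \<open>T + \<i>\<close>, which is the whole space; so \<open>g = f\<close>.
\<close>

lemma self_adjointI_surjective:
  assumes T: "symmetric_operator H T"
    and plus: "\<And>y. y \<in> V \<Longrightarrow> \<exists>f. (f, y \<oplus> \<i> \<odot> f) \<in> T"
    and minus: "\<And>y. y \<in> V \<Longrightarrow> \<exists>f. (f, y \<oplus> (- \<i>) \<odot> f) \<in> T"
  shows "self_adjoint H T"
proof -
  note lin = symmetric_linear[OF T]
  have c: "f \<in> V" "f' \<in> V" if "(f, f') \<in> T" for f f' using linear_carrier[OF lin that] by auto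
  have "v = hzero H" if v: "v \<in> V" and perp: "\<forall>(f, g)\<in>T. \<langle>v, f\<rangle> = 0" for v
  proof -
    obtain f where f: "(f, v \<oplus> \<i> \<odot> f) \<in> T" using plus[OF v] by blast
    obtain g where g: "(g, f \<oplus> (- \<i>) \<odot> g) \<in> T" using minus[of f] c[OF f] by blast
    have fg: "f \<in> V" "g \<in> V" using c[OF f] c[OF g] by auto
    have "\<langle>v \<oplus> \<i> \<odot> f, g\<rangle> = \<langle>f, f \<oplus> (- \<i>) \<odot> g\<rangle>" by (rule symmetricD[OF T f g])
    moreover have "\<langle>v, g\<rangle> = 0" using perp g by blast
    ultimately have "\<langle>f, f\<rangle> = 0" using v fg by (simp add: inner_simps)
    then have f0: "f = hzero H" using inner_definite fg by blast
    have "v \<oplus> \<i> \<odot> f = hzero H" using linear_unique[OF lin f] linear_zero[OF lin] f0 by blast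
    moreover have "v \<oplus> \<i> \<odot> f = v"
      using v unfolding f0 by (intro eqI_inner) (simp_all add: inner_simps)
    ultimately show ?thesis by simp
  qed
  then have "densely_defined H T" using densely_defined_iff[OF lin] by blast
  moreover have "(g, h) \<in> T" if "(g, h) \<in> adjoint_op H T" for g h
  proof -
    note gh = adjointD[OF that]
    obtain f where f: "(f, (h \<ominus> \<i> \<odot> g) \<oplus> \<i> \<odot> f) \<in> T" using plus[of "h \<ominus> \<i> \<odot> g"] gh by auto
    have fV: "f \<in> V" using c[OF f] by simp
    obtain u where u: "(u, (g \<ominus> f) \<oplus> (- \<i>) \<odot> u) \<in> T" using minus[of "g \<ominus> f"] gh fV by auto
    have uV: "u \<in> V" using c[OF u] by simp
    have "\<langle>g \<ominus> f, g \<ominus> f\<rangle> = 0"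
      using gh(3)[OF u] symmetricD[OF T u f] gh(1,2) fV uV by (simp add: inner_simps algebra_simps)
    then have "g = f" using inner_definite[of "g \<ominus> f"] gh fV by (simp add: diff_eq_zero_iff)
    moreover have "(h \<ominus> \<i> \<odot> g) \<oplus> \<i> \<odot> g = h"
      using gh by (intro eqI_inner) (simp_all add: inner_simps)
    ultimately show ?thesis using f by simp
  qed
  moreover have "(g, h) \<in> adjoint_op H T" if "(g, h) \<in> T" for g h
    using c[OF that] symmetricD[OF T _ that] by (intro adjointI) auto
  ultimately show ?thesis using lin unfolding self_adjoint_def by auto
qed

text \<open>
  The solution \<open>f\<close> of \<open>A f - z f = x\<close>, in terms of the graph of \<open>A\<close>.
\<close>

definition resolvent :: "'a operator \<Rightarrow> complex \<Rightarrow> 'a \<Rightarrow> 'a" where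
  "resolvent A z x = (THE f. (f, x \<oplus> z \<odot> f) \<in> A)"

end

locale self_adjoint_op = hilbert_space H for H :: "('a, 'b) hspace_scheme" +
  fixes A :: "'a operator"
  assumes self_adjoint: "self_adjoint H A"
begin

abbreviation R where "R \<equiv> resolvent A"

lemma A_linear: "linear_operator H A" and A_adjoint: "adjoint_op H A = A"
  using self_adjoint by (auto simp: self_adjoint_def)

lemmas A_carrier = linear_carrier[OF A_linear]

lemma A_symmetric: "symmetric_operator H A"
  unfolding symmetric_operator_def using A_linear A_adjoint adjointD(3)[of _ _ A] by auto

text \<open>
  \<open>A\<close> is an adjoint, and adjoints are defined by equations that survive limits.
\<close>

lemma A_closed:
  assumes "\<And>n. (s n, t n) \<in> A" "converges s x" "converges t y"
  shows "(x, y) \<in> A"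
proof -
  have "\<langle>f', x\<rangle> = \<langle>f, y\<rangle>" if f: "(f, f') \<in> A" for f f'
  proof -
    have "\<langle>f', s n\<rangle> = \<langle>f, t n\<rangle>" for n using symmetricD[OF A_symmetric f assms(1)] .
    then show ?thesis
      using converges_inner_right[OF assms(2), of f'] converges_inner_right[OF assms(3), of f]
        A_carrier[OF f] LIMSEQ_unique by auto
  qed
  then have "(x, y) \<in> adjoint_op H A"
    using assms(2,3) by (intro adjointI) (auto simp: converges_def)
  then show ?thesis by (simp add: A_adjoint)
qed

lemma A_injective:
  assumes z: "Im z \<noteq> 0" and f: "(f, x \<oplus> z \<odot> f) \<in> A" and g: "(g, x \<oplus> z \<odot> g) \<in> A" and x: "x \<in> V"
  shows "f = g"
proof -
  have V: "f \<in> V" "g \<in> V" using A_carrier f g by blast+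
  have "((x \<oplus> z \<odot> f) \<ominus> (x \<oplus> z \<odot> g)) \<ominus> z \<odot> (f \<ominus> g) = hzero H"
    using V x by (intro eqI_inner) (simp_all add: inner_simps algebra_simps)
  then have "\<bar>Im z\<bar> * norm_H (f \<ominus> g) \<le> 0"
    using symmetric_lower_bound[OF A_symmetric linear_diff[OF A_linear f g], of z] by simp
  then have "norm_H (f \<ominus> g) = 0" using z V
    by (intro antisym) (auto simp: mult_le_0_iff)
  then show ?thesis using V by (simp add: norm_eq_zero diff_eq_zero_iff)
qed

text \<open>
  A vector orthogonal to the range of \<open>A - z\<close> is an eigenvector of the adjoint \<open>A\<close> for the number
  \<open>cnj z\<close>; it vanishes because \<open>z\<close> is not real. The range is closed, hence everything.
\<close>

lemma resolvent_in_A: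
  assumes z: "Im z \<noteq> 0" and x: "x \<in> V"
  shows "(R z x, x \<oplus> z \<odot> R z x) \<in> A"
proof -
  obtain f where f: "(f, x \<oplus> z \<odot> f) \<in> A"
  proof (rule symmetric_range[OF A_symmetric z x A_closed])
    fix u assume u: "u \<in> V" and perp: "\<And>f f'. (f, f') \<in> A \<Longrightarrow> \<langle>u, f' \<ominus> z \<odot> f\<rangle> = 0"
    have "\<langle>f', u\<rangle> = \<langle>f, cnj z \<odot> u\<rangle>" if f: "(f, f') \<in> A" for f f'
    proof -
      have V: "f \<in> V" "f' \<in> V" using A_carrier[OF f] by auto
      have "\<langle>f' \<ominus> z \<odot> f, u\<rangle> = 0" using perp[OF f] inner_commute[of "f' \<ominus> z \<odot> f" u] V u by simp
      then show ?thesis using V u by (simp add: inner_simps)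
    qed
    then have "(u, cnj z \<odot> u) \<in> A"
      using u adjointI[of u "cnj z \<odot> u" A] by (simp add: A_adjoint)
    moreover have "(hzero H, cnj z \<odot> hzero H) \<in> A"
      using linear_scale[OF A_linear linear_zero[OF A_linear], of 0 ] linear_zero[OF A_linear]
        linear_scale[OF A_linear linear_zero[OF A_linear], of "cnj z"]
        eqI_inner[of "cnj z \<odot> hzero H" "hzero H"] by (simp add: inner_simps)
    moreover have "hzero H \<oplus> cnj z \<odot> v = cnj z \<odot> v" if "v \<in> V" for v
      using that by (simp add: add_zero)
    ultimately have "u = hzero H"
      using A_injective[of "cnj z" u "hzero H" "hzero H"] z u by simp
    then show "\<langle>x, u\<rangle> = 0" using x by simp
  qed
  then have "\<exists>!f. (f, x \<oplus> z \<odot> f) \<in> A"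
    using A_injective[OF z _ _ x] by blast
  then show ?thesis unfolding resolvent_def by (rule theI')
qed

lemma resolvent_closed [simp]: "\<lbrakk>Im z \<noteq> 0; x \<in> V\<rbrakk> \<Longrightarrow> R z x \<in> V"
  using A_carrier[OF resolvent_in_A] by blast

lemma resolvent_unique: "\<lbrakk>Im z \<noteq> 0; x \<in> V; (f, x \<oplus> z \<odot> f) \<in> A\<rbrakk> \<Longrightarrow> R z x = f"
  using A_injective[OF _ resolvent_in_A] by blast

lemma resolvent_of_graph:
  assumes z: "Im z \<noteq> 0" and f: "(f, f') \<in> A"
  shows "R z (f' \<ominus> z \<odot> f) = f"
proof (rule resolvent_unique[OF z])
  have "f \<in> V" "f' \<in> V" using A_carrier[OF f] by auto
  then have "(f' \<ominus> z \<odot> f) \<oplus> z \<odot> f = f'" by (intro eqI_inner) (simp_all add: inner_simps)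
  then show "(f, (f' \<ominus> z \<odot> f) \<oplus> z \<odot> f) \<in> A" using f by simp
qed (use A_carrier[OF f] in simp)

lemma inner_resolvent:
  assumes z: "Im z \<noteq> 0" and xy: "x \<in> V" "y \<in> V"
  shows "\<langle>R z x, y\<rangle> = \<langle>x, R (cnj z) y\<rangle>"
  using symmetricD[OF A_symmetric resolvent_in_A[OF z xy(1)] resolvent_in_A[of "cnj z", OF _ xy(2)]]
    z xy by (simp add: inner_simps)

lemma resolvent_add: "\<lbrakk>Im z \<noteq> 0; x \<in> V; y \<in> V\<rbrakk> \<Longrightarrow> R z (x \<oplus> y) = R z x \<oplus> R z y"
  by (intro eqI_inner) (simp_all add: inner_simps inner_resolvent)

lemma resolvent_scale: "\<lbrakk>Im z \<noteq> 0; x \<in> V\<rbrakk> \<Longrightarrow> R z (c \<odot> x) = c \<odot> R z x"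
  by (intro eqI_inner) (simp_all add: inner_simps inner_resolvent)

lemma resolvent_identity:
  assumes z: "Im z \<noteq> 0" and w: "Im w \<noteq> 0" and x: "x \<in> V"
  shows "R z x \<ominus> R w x = (z - w) \<odot> R z (R w x)"
proof -
  have "(x \<oplus> z \<odot> R z x) \<ominus> (x \<oplus> w \<odot> R w x) = (z - w) \<odot> R w x \<oplus> z \<odot> (R z x \<ominus> R w x)"
    using z w x by (intro eqI_inner) (simp_all add: inner_simps algebra_simps)
  then have "R z ((z - w) \<odot> R w x) = R z x \<ominus> R w x"
    using linear_diff[OF A_linear resolvent_in_A[OF z x] resolvent_in_A[OF w x]] z w x
    by (intro resolvent_unique) auto
  then show ?thesis using z w x by (simp add: resolvent_scale)
qed

lemma norm_resolvent_le:
  assumes z: "Im z \<noteq> 0" and x: "x \<in> V"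
  shows "\<bar>Im z\<bar> * norm_H (R z x) \<le> norm_H x"
proof -
  have "(x \<oplus> z \<odot> R z x) \<ominus> z \<odot> R z x = x"
    using z x by (intro eqI_inner) (simp_all add: inner_simps)
  then show ?thesis
    using symmetric_lower_bound[OF A_symmetric resolvent_in_A[OF z x], of z] by simp
qed

end

section \<open>Symmetric operators with deficiency indices (1,1)\<close>

text \<open>The form shared by the dissipative extensions of \<open>T\<close> and the dissipative model operator.\<close>

abbreviation span_extension :: "('a, 'b) hspace_scheme \<Rightarrow> 'a operator \<Rightarrow> 'a \<Rightarrow> 'a operator" where
  "span_extension H T h \<equiv>
    restrict_op (adjoint_op H T) {hadd H f0 (hscale H c h) | f0 c. f0 \<in> Domain T}"

text \<open>
  Only the deficiency vector at \<open>\<i>\<close> is fixed here; the one at \<open>- \<i>\<close> is then constructed from it and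
  from \<open>A\<close>.
\<close>

locale deficiency_vector = self_adjoint_op H A for H :: "('a, 'b) hspace_scheme" and A :: "'a operator" +
  fixes T :: "'a operator" and gp :: 'a
  assumes T_symmetric: "symmetric_operator H T"
    and T_dense: "densely_defined H T"
    and T_closed: "closed_operator H T"
    and T_sub_A: "T \<subseteq> A"
    and indices: "deficiency_indices_1_1 H T"
    and gp_defect: "gp \<in> defect_space H T \<i>"
    and gp_norm: "norm_H gp = 1"
begin

abbreviation Tadj where "Tadj \<equiv> adjoint_op H T"

lemma T_linear: "linear_operator H T"
  by (rule symmetric_linear[OF T_symmetric])

lemmas T_carrier = linear_carrier[OF T_linear]

lemma gp_adj: "(gp, \<i> \<odot> gp) \<in> Tadj"
  using gp_defect by (simp add: defect_space_iff)

lemma gp_closed [simp]: "gp \<in> V"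
  using adjointD(1)[OF gp_adj] .

lemma gp_unit: "\<langle>gp, gp\<rangle> = 1"
  by (simp add: inner_self gp_norm)

lemma gp_nonzero: "gp \<noteq> hzero H"
  using gp_norm by auto

text \<open>
  The adjoint is single-valued because \<open>T\<close> is densely defined.
\<close>

lemma Tadj_unique:
  assumes "(g, h) \<in> Tadj" "(g, h') \<in> Tadj"
  shows "h = h'"
proof -
  note h = adjointD[OF assms(1)] adjointD[OF assms(2)]
  have "\<langle>h \<ominus> h', f\<rangle> = 0" if f: "(f, f') \<in> T" for f f'
  proof -
    have "\<langle>f, h\<rangle> = \<langle>f, h'\<rangle>" using h(3)[OF f] h(6)[OF f] by simp
    then show ?thesis
      using h T_carrier[OF f] inner_commute[of h f] inner_commute[of h' f]
      by (simp add: inner_diff_left)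
  qed
  then have "h \<ominus> h' = hzero H"
    using T_dense[unfolded densely_defined_iff[OF T_linear], rule_format, of "h \<ominus> h'"] h by auto
  then show ?thesis using h by (simp add: diff_eq_zero_iff)
qed

lemma Tadj_add: "\<lbrakk>(f, f') \<in> Tadj; (g, g') \<in> Tadj\<rbrakk> \<Longrightarrow> (f \<oplus> g, f' \<oplus> g') \<in> Tadj"
  by (rule adjointI) (auto simp: adjointD inner_add_right T_carrier)

lemma Tadj_scale: "(f, f') \<in> Tadj \<Longrightarrow> (c \<odot> f, c \<odot> f') \<in> Tadj"
  by (rule adjointI) (auto simp: adjointD inner_scale_right T_carrier)

lemma Tadj_diff: "\<lbrakk>(f, f') \<in> Tadj; (g, g') \<in> Tadj\<rbrakk> \<Longrightarrow> (f \<ominus> g, f' \<ominus> g') \<in> Tadj"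
  unfolding hdiff_def by (intro Tadj_add Tadj_scale)

lemma A_sub_Tadj: "A \<subseteq> Tadj"
proof
  fix p assume p: "p \<in> A"
  obtain g h where gh: "p = (g, h)" by fastforce
  have "(g, h) \<in> Tadj"
    using p[unfolded gh] T_sub_A A_carrier symmetricD[OF A_symmetric] by (intro adjointI) blast+
  then show "p \<in> Tadj" by (simp add: gh)
qed

lemma T_sub_Tadj: "T \<subseteq> Tadj"
  using T_sub_A A_sub_Tadj by blast

text \<open>Such a vector would be an eigenvector of the symmetric operator \<open>A\<close> for a non-real number.\<close>

lemma defect_not_in_Domain_A:
  assumes g: "(g, z \<odot> g) \<in> Tadj" and z: "Im z \<noteq> 0" and dom: "g \<in> Domain A"
  shows "g = hzero H"
proof -
  obtain h where h: "(g, h) \<in> A" using dom by blast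
  then have "h = z \<odot> g" using A_sub_Tadj g Tadj_unique by blast
  then have gz: "(g, z \<odot> g) \<in> A" and "g \<in> V" using h A_carrier[OF h] by auto
  moreover have "z \<odot> g \<ominus> z \<odot> g = hzero H" using \<open>g \<in> V\<close> by (simp add: diff_eq_zero_iff)
  ultimately show ?thesis
    using symmetric_lower_bound[OF A_symmetric gz, of z] z norm_le_zero[of g]
    by (simp add: mult_le_0_iff)
qed

lemma one_dimensional_span:
  assumes "one_dimensional H N" "g \<in> N" "g \<noteq> hzero H" "f \<in> N"
  shows "\<exists>c. f = c \<odot> g"
proof -
  obtain h where h: "h \<in> V" "N = range (\<lambda>c. c \<odot> h)"
    using assms(1) unfolding one_dimensional_def by blast
  obtain a b where ab: "g = a \<odot> h" "f = b \<odot> h" using assms h by auto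
  have "a \<noteq> 0" using assms(3) ab scale_zero_left[OF h(1)] by auto
  then have "f = (b / a) \<odot> g" using ab h by (simp add: scale_scale)
  then show ?thesis by blast
qed

lemma defect_plus: "(f, \<i> \<odot> f) \<in> Tadj \<Longrightarrow> \<exists>c. f = c \<odot> gp"
  using one_dimensional_span[of "defect_space H T \<i>" gp f] indices gp_defect gp_nonzero
  by (simp add: deficiency_indices_1_1_def defect_space_iff)

text \<open>
  The deficiency vectors at all non-real points, normalised so that \<open>\<gamma> \<i> = gp\<close>; under the spectral
  representation of \<open>A\<close> they become the functions \<open>1 / (t - z)\<close>.
\<close>

definition \<gamma> :: "complex \<Rightarrow> 'a" where
  "\<gamma> z = gp \<oplus> (z - \<i>) \<odot> R z gp"

lemma gamma_closed [simp]: "Im z \<noteq> 0 \<Longrightarrow> \<gamma> z \<in> V"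
  by (simp add: \<gamma>_def)

lemma gamma_i: "\<gamma> \<i> = gp"
  by (intro eqI_inner) (simp_all add: \<gamma>_def inner_simps)

text \<open>
  The resolvent identity. In the spectral representation it is the partial fraction decomposition
  of \<open>1 / ((t - z) (t - w))\<close>.
\<close>

lemma gamma_diff:
  assumes z: "Im z \<noteq> 0" and w: "Im w \<noteq> 0"
  shows "\<gamma> z \<ominus> \<gamma> w = (z - w) \<odot> R w (\<gamma> z)"
proof (rule eqI_inner)
  fix v assume v: "v \<in> V"
  have "\<langle>R w gp, v\<rangle> - \<langle>R z gp, v\<rangle> = (w - z) * \<langle>R w (R z gp), v\<rangle>"
    using arg_cong[OF resolvent_identity[OF w z gp_closed], of "\<lambda>x. \<langle>x, v\<rangle>"] v z w
    by (simp add: inner_simps)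
  moreover have "R w (\<gamma> z) = R w gp \<oplus> (z - \<i>) \<odot> R w (R z gp)"
    using z w by (simp add: \<gamma>_def resolvent_add resolvent_scale)
  moreover have "(z - j) * b - (w - j) * a = (z - w) * (a + (z - j) * c)"
    if "a - b = (w - z) * c" for a b c j :: complex
    using that by algebra
  ultimately show "\<langle>\<gamma> z \<ominus> \<gamma> w, v\<rangle> = \<langle>(z - w) \<odot> R w (\<gamma> z), v\<rangle>"
    using v z w by (simp add: \<gamma>_def inner_simps)
qed (use z w in simp_all)

lemma gamma_adj:
  assumes z: "Im z \<noteq> 0"
  shows "(\<gamma> z, z \<odot> \<gamma> z) \<in> Tadj"
proof -
  have "(R z gp, gp \<oplus> z \<odot> R z gp) \<in> Tadj"
    using resolvent_in_A[OF z] A_sub_Tadj by auto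
  then have "(\<gamma> z, \<i> \<odot> gp \<oplus> (z - \<i>) \<odot> (gp \<oplus> z \<odot> R z gp)) \<in> Tadj"
    unfolding \<gamma>_def by (intro Tadj_add Tadj_scale gp_adj)
  moreover have "\<i> \<odot> gp \<oplus> (z - \<i>) \<odot> (gp \<oplus> z \<odot> R z gp) = z \<odot> \<gamma> z"
    using z by (intro eqI_inner) (simp_all add: \<gamma>_def inner_simps algebra_simps)
  ultimately show ?thesis by simp
qed

text \<open>
  By \<open>gamma_diff\<close>, \<open>\<gamma> z = 0\<close> would propagate to \<open>\<gamma> \<i> = gp\<close>.
\<close>

lemma gamma_nonzero:
  assumes z: "Im z \<noteq> 0"
  shows "\<gamma> z \<noteq> hzero H"
proof
  assume 0: "\<gamma> z = hzero H"
  have "\<gamma> z \<ominus> \<gamma> \<i> = (z - \<i>) \<odot> R \<i> (\<gamma> z)" by (rule gamma_diff) (use z in auto)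
  moreover have "R \<i> (\<gamma> z) = hzero H"
    using resolvent_scale[of \<i> "hzero H" 0] scale_zero_left[of "hzero H"]
      scale_zero_left[of "R \<i> (hzero H)"] unfolding 0 by simp
  moreover have "(z - \<i>) \<odot> hzero H = hzero H"
    by (intro eqI_inner) (simp_all add: inner_simps)
  ultimately have "hzero H = gp" using 0 gamma_i by (simp add: diff_eq_zero_iff)
  then show False using gp_nonzero by simp
qed

lemma defect_gamma:
  assumes z: "Im z \<noteq> 0" and f: "(f, z \<odot> f) \<in> Tadj"
  shows "\<exists>c. f = c \<odot> \<gamma> z"
proof -
  have fV: "f \<in> V" using adjointD[OF f] by simp
  \<comment> \<open>The map \<open>1 + (\<i> - z) R \<i>\<close> carries the deficiency space at \<open>z\<close> to the one at \<open>\<i>\<close>.\<close>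
  define u where "u = f \<oplus> (\<i> - z) \<odot> R \<i> f"
  have uV: "u \<in> V" using fV by (simp add: u_def)
  have "(R \<i> f, f \<oplus> \<i> \<odot> R \<i> f) \<in> Tadj" using resolvent_in_A[of \<i> f] fV A_sub_Tadj by auto
  then have "(u, z \<odot> f \<oplus> (\<i> - z) \<odot> (f \<oplus> \<i> \<odot> R \<i> f)) \<in> Tadj"
    unfolding u_def by (intro Tadj_add Tadj_scale f)
  moreover have "z \<odot> f \<oplus> (\<i> - z) \<odot> (f \<oplus> \<i> \<odot> R \<i> f) = \<i> \<odot> u"
    using fV by (intro eqI_inner) (simp_all add: u_def inner_simps algebra_simps)
  ultimately obtain c where c: "u = c \<odot> gp" using defect_plus by auto
  have "f = u \<oplus> (z - \<i>) \<odot> R z u"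
  proof (rule eqI_inner)
    fix v assume v: "v \<in> V"
    have "\<langle>R z f, v\<rangle> - \<langle>R \<i> f, v\<rangle> = (z - \<i>) * \<langle>R z (R \<i> f), v\<rangle>"
      using arg_cong[OF resolvent_identity[OF z _ fV, of \<i>], of "\<lambda>x. \<langle>x, v\<rangle>"] v z fV
      by (simp add: inner_simps)
    moreover have "(j - z) * b + (z - j) * (a + (j - z) * c) = 0"
      if "a - b = (z - j) * c" for a b c j :: complex
      using that by algebra
    ultimately show "\<langle>f, v\<rangle> = \<langle>u \<oplus> (z - \<i>) \<odot> R z u, v\<rangle>"
      using v z fV by (simp add: u_def inner_simps resolvent_add resolvent_scale)
  qed (use fV uV z in simp_all)
  also have "\<dots> = c \<odot> \<gamma> z"
    unfolding c using z by (intro eqI_inner) (simp_all add: \<gamma>_def inner_simps resolvent_scale algebra_simps)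
  finally show ?thesis by blast
qed

text \<open>
  The Weyl-Titchmarsh function \<open>((z A + 1) R z gp, gp)\<close>, rewritten with \<open>A R z = 1 + z R z\<close>.
\<close>

definition m :: "complex \<Rightarrow> complex" where
  "m z = z + (z\<^sup>2 + 1) * \<langle>R z gp, gp\<rangle>"

lemma m_i: "m \<i> = \<i>" and m_minus_i: "m (- \<i>) = - \<i>"
  by (simp_all add: m_def)

lemma m_cnj: "Im z \<noteq> 0 \<Longrightarrow> m (cnj z) = cnj (m z)"
  using inner_resolvent[of z gp gp] inner_commute[of gp "R (cnj z) gp"]
  by (simp add: m_def)

text \<open>
  Expanding the left side by the definition of \<open>\<gamma>\<close> leaves \<open>(R z gp, R w gp)\<close>, which the resolvent
  identity turns into a difference quotient of \<open>(R z gp, gp)\<close>.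
\<close>

lemma gram:
  assumes z: "Im z \<noteq> 0" and w: "Im w \<noteq> 0"
  shows "(z - cnj w) * \<langle>\<gamma> z, \<gamma> w\<rangle> = m z - m (cnj w)"
proof -
  define r where "r = (\<lambda>z. \<langle>R z gp, gp\<rangle>)"
  have 1: "\<langle>gp, R w gp\<rangle> = r (cnj w)"
    using inner_resolvent[of "cnj w" gp gp] w by (simp add: r_def)
  have 2: "(z - cnj w) * \<langle>R z gp, R w gp\<rangle> = r z - r (cnj w)"
  proof -
    have "(cnj w - z) * \<langle>R (cnj w) (R z gp), gp\<rangle> = r (cnj w) - r z"
      using arg_cong[OF resolvent_identity[of "cnj w" z gp], of "\<lambda>x. \<langle>x, gp\<rangle>"] z w
      by (simp add: inner_simps r_def)
    moreover have "\<langle>R (cnj w) (R z gp), gp\<rangle> = \<langle>R z gp, R w gp\<rangle>"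
      using inner_resolvent[of "cnj w" "R z gp" gp] z w by simp
    ultimately show ?thesis by (simp add: algebra_simps)
  qed
  have g: "\<langle>\<gamma> z, \<gamma> w\<rangle> = 1 + (z - \<i>) * r z + (cnj w + \<i>) * r (cnj w)
      + (z - \<i>) * (cnj w + \<i>) * \<langle>R z gp, R w gp\<rangle>"
    using z w by (simp add: \<gamma>_def inner_simps gp_unit 1 algebra_simps) (simp add: r_def)
  have "(z - cnj w) * \<langle>\<gamma> z, \<gamma> w\<rangle> = (z - cnj w) * (1 + (z - \<i>) * r z + (cnj w + \<i>) * r (cnj w))
      + (z - \<i>) * (cnj w + \<i>) * ((z - cnj w) * \<langle>R z gp, R w gp\<rangle>)"
    unfolding g by (simp add: algebra_simps)
  also have "\<dots> = m z - m (cnj w)"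
    unfolding 2 m_def by (simp add: algebra_simps power2_eq_square) (simp add: r_def)
  finally show ?thesis .
qed

text \<open>
  On the diagonal the Gram formula gives \<open>Im (m z) = Im z * \<parallel>\<gamma> z\<parallel>\<^sup>2\<close>.
\<close>

lemma Im_m_pos: "Im z > 0 \<Longrightarrow> Im (m z) > 0"
proof -
  assume z: "Im z > 0"
  have "(z - cnj z) * of_real ((norm_H (\<gamma> z))\<^sup>2) = m z - cnj (m z)"
    using gram[of z z] z by (simp add: inner_self m_cnj)
  from arg_cong[OF this, of Im] have "Im (m z) = Im z * (norm_H (\<gamma> z))\<^sup>2"
    by (simp add: complex_eq_iff)
  moreover have "norm_H (\<gamma> z) \<noteq> 0" using gamma_nonzero[of z] norm_eq_zero[of "\<gamma> z"] z by simp
  ultimately show ?thesis using z by simp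
qed

lemma gamma_inner_gp: "Im z \<noteq> 0 \<Longrightarrow> (z + \<i>) * \<langle>\<gamma> z, gp\<rangle> = m z + \<i>"
  using gram[of z \<i>] by (simp add: gamma_i m_minus_i)

end

locale deficiency_one = deficiency_vector H A T gp
  for H :: "('a, 'b) hspace_scheme" and A T :: "'a operator" and gp :: 'a +
  fixes gm :: 'a
  assumes gm_defect: "gm \<in> defect_space H T (- \<i>)"
    and gm_norm: "norm_H gm = 1"
    and gp_gm: "gp \<ominus> gm \<in> Domain A"
begin

lemma gm_adj: "(gm, (- \<i>) \<odot> gm) \<in> Tadj"
  using gm_defect by (simp add: defect_space_iff)

lemma gm_closed [simp]: "gm \<in> V"
  using adjointD(1)[OF gm_adj] .

lemma gm_unit: "\<langle>gm, gm\<rangle> = 1"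
  by (simp add: inner_self gm_norm)

lemma gm_nonzero: "gm \<noteq> hzero H"
  using gm_norm by auto

lemma defect_minus: "(f, (- \<i>) \<odot> f) \<in> Tadj \<Longrightarrow> \<exists>c. f = c \<odot> gm"
  using one_dimensional_span[of "defect_space H T (- \<i>)" gm f] indices gm_defect gm_nonzero
  by (simp add: deficiency_indices_1_1_def defect_space_iff)

text \<open>
  Both \<open>gp - \<gamma> (- \<i>)\<close> and \<open>gp - gm\<close> lie in the domain of \<open>A\<close>. So does their difference, which is a
  multiple of \<open>gm\<close>; by \<open>defect_not_in_Domain_A\<close> it vanishes.
\<close>

lemma gamma_minus_i: "\<gamma> (- \<i>) = gm"
proof -
  obtain c where c: "\<gamma> (- \<i>) = c \<odot> gm"
    using gamma_adj[of "- \<i>"] defect_minus by auto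
  have "\<gamma> (- \<i>) \<ominus> gp = (- 2 * \<i>) \<odot> R (- \<i>) gp"
    by (intro eqI_inner) (simp_all add: \<gamma>_def inner_simps)
  moreover have "(- 2 * \<i>) \<odot> R (- \<i>) gp \<in> Domain A"
    using linear_scale[OF A_linear resolvent_in_A[of "- \<i>" gp]] by auto
  ultimately have "(\<gamma> (- \<i>) \<ominus> gp) \<oplus> (gp \<ominus> gm) \<in> Domain A"
    using gp_gm linear_add[OF A_linear] by fastforce
  moreover have "(\<gamma> (- \<i>) \<ominus> gp) \<oplus> (gp \<ominus> gm) = (c - 1) \<odot> gm"
    by (intro eqI_inner) (simp_all add: c inner_simps algebra_simps)
  ultimately have "(c - 1) \<odot> gm \<in> Domain A" by simp
  moreover have "((c - 1) \<odot> gm, (- \<i>) \<odot> (c - 1) \<odot> gm) \<in> Tadj"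
    using Tadj_scale[OF gm_adj, of "c - 1"] by (simp add: scale_scale mult.commute)
  ultimately have "(c - 1) \<odot> gm = hzero H"
    by (intro defect_not_in_Domain_A[where z = "- \<i>"]) auto
  then have "cmod (c - 1) = 0"
    using norm_scale[of gm "c - 1"] gm_norm by simp
  then show ?thesis using c by (simp add: scale_one)
qed

text \<open>
  The range of \<open>T - \<i>\<close> is closed and its orthogonal complement is spanned by \<open>gm\<close>. So if \<open>(A - \<i>) f\<close> is
  orthogonal to \<open>gm\<close>, it equals \<open>(T - \<i>) g\<close> for some \<open>g\<close>, and \<open>f = g\<close> because \<open>A - \<i>\<close> is injective.
\<close>

lemma T_iff: "(f, f') \<in> T \<longleftrightarrow> (f, f') \<in> A \<and> \<langle>f' \<ominus> \<i> \<odot> f, gm\<rangle> = 0"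
proof
  assume T: "(f, f') \<in> T"
  then show "(f, f') \<in> A \<and> \<langle>f' \<ominus> \<i> \<odot> f, gm\<rangle> = 0"
    using adjointD(3)[OF gm_adj T] T_carrier[OF T] T_sub_A by (auto simp: inner_simps)
next
  assume A: "(f, f') \<in> A \<and> \<langle>f' \<ominus> \<i> \<odot> f, gm\<rangle> = 0"
  then have c: "f \<in> V" "f' \<in> V" using A_carrier by auto
  define y where "y = f' \<ominus> \<i> \<odot> f"
  have yV: "y \<in> V" using c by (simp add: y_def)
  have f': "f' = y \<oplus> \<i> \<odot> f" unfolding y_def using c by (intro eqI_inner) (simp_all add: inner_simps)
  obtain g where g: "(g, y \<oplus> \<i> \<odot> g) \<in> T"
  proof (rule symmetric_range[OF T_symmetric _ yV, of \<i>])
    show "(x, y) \<in> T" if "\<And>n. (s n, t n) \<in> T" "converges s x" "converges t y" for s t x y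
      by (rule closed_operator_sequence[OF T_closed _ that]) (use T_carrier in auto)
    fix u assume u: "u \<in> V" and perp: "\<And>f f'. (f, f') \<in> T \<Longrightarrow> \<langle>u, f' \<ominus> \<i> \<odot> f\<rangle> = 0"
    have "(u, (- \<i>) \<odot> u) \<in> Tadj"
    proof (rule adjointI)
      fix f f' assume f: "(f, f') \<in> T"
      have "\<langle>f' \<ominus> \<i> \<odot> f, u\<rangle> = 0"
        using perp[OF f] inner_commute[of "f' \<ominus> \<i> \<odot> f" u] T_carrier[OF f] u by simp
      then show "\<langle>f', u\<rangle> = \<langle>f, (- \<i>) \<odot> u\<rangle>" using T_carrier[OF f] u by (simp add: inner_simps)
    qed (use u in simp_all)
    then obtain c where "u = c \<odot> gm" using defect_minus by blast
    then show "\<langle>y, u\<rangle> = 0" using A yV by (simp add: y_def[symmetric] inner_scale_right)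
  qed auto
  have "f = g"
    using A g T_sub_A yV unfolding f' by (intro A_injective[of \<i> f y g]) auto
  then show "(f, f') \<in> T" using g f' by simp
qed

text \<open>
  Von Neumann's formula. With \<open>h = f' - \<i> f\<close>, the vector \<open>f - R \<i> h\<close> lies in the deficiency space at \<open>\<i>\<close>.
  If \<open>b gm\<close> is the component of \<open>h\<close> along \<open>gm\<close>, then \<open>R \<i> (h - b gm)\<close> lies in the domain of \<open>T\<close> by
  \<open>T_iff\<close>, and \<open>R \<i> gm\<close> is a multiple of \<open>gm - gp\<close> by \<open>gamma_diff\<close>.
\<close>

lemma Tadj_decomposition:
  assumes f: "(f, f') \<in> Tadj"
  obtains f0 a b where "f0 \<in> Domain T" "f = f0 \<oplus> (a \<odot> gp \<oplus> b \<odot> gm)"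
proof -
  have fV: "f \<in> V" "f' \<in> V" using adjointD[OF f] by auto
  define h where "h = f' \<ominus> \<i> \<odot> f"
  have hV: "h \<in> V" using fV by (simp add: h_def)
  have "(f \<ominus> R \<i> h, f' \<ominus> (h \<oplus> \<i> \<odot> R \<i> h)) \<in> Tadj"
    using resolvent_in_A[of \<i> h] hV A_sub_Tadj by (intro Tadj_diff f) auto
  moreover have "f' \<ominus> (h \<oplus> \<i> \<odot> R \<i> h) = \<i> \<odot> (f \<ominus> R \<i> h)"
    unfolding h_def using fV by (intro eqI_inner) (simp_all add: inner_simps algebra_simps)
  ultimately obtain c where c: "f \<ominus> R \<i> h = c \<odot> gp" using defect_plus by auto
  define b where "b = \<langle>h, gm\<rangle>"
  define k where "k = h \<ominus> b \<odot> gm"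
  have kV: "k \<in> V" using hV by (simp add: k_def)
  have "\<langle>k, gm\<rangle> = 0" using hV by (simp add: k_def b_def inner_simps gm_unit)
  moreover have "(k \<oplus> \<i> \<odot> R \<i> k) \<ominus> \<i> \<odot> R \<i> k = k"
    using kV by (intro eqI_inner) (simp_all add: inner_simps)
  ultimately have T: "(R \<i> k, k \<oplus> \<i> \<odot> R \<i> k) \<in> T"
    using resolvent_in_A[of \<i> k] kV by (simp add: T_iff)
  have Rgm: "gm \<ominus> gp = (- 2 * \<i>) \<odot> R \<i> gm"
    using gamma_diff[of "- \<i>" \<i>] by (simp add: gamma_i gamma_minus_i)
  have "f = R \<i> k \<oplus> ((c + b / (2 * \<i>)) \<odot> gp \<oplus> (- b / (2 * \<i>)) \<odot> gm)"
  proof (rule eqI_inner)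
    fix v assume v: "v \<in> V"
    have 1: "\<langle>f, v\<rangle> - \<langle>R \<i> h, v\<rangle> = c * \<langle>gp, v\<rangle>"
      using arg_cong[OF c, of "\<lambda>x. \<langle>x, v\<rangle>"] v fV hV by (simp add: inner_simps)
    have 2: "\<langle>gm, v\<rangle> - \<langle>gp, v\<rangle> = (- 2 * \<i>) * \<langle>R \<i> gm, v\<rangle>"
      using arg_cong[OF Rgm, of "\<lambda>x. \<langle>x, v\<rangle>"] v by (simp add: inner_simps)
    have "h = k \<oplus> b \<odot> gm" unfolding k_def using hV by (intro eqI_inner) (simp_all add: inner_simps)
    then have 3: "\<langle>R \<i> h, v\<rangle> = \<langle>R \<i> k, v\<rangle> + b * \<langle>R \<i> gm, v\<rangle>"
      using v kV by (simp add: resolvent_add resolvent_scale inner_simps)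
    have 4: "\<langle>R \<i> gm, v\<rangle> = (\<langle>gp, v\<rangle> - \<langle>gm, v\<rangle>) / (2 * \<i>)"
      using 2 by (simp add: field_simps)
    show "\<langle>f, v\<rangle> = \<langle>R \<i> k \<oplus> ((c + b / (2 * \<i>)) \<odot> gp \<oplus> (- b / (2 * \<i>)) \<odot> gm), v\<rangle>"
      using v kV 1 3 by (simp add: inner_simps 4) (simp add: field_simps)
  qed (use fV kV in simp_all)
  then show thesis using that T by blast
qed

end

lemma (in deficiency_vector) deficiency_one_gamma: "deficiency_one H A T gp (\<gamma> (- \<i>))"
proof unfold_locales
  show "\<gamma> (- \<i>) \<in> defect_space H T (- \<i>)"
    using gamma_adj[of "- \<i>"] by (simp add: defect_space_iff)
  have "\<langle>\<gamma> (- \<i>), \<gamma> (- \<i>)\<rangle> = 1"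
    using gram[of "- \<i>" "- \<i>"] by (simp add: m_i m_minus_i)
  then show "norm_H (\<gamma> (- \<i>)) = 1" by (simp add: hnorm_def)
  have "gp \<ominus> \<gamma> (- \<i>) = (2 * \<i>) \<odot> R (- \<i>) gp"
    by (intro eqI_inner) (simp_all add: \<gamma>_def inner_simps)
  then show "gp \<ominus> \<gamma> (- \<i>) \<in> Domain A"
    using linear_scale[OF A_linear resolvent_in_A[of "- \<i>" gp]] by auto
qed

section \<open>Maximal dissipative extensions\<close>

context deficiency_one
begin

text \<open>
  The adjoint acts on \<open>gp\<close> and \<open>gm\<close> as \<open>\<i>\<close> and \<open>- \<i>\<close>, and all terms with a vector from the domain of
  \<open>T\<close> cancel.
\<close>

lemma boundary_form:
  assumes f: "(f, f') \<in> Tadj" and g: "(g, g') \<in> Tadj"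
    and f0: "f0 \<in> Domain T" "f = f0 \<oplus> (a \<odot> gp \<oplus> b \<odot> gm)"
    and g0: "g0 \<in> Domain T" "g = g0 \<oplus> (c \<odot> gp \<oplus> d \<odot> gm)"
  shows "\<langle>f', g\<rangle> - \<langle>f, g'\<rangle> = 2 * \<i> * (a * cnj c - b * cnj d)"
proof -
  obtain f0' g0' where T: "(f0, f0') \<in> T" "(g0, g0') \<in> T" using f0 g0 by blast
  note V = T_carrier[OF T(1)] T_carrier[OF T(2)]
  have "(f, f0' \<oplus> (a \<odot> \<i> \<odot> gp \<oplus> b \<odot> (- \<i>) \<odot> gm)) \<in> Tadj"
    unfolding f0 by (intro Tadj_add Tadj_scale gp_adj gm_adj) (use T T_sub_Tadj in auto)
  then have f': "f' = f0' \<oplus> (a \<odot> \<i> \<odot> gp \<oplus> b \<odot> (- \<i>) \<odot> gm)" by (rule Tadj_unique[OF f])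
  have "(g, g0' \<oplus> (c \<odot> \<i> \<odot> gp \<oplus> d \<odot> (- \<i>) \<odot> gm)) \<in> Tadj"
    unfolding g0 by (intro Tadj_add Tadj_scale gp_adj gm_adj) (use T T_sub_Tadj in auto)
  then have g': "g' = g0' \<oplus> (c \<odot> \<i> \<odot> gp \<oplus> d \<odot> (- \<i>) \<odot> gm)" by (rule Tadj_unique[OF g])
  have 1: "\<langle>f0', g0\<rangle> = \<langle>f0, g0'\<rangle>" by (rule symmetricD[OF T_symmetric T])
  have 2: "\<langle>f0', gp\<rangle> = - \<i> * \<langle>f0, gp\<rangle>" "\<langle>f0', gm\<rangle> = \<i> * \<langle>f0, gm\<rangle>"
    using adjointD(3)[OF gp_adj T(1)] adjointD(3)[OF gm_adj T(1)] V by (simp_all add: inner_simps)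
  have "\<langle>g0', gp\<rangle> = - \<i> * \<langle>g0, gp\<rangle>" "\<langle>g0', gm\<rangle> = \<i> * \<langle>g0, gm\<rangle>"
    using adjointD(3)[OF gp_adj T(2)] adjointD(3)[OF gm_adj T(2)] V by (simp_all add: inner_simps)
  then have 3: "\<langle>gp, g0'\<rangle> = \<i> * \<langle>gp, g0\<rangle>" "\<langle>gm, g0'\<rangle> = - \<i> * \<langle>gm, g0\<rangle>"
    using V inner_commute[of gp g0'] inner_commute[of gm g0'] inner_commute[of gp g0] inner_commute[of gm g0]
    by simp_all
  show ?thesis
    unfolding f' g' f0 g0 using V by (simp add: inner_simps 1 2 3 gp_unit gm_unit algebra_simps)
qed

text \<open>
  For \<open>h\<close> in the domain of \<open>T\<close>, the imaginary part of the form on \<open>f + c h\<close> is affine in \<open>c\<close>. Being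
  nonnegative for all \<open>c\<close>, it is constant; its linear coefficient is the defect \<open>w\<close> in the equation
  that puts \<open>f\<close> into the domain of the adjoint.
\<close>

lemma dissipative_sub_Tadj:
  assumes TD: "T \<subseteq> D" and D: "dissipative H D"
  shows "D \<subseteq> Tadj"
proof
  fix p assume p: "p \<in> D"
  obtain f f' where ff: "p = (f, f')" by fastforce
  have lin: "linear_operator H D" using D by (simp add: dissipative_def)
  have fD: "(f, f') \<in> D" using p ff by simp
  have fV: "f \<in> V" "f' \<in> V" using linear_carrier[OF lin fD] by auto
  have "\<langle>h', f\<rangle> = \<langle>h, f'\<rangle>" if h: "(h, h') \<in> T" for h h'
  proof -
    have hV: "h \<in> V" "h' \<in> V" using T_carrier[OF h] by auto
    define w where "w = \<langle>f', h\<rangle> - \<langle>f, h'\<rangle>"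
    have hh: "Im \<langle>h', h\<rangle> = 0"
      using symmetricD[OF T_symmetric h h] inner_commute[of h h'] hV by (metis cnj.sel(2) equal_neg_zero)
    have "0 \<le> Im \<langle>f', f\<rangle> + t * (cmod w)\<^sup>2" for t :: real
    proof -
      \<comment> \<open>The direction in which the linear coefficient acts as \<open>\<bar>w\<bar>\<^sup>2\<close>.\<close>
      define c where "c = - \<i> * of_real t * w"
      have "(f \<oplus> c \<odot> h, f' \<oplus> c \<odot> h') \<in> D"
        using h TD by (intro linear_add[OF lin] linear_scale[OF lin] fD) auto
      then have "0 \<le> Im \<langle>f' \<oplus> c \<odot> h', f \<oplus> c \<odot> h\<rangle>"
        using D unfolding dissipative_def by blast
      also have "\<langle>f' \<oplus> c \<odot> h', f \<oplus> c \<odot> h\<rangle>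
        = \<langle>f', f\<rangle> + cnj c * \<langle>f', h\<rangle> + c * cnj \<langle>f, h'\<rangle> + (c * cnj c) * \<langle>h', h\<rangle>"
        using fV hV inner_commute[of h' f] by (simp add: inner_simps algebra_simps)
      also have "Im \<dots> = Im \<langle>f', f\<rangle> + Im (cnj c * w)"
      proof -
        have "c * cnj c = of_real ((cmod c)\<^sup>2)" by (simp add: complex_norm_square[symmetric])
        then have "Im ((c * cnj c) * \<langle>h', h\<rangle>) = 0" using hh by simp
        then show ?thesis by (simp add: w_def algebra_simps)
      qed
      also have "cnj c * w = \<i> * of_real (t * (cmod w)\<^sup>2)"
        using complex_norm_square[of w] by (simp add: c_def mult.commute mult.left_commute)
      finally show ?thesis by simp
    qed
    note le = this
    have "w = 0"
    proof (rule ccontr)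
      assume "w \<noteq> 0"
      then show False
        using le[of "- (Im \<langle>f', f\<rangle> + 1) / (cmod w)\<^sup>2"] by (simp add: field_simps)
    qed
    then have "cnj \<langle>f', h\<rangle> = cnj \<langle>f, h'\<rangle>" by (simp add: w_def)
    then show ?thesis using fV hV inner_commute[of h f'] inner_commute[of h' f] by simp
  qed
  then have "(f, f') \<in> Tadj" by (intro adjointI fV)
  then show "p \<in> Tadj" using ff by simp
qed

text \<open>
  On the quotient of the domain of the adjoint by the domain of \<open>T\<close> the imaginary part of the form
  is \<open>\<bar>a\<bar>\<^sup>2 - \<bar>b\<bar>\<^sup>2\<close>. A maximal nonnegative subspace of this plane is the line \<open>b = - \<kappa> a\<close> with
  \<open>\<bar>\<kappa>\<bar> \<le> 1\<close>, and \<open>\<bar>\<kappa>\<bar> = 1\<close> is the self-adjoint case.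
\<close>

lemma maximal_dissipative_parameter:
  assumes D: "maximal_dissipative_extension H T D" and nsa: "D \<noteq> adjoint_op H D"
  obtains \<kappa> where "cmod \<kappa> < 1"
    "D = span_extension H T (gp \<ominus> \<kappa> \<odot> gm)"
proof -
  have TD: "T \<subseteq> D" and diss: "dissipative H D"
    and max: "\<And>D'. \<lbrakk>dissipative H D'; D \<subseteq> D'\<rbrakk> \<Longrightarrow> D' = D"
    using D unfolding maximal_dissipative_extension_def by auto
  have lin: "linear_operator H D" using diss by (simp add: dissipative_def)
  have DT: "D \<subseteq> Tadj" by (rule dissipative_sub_Tadj[OF TD diss])
  have cone: "cmod b \<le> cmod a"
    if f: "(f, f') \<in> D" "f0 \<in> Domain T" "f = f0 \<oplus> (a \<odot> gp \<oplus> b \<odot> gm)" for f f' f0 a b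
  proof -
    have V: "f \<in> V" "f' \<in> V" using linear_carrier[OF lin f(1)] by auto
    have "\<langle>f', f\<rangle> - cnj \<langle>f', f\<rangle> = 2 * \<i> * of_real ((cmod a)\<^sup>2 - (cmod b)\<^sup>2)"
      using boundary_form[of f f' f f' f0 a b f0 a b] f DT inner_commute[of f f'] V
      by (auto simp: complex_norm_square[symmetric])
    then have "Im \<langle>f', f\<rangle> = (cmod a)\<^sup>2 - (cmod b)\<^sup>2" by (simp add: complex_eq_iff)
    then have "(cmod b)\<^sup>2 \<le> (cmod a)\<^sup>2"
      using diss f(1) unfolding dissipative_def by fastforce
    then show ?thesis by (rule power2_le_imp_le) simp
  qed
  \<comment> \<open>Otherwise \<open>D\<close> has the domain of \<open>T\<close>, and it stays dissipative when \<open>gp\<close> is added to it.\<close>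
  have "\<exists>f f' f0 a b. (f, f') \<in> D \<and> f0 \<in> Domain T \<and> f = f0 \<oplus> (a \<odot> gp \<oplus> b \<odot> gm) \<and> a \<noteq> 0"
  proof (rule ccontr)
    assume no: "\<not> ?thesis"
    have DomD: "f \<in> Domain T" if f: "(f, f') \<in> D" for f f'
    proof -
      obtain f0 a b where *: "f0 \<in> Domain T" "f = f0 \<oplus> (a \<odot> gp \<oplus> b \<odot> gm)"
        using Tadj_decomposition[of f f'] f DT by blast
      then have "a = 0" using no f by blast
      moreover then have "b = 0" using cone[OF f *] by simp
      ultimately have "f = f0"
        unfolding *(2) using * T_carrier by (intro eqI_inner) (auto simp: inner_simps)
      then show ?thesis using * by simp
    qed
    define D' where "D' = {(f \<oplus> c \<odot> gp, f' \<oplus> c \<odot> \<i> \<odot> gp) | f f' c. (f, f') \<in> D}"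
    have c: "f \<in> V" "f' \<in> V" if "(f, f') \<in> D" for f f' using linear_carrier[OF lin that] by auto
    have D'T: "D' \<subseteq> Tadj"
      unfolding D'_def using DT by (auto intro!: Tadj_add Tadj_scale gp_adj)
    have sub: "D \<subseteq> D'"
    proof clarify
      fix f f' assume f: "(f, f') \<in> D"
      have "f = f \<oplus> 0 \<odot> gp" "f' = f' \<oplus> 0 \<odot> \<i> \<odot> gp"
        using c[OF f] by (auto intro!: eqI_inner simp: inner_simps)
      then show "(f, f') \<in> D'" unfolding D'_def using f by blast
    qed
    have "linear_operator H D'" unfolding linear_operator_def
    proof (intro conjI)
      show "D' \<subseteq> V \<times> V" using D'T adjointD(1,2) by fastforce
      show "single_valued D'" using D'T Tadj_unique unfolding single_valued_def by blast
      show "(hzero H, hzero H) \<in> D'" using sub linear_zero[OF lin] by blast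
      have "(f \<oplus> g, f' \<oplus> g') \<in> D'" if fg: "(f, f') \<in> D'" "(g, g') \<in> D'" for f f' g g'
      proof -
        obtain u u' a where u: "(u, u') \<in> D" "f = u \<oplus> a \<odot> gp" "f' = u' \<oplus> a \<odot> \<i> \<odot> gp"
          using fg(1) unfolding D'_def by blast
        obtain v v' b where v: "(v, v') \<in> D" "g = v \<oplus> b \<odot> gp" "g' = v' \<oplus> b \<odot> \<i> \<odot> gp"
          using fg(2) unfolding D'_def by blast
        have "f \<oplus> g = (u \<oplus> v) \<oplus> (a + b) \<odot> gp" "f' \<oplus> g' = (u' \<oplus> v') \<oplus> (a + b) \<odot> \<i> \<odot> gp"
          unfolding u v using c[OF u(1)] c[OF v(1)]
          by (intro eqI_inner; simp add: inner_simps algebra_simps)+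
        then show ?thesis unfolding D'_def using linear_add[OF lin u(1) v(1)] by blast
      qed
      then show "\<forall>(f, f')\<in>D'. \<forall>(g, g')\<in>D'. (f \<oplus> g, f' \<oplus> g') \<in> D'" by blast
      have "(k \<odot> f, k \<odot> f') \<in> D'" if f: "(f, f') \<in> D'" for f f' k
      proof -
        obtain u u' a where u: "(u, u') \<in> D" "f = u \<oplus> a \<odot> gp" "f' = u' \<oplus> a \<odot> \<i> \<odot> gp"
          using f unfolding D'_def by blast
        have "k \<odot> f = k \<odot> u \<oplus> (k * a) \<odot> gp" "k \<odot> f' = k \<odot> u' \<oplus> (k * a) \<odot> \<i> \<odot> gp"
          unfolding u using c[OF u(1)] by (intro eqI_inner; simp add: inner_simps algebra_simps)+
        then show ?thesis unfolding D'_def using linear_scale[OF lin u(1)] by blast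
      qed
      then show "\<forall>k. \<forall>(f, f')\<in>D'. (k \<odot> f, k \<odot> f') \<in> D'" by blast
    qed
    moreover have "0 \<le> Im \<langle>g', g\<rangle>" if g: "(g, g') \<in> D'" for g g'
    proof -
      obtain u u' a where u: "(u, u') \<in> D" "g = u \<oplus> a \<odot> gp" "g' = u' \<oplus> a \<odot> \<i> \<odot> gp"
        using g unfolding D'_def by blast
      have V: "g \<in> V" "g' \<in> V" using D'T g adjointD(1,2) by blast+
      have "g = u \<oplus> (a \<odot> gp \<oplus> 0 \<odot> gm)"
        unfolding u(2) using c[OF u(1)] by (intro eqI_inner) (simp_all add: inner_simps)
      then have "\<langle>g', g\<rangle> - cnj \<langle>g', g\<rangle> = 2 * \<i> * of_real ((cmod a)\<^sup>2)"
        using boundary_form[of g g' g g' u a 0 u a 0] g D'T DomD[OF u(1)] inner_commute[of g g'] V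
        by (auto simp: complex_norm_square[symmetric])
      then show ?thesis by (simp add: complex_eq_iff)
    qed
    ultimately have "dissipative H D'" unfolding dissipative_def by blast
    then have "D' = D" using max sub by blast
    moreover have "(hzero H \<oplus> 1 \<odot> gp, hzero H \<oplus> 1 \<odot> \<i> \<odot> gp) \<in> D'"
      unfolding D'_def using linear_zero[OF lin] by blast
    ultimately have "(gp, \<i> \<odot> gp) \<in> D" by (simp add: scale_one add_zero)
    moreover have "gp = hzero H \<oplus> (1 \<odot> gp \<oplus> 0 \<odot> gm)"
      by (intro eqI_inner) (simp_all add: inner_simps)
    ultimately show False using no linear_zero[OF T_linear] by (metis DomainI zero_neq_one)
  qed
  then obtain f f' f0 a b where f: "(f, f') \<in> D" "f0 \<in> Domain T" "f = f0 \<oplus> (a \<odot> gp \<oplus> b \<odot> gm)" "a \<noteq> 0"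
    by blast
  define \<kappa> where "\<kappa> = - b / a"
  have f0V: "f0 \<in> V" using f(2) T_carrier by blast
  have "(1 / a) \<odot> (f \<ominus> f0) = gp \<ominus> \<kappa> \<odot> gm"
    unfolding f(3) using f0V f(4)
    by (intro eqI_inner) (simp_all add: inner_simps \<kappa>_def field_simps)
  moreover have "(1 / a) \<odot> (f \<ominus> f0) \<in> Domain D"
    using linear_scale[OF lin linear_diff[OF lin f(1)]] f(2) TD by (fastforce simp: Domain_iff)
  ultimately obtain k where k: "(gp \<ominus> \<kappa> \<odot> gm, k) \<in> D" by auto
  have kdec: "gp \<ominus> \<kappa> \<odot> gm = hzero H \<oplus> (1 \<odot> gp \<oplus> (- \<kappa>) \<odot> gm)"
    by (intro eqI_inner) (simp_all add: inner_simps)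
  have zT: "hzero H \<in> Domain T" using linear_zero[OF T_linear] by blast
  have le1: "cmod \<kappa> \<le> 1" using cone[OF k zT kdec] by simp
  have comb: "f0 \<oplus> (a \<odot> gp \<oplus> (- \<kappa> * a) \<odot> gm) = f0 \<oplus> a \<odot> (gp \<ominus> \<kappa> \<odot> gm)" if "f0 \<in> V" for f0 a
    using that by (intro eqI_inner) (simp_all add: inner_simps algebra_simps)
  \<comment> \<open>Subtracting a multiple of \<open>gp - \<kappa> gm\<close> leaves a vector with \<open>a = 0\<close>, hence with \<open>b = 0\<close>.\<close>
  have Ddec: "\<exists>g0\<in>Domain T. \<exists>c. g = g0 \<oplus> (c \<odot> gp \<oplus> (- \<kappa> * c) \<odot> gm)" if g: "(g, g') \<in> D" for g g'
  proof -
    obtain g0 c d where g0: "g0 \<in> Domain T" "g = g0 \<oplus> (c \<odot> gp \<oplus> d \<odot> gm)"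
      using Tadj_decomposition[of g g'] g DT by blast
    have g0V: "g0 \<in> V" using g0 T_carrier by blast
    have "(g \<ominus> c \<odot> (gp \<ominus> \<kappa> \<odot> gm), g' \<ominus> c \<odot> k) \<in> D"
      by (intro linear_diff[OF lin] linear_scale[OF lin] g k)
    moreover have "g \<ominus> c \<odot> (gp \<ominus> \<kappa> \<odot> gm) = g0 \<oplus> (0 \<odot> gp \<oplus> (d + c * \<kappa>) \<odot> gm)"
      unfolding g0 using g0V by (intro eqI_inner) (simp_all add: inner_simps algebra_simps)
    ultimately have "cmod (d + c * \<kappa>) \<le> cmod 0" using cone[OF _ g0(1)] by blast
    then have "d = - \<kappa> * c" by (simp add: add_eq_0_iff2 mult.commute)
    then show ?thesis using g0 by blast
  qed
  have Deq: "D = span_extension H T (gp \<ominus> \<kappa> \<odot> gm)" (is "_ = restrict_op Tadj ?Dom")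
  proof
    show "D \<subseteq> restrict_op Tadj ?Dom"
    proof clarify
      fix g g' assume g: "(g, g') \<in> D"
      obtain g0 c where "g0 \<in> Domain T" "g = g0 \<oplus> (c \<odot> gp \<oplus> (- \<kappa> * c) \<odot> gm)"
        using Ddec[OF g] by blast
      then have "g \<in> ?Dom" using comb[of g0 c] T_carrier by blast
      then show "(g, g') \<in> restrict_op Tadj ?Dom"
        using g DT unfolding restrict_op_def by blast
    qed
    show "restrict_op Tadj ?Dom \<subseteq> D"
    proof clarify
      fix g g' assume g: "(g, g') \<in> restrict_op Tadj ?Dom"
      then obtain f0 c where fc: "f0 \<in> Domain T" "g = f0 \<oplus> c \<odot> (gp \<ominus> \<kappa> \<odot> gm)" and gT: "(g, g') \<in> Tadj"
        unfolding restrict_op_def by blast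
      then obtain f0' where "(f0, f0') \<in> D" using TD by blast
      then have gD: "(g, f0' \<oplus> c \<odot> k) \<in> D"
        unfolding fc by (intro linear_add[OF lin] linear_scale[OF lin] k)
      then have "g' = f0' \<oplus> c \<odot> k" using Tadj_unique gT DT by blast
      then show "(g, g') \<in> D" using gD by simp
    qed
  qed
  \<comment> \<open>On the unit circle \<open>D\<close> would be its own annihilator under the boundary form, hence self-adjoint.\<close>
  have "cmod \<kappa> \<noteq> 1"
  proof
    assume 1: "cmod \<kappa> = 1"
    then have kk: "\<kappa> * cnj \<kappa> = 1" using complex_norm_square[of \<kappa>] by simp
    have "adjoint_op H D = D"
    proof
      show "D \<subseteq> adjoint_op H D"
      proof clarify
        fix g g' assume g: "(g, g') \<in> D"
        obtain g0 c where g0: "g0 \<in> Domain T" "g = g0 \<oplus> (c \<odot> gp \<oplus> (- \<kappa> * c) \<odot> gm)"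
          using Ddec[OF g] by blast
        show "(g, g') \<in> adjoint_op H D"
        proof (rule adjointI)
          fix h h' assume h: "(h, h') \<in> D"
          obtain h0 d where h0: "h0 \<in> Domain T" "h = h0 \<oplus> (d \<odot> gp \<oplus> (- \<kappa> * d) \<odot> gm)"
            using Ddec[OF h] by blast
          have "(h, h') \<in> Tadj" "(g, g') \<in> Tadj" using g h DT by auto
          then have "\<langle>h', g\<rangle> - \<langle>h, g'\<rangle> = 2 * \<i> * (d * cnj c - (- \<kappa> * d) * cnj (- \<kappa> * c))"
            by (rule boundary_form[OF _ _ h0 g0])
          also have "(- \<kappa> * d) * cnj (- \<kappa> * c) = (\<kappa> * cnj \<kappa>) * (d * cnj c)" by simp
          finally show "\<langle>h', g\<rangle> = \<langle>h, g'\<rangle>" unfolding kk by simp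
        qed (use linear_carrier[OF lin g] in auto)
      qed
      show "adjoint_op H D \<subseteq> D"
      proof clarify
        fix g h assume g: "(g, h) \<in> adjoint_op H D"
        have gT: "(g, h) \<in> Tadj"
          using adjointD[OF g] TD by (intro adjointI) auto
        obtain g0 c d where g0: "g0 \<in> Domain T" "g = g0 \<oplus> (c \<odot> gp \<oplus> d \<odot> gm)"
          using Tadj_decomposition[OF gT] by blast
        have "(gp \<ominus> \<kappa> \<odot> gm, k) \<in> Tadj" using k DT by blast
        then have "\<langle>k, g\<rangle> - \<langle>gp \<ominus> \<kappa> \<odot> gm, h\<rangle> = 2 * \<i> * (1 * cnj c - (- \<kappa>) * cnj d)"
          by (rule boundary_form[OF _ gT zT kdec g0])
        then have "cnj c + \<kappa> * cnj d = 0" using adjointD(3)[OF g k] by simp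
        then have "cnj (cnj c + \<kappa> * cnj d) = 0" by simp
        then have "c = - cnj \<kappa> * d" by (simp add: eq_neg_iff_add_eq_0)
        then have "- \<kappa> * c = (\<kappa> * cnj \<kappa>) * d" by simp
        then have "d = - \<kappa> * c" using kk by simp
        then have "g = g0 \<oplus> c \<odot> (gp \<ominus> \<kappa> \<odot> gm)" using g0 comb[of g0 c] T_carrier by blast
        then show "(g, h) \<in> D"
          unfolding Deq restrict_op_def using gT g0 by blast
      qed
    qed
    then show False using nsa by simp
  qed
  then show thesis using that[of \<kappa>] le1 Deq by simp
qed

lemma parameter_unique:
  assumes D: "D = span_extension H T (gp \<ominus> \<kappa> \<odot> gm)"
    and mem: "gp \<ominus> \<kappa>' \<odot> gm \<in> Domain D"
  shows "\<kappa>' = \<kappa>"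
proof -
  obtain f0 c where f: "f0 \<in> Domain T" "gp \<ominus> \<kappa>' \<odot> gm = f0 \<oplus> c \<odot> (gp \<ominus> \<kappa> \<odot> gm)"
    using mem unfolding D restrict_op_def by blast
  have f0V: "f0 \<in> V" using f T_carrier by blast
  have "f0 = (1 - c) \<odot> gp \<oplus> (c * \<kappa> - \<kappa>') \<odot> gm"
  proof (rule eqI_inner)
    fix v assume v: "v \<in> V"
    show "\<langle>f0, v\<rangle> = \<langle>(1 - c) \<odot> gp \<oplus> (c * \<kappa> - \<kappa>') \<odot> gm, v\<rangle>"
      using arg_cong[OF f(2), of "\<lambda>x. \<langle>x, v\<rangle>"] v f0V by (simp add: inner_simps algebra_simps)
  qed (use f0V in simp_all)
  then have f0: "f0 = hzero H \<oplus> ((1 - c) \<odot> gp \<oplus> (c * \<kappa> - \<kappa>') \<odot> gm)" by (simp add: add_zero)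
  obtain f0' where T: "(f0, f0') \<in> Tadj" using f T_sub_Tadj by blast
  have z: "hzero H \<in> Domain T" using linear_zero[OF T_linear] by blast
  have triv: "f0 = f0 \<oplus> (0 \<odot> gp \<oplus> 0 \<odot> gm)"
    using f0V by (intro eqI_inner) (simp_all add: inner_simps)
  have pm: "gp = hzero H \<oplus> (1 \<odot> gp \<oplus> 0 \<odot> gm)" "gm = hzero H \<oplus> (0 \<odot> gp \<oplus> 1 \<odot> gm)"
    by (intro eqI_inner; simp add: inner_simps)+
  \<comment> \<open>The boundary form pairs the domain of \<open>T\<close> to zero and reads off both coefficients.\<close>
  have "1 - c = 0"
    using boundary_form[OF T gp_adj z f0 z pm(1)] boundary_form[OF T gp_adj f(1) triv z pm(1)] by simp
  moreover have "c * \<kappa> - \<kappa>' = 0"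
    using boundary_form[OF T gm_adj z f0 z pm(2)] boundary_form[OF T gm_adj f(1) triv z pm(2)] by simp
  ultimately show ?thesis by simp
qed

end

section \<open>The characteristic function in terms of the Weyl-Titchmarsh function\<close>

context deficiency_one
begin

lemma gamma_inner_gm: "Im z \<noteq> 0 \<Longrightarrow> (z - \<i>) * \<langle>\<gamma> z, gm\<rangle> = m z - \<i>"
  using gram[of z "- \<i>"] by (simp add: gamma_minus_i m_i)

text \<open>
  By \<open>gamma_minus_i\<close> the second vector is a linear function of the first, so the same phase appears
  in both.
\<close>

lemma pair_unique:
  assumes "deficiency_one H A T gp' gm'"
  obtains \<omega> where "cmod \<omega> = 1" "gp' = \<omega> \<odot> gp" "gm' = \<omega> \<odot> gm"
proof -
  interpret other: deficiency_one H A T gp' gm' by fact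
  obtain \<omega> where \<omega>: "gp' = \<omega> \<odot> gp" using defect_plus[OF other.gp_adj] by blast
  have "cmod \<omega> = 1" using other.gp_norm gp_norm by (simp add: \<omega> norm_scale)
  moreover have "other.\<gamma> (- \<i>) = \<omega> \<odot> \<gamma> (- \<i>)"
    unfolding other.\<gamma>_def \<gamma>_def unfolding \<omega>
    by (intro eqI_inner) (simp_all add: inner_simps resolvent_scale algebra_simps)
  ultimately show thesis
    using that[OF _ \<omega>] other.gamma_minus_i gamma_minus_i by simp
qed

lemma chosen_pair: "deficiency_one H A T (g_plus H T A) (g_minus H T A)"
proof -
  let ?P = "\<lambda>(gp, gm). gp \<in> defect_space H T \<i> \<and> gm \<in> defect_space H T (- \<i>) \<and>
    hnorm H gp = 1 \<and> hnorm H gm = 1 \<and> hdiff H gp gm \<in> Domain A"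
  have "?P (gp, gm)" using gp_defect gm_defect gp_norm gm_norm gp_gm by simp
  then have "?P (deficiency_pair H T A)" unfolding deficiency_pair_def by (rule someI[of ?P])
  then show ?thesis
    unfolding g_plus_def g_minus_def
    by unfold_locales (auto simp: T_symmetric T_dense T_closed T_sub_A indices split: prod.splits)
qed

lemma chosen_phase:
  obtains \<omega> where "\<omega> * cnj \<omega> = 1" "g_plus H T A = \<omega> \<odot> gp" "g_minus H T A = \<omega> \<odot> gm"
proof (rule pair_unique[OF chosen_pair])
  fix \<omega> assume *: "cmod \<omega> = 1" "g_plus H T A = \<omega> \<odot> gp" "g_minus H T A = \<omega> \<odot> gm"
  then have "\<omega> * cnj \<omega> = 1" using complex_norm_square[of \<omega>] by simp
  then show thesis using that * by blast
qed

text \<open>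
  The chosen vector \<open>g_plus\<close> differs from \<open>gp\<close> by a phase, which cancels in the quadratic form.
\<close>

lemma weyl_function_eq:
  assumes z: "Im z \<noteq> 0"
  shows "weyl_function H T A z = m z"
proof -
  obtain \<omega> where \<omega>: "\<omega> * cnj \<omega> = 1" "g_plus H T A = \<omega> \<odot> gp" by (rule chosen_phase)
  define g where "g = \<omega> \<odot> gp"
  have gV: "g \<in> V" by (simp add: g_def)
  define y where "y = z \<odot> (g \<oplus> z \<odot> R z g) \<oplus> 1 \<odot> R z g"
  have "(g, w) \<in> (op_shift H A (- z))\<inverse> O op_shift H (op_scale H z A) 1 \<longleftrightarrow> w = y" for w
  proof
    assume "(g, w) \<in> (op_shift H A (- z))\<inverse> O op_shift H (op_scale H z A) 1"
    then obtain f f' f'' where f: "(f, f') \<in> A" "g = f' \<oplus> (- z) \<odot> f" "(f, f'') \<in> A" "w = z \<odot> f'' \<oplus> 1 \<odot> f"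
      unfolding op_shift_def op_scale_def by blast
    have V: "f \<in> V" "f' \<in> V" using A_carrier[OF f(1)] by auto
    have f'': "f'' = f'" using f linear_unique[OF A_linear] by blast
    have fg: "f' = g \<oplus> z \<odot> f"
      unfolding f using V by (intro eqI_inner) (simp_all add: inner_simps)
    then have "R z g = f" using f(1) by (intro resolvent_unique z gV) simp
    then show "w = y" unfolding y_def f(4) f'' fg[symmetric] by (simp add: fg)
  next
    assume w: "w = y"
    have A: "(R z g, g \<oplus> z \<odot> R z g) \<in> A" by (rule resolvent_in_A[OF z gV])
    have "g = (g \<oplus> z \<odot> R z g) \<oplus> (- z) \<odot> R z g"
      using gV z by (intro eqI_inner) (simp_all add: inner_simps)
    then have "(R z g, g) \<in> op_shift H A (- z)" using A unfolding op_shift_def by blast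
    moreover have "(R z g, y) \<in> op_shift H (op_scale H z A) 1"
      unfolding op_shift_def op_scale_def y_def using A by blast
    ultimately show "(g, w) \<in> (op_shift H A (- z))\<inverse> O op_shift H (op_scale H z A) 1"
      using w by blast
  qed
  then have "op_apply ((op_shift H A (- z))\<inverse> O op_shift H (op_scale H z A) 1) g = y"
    unfolding op_apply_def by simp
  then have "weyl_function H T A z = \<langle>y, g\<rangle>"
    unfolding weyl_function_def \<omega>(2) g_def by simp
  also have "\<dots> = (\<omega> * cnj \<omega>) * m z"
    unfolding y_def g_def m_def using z
    by (simp add: inner_simps resolvent_scale gp_unit algebra_simps power2_eq_square)
  finally show ?thesis using \<omega>(1) by simp
qed

text \<open>
  The common phase of the chosen pair and the scaling of the chosen deficiency vector at \<open>z\<close> cancel in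
  the quotient. What is left is the Gram formula with \<open>gm = \<gamma> (- \<i>)\<close> and with \<open>gp = \<gamma> \<i>\<close>.
\<close>

lemma livsic_function_eq:
  assumes z: "Im z > 0"
  shows "livsic_function H T A z = (m z - \<i>) / (m z + \<i>)"
proof -
  obtain \<omega> where \<omega>: "\<omega> * cnj \<omega> = 1" "g_plus H T A = \<omega> \<odot> gp" "g_minus H T A = \<omega> \<odot> gm"
    by (rule chosen_phase)
  define g where "g = (SOME g. g \<in> defect_space H T z \<and> g \<noteq> hzero H)"
  have "\<gamma> z \<in> defect_space H T z \<and> \<gamma> z \<noteq> hzero H"
    using gamma_adj[of z] gamma_nonzero[of z] z by (simp add: defect_space_iff)
  then have g: "g \<in> defect_space H T z" "g \<noteq> hzero H"
    unfolding g_def using someI[of "\<lambda>g. g \<in> defect_space H T z \<and> g \<noteq> hzero H"] by blast+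
  obtain c where c: "g = c \<odot> \<gamma> z" using defect_gamma[of z g] g z by (auto simp: defect_space_iff)
  have c0: "c \<noteq> 0" using g(2) c scale_zero_left[of "\<gamma> z"] z by auto
  have \<omega>0: "cnj \<omega> \<noteq> 0" using \<omega>(1) by auto
  have "livsic_function H T A z = (z - \<i>) / (z + \<i>) * (\<langle>g, \<omega> \<odot> gm\<rangle> / \<langle>g, \<omega> \<odot> gp\<rangle>)"
    unfolding livsic_function_def Let_def g_def[symmetric] \<omega> ..
  also have "\<dots> = ((z - \<i>) * \<langle>\<gamma> z, gm\<rangle>) / ((z + \<i>) * \<langle>\<gamma> z, gp\<rangle>)"
    unfolding c using c0 \<omega>0 z by (simp add: inner_simps)
  finally show ?thesis using gamma_inner_gm[of z] gamma_inner_gp[of z] z by simp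
qed

lemma Domain_extension:
  assumes D: "D = span_extension H T (gp \<ominus> \<kappa> \<odot> gm)"
  shows "Domain D = {f0 \<oplus> c \<odot> (gp \<ominus> \<kappa> \<odot> gm) | f0 c. f0 \<in> Domain T}"
proof -
  have "f0 \<oplus> c \<odot> (gp \<ominus> \<kappa> \<odot> gm) \<in> Domain Tadj" if f0: "f0 \<in> Domain T" for f0 c
  proof -
    obtain f0' where "(f0, f0') \<in> Tadj" using f0 T_sub_Tadj by blast
    then have "(f0 \<oplus> c \<odot> (gp \<ominus> \<kappa> \<odot> gm), f0' \<oplus> c \<odot> (\<i> \<odot> gp \<ominus> \<kappa> \<odot> (- \<i>) \<odot> gm)) \<in> Tadj"
      by (intro Tadj_add Tadj_scale Tadj_diff gp_adj gm_adj)
    then show ?thesis by blast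
  qed
  then show ?thesis unfolding D restrict_op_def by blast
qed

lemma von_neumann_parameter_eq:
  assumes D: "D = span_extension H T (gp \<ominus> \<kappa> \<odot> gm)"
    and \<kappa>: "cmod \<kappa> < 1"
  shows "von_neumann_parameter H T D A = \<kappa>"
proof -
  obtain \<omega> where \<omega>: "\<omega> * cnj \<omega> = 1" "g_plus H T A = \<omega> \<odot> gp" "g_minus H T A = \<omega> \<odot> gm"
    by (rule chosen_phase)
  have phase: "\<omega> \<odot> gp \<ominus> k \<odot> \<omega> \<odot> gm = \<omega> \<odot> (gp \<ominus> k \<odot> gm)" for k
    by (intro eqI_inner) (simp_all add: inner_simps algebra_simps)
  have zT: "hzero H \<in> Domain T" using linear_zero[OF T_linear] by blast
  have "\<omega> \<odot> (gp \<ominus> \<kappa> \<odot> gm) = hzero H \<oplus> \<omega> \<odot> (gp \<ominus> \<kappa> \<odot> gm)" by (simp add: add_zero)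
  then have mem: "\<omega> \<odot> (gp \<ominus> \<kappa> \<odot> gm) \<in> Domain D"
    unfolding Domain_extension[OF D] using zT by blast
  show ?thesis unfolding von_neumann_parameter_def \<omega> phase
  proof (rule some_equality)
    fix k assume k: "cmod k < 1 \<and> \<omega> \<odot> (gp \<ominus> k \<odot> gm) \<in> Domain D"
    then obtain f0 c where f: "f0 \<in> Domain T" "\<omega> \<odot> (gp \<ominus> k \<odot> gm) = f0 \<oplus> c \<odot> (gp \<ominus> \<kappa> \<odot> gm)"
      unfolding Domain_extension[OF D] by blast
    have f0V: "f0 \<in> V" "cnj \<omega> \<odot> f0 \<in> Domain T"
      using f T_carrier linear_scale[OF T_linear] by blast+
    have "gp \<ominus> k \<odot> gm = cnj \<omega> \<odot> \<omega> \<odot> (gp \<ominus> k \<odot> gm)"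
      using \<omega>(1) by (simp add: scale_scale scale_one mult.commute)
    also have "\<dots> = cnj \<omega> \<odot> f0 \<oplus> (cnj \<omega> * c) \<odot> (gp \<ominus> \<kappa> \<odot> gm)"
      unfolding f(2) using f0V by (simp add: scale_add_right scale_scale)
    finally have "gp \<ominus> k \<odot> gm \<in> Domain D"
      unfolding Domain_extension[OF D] using f0V by blast
    then show "k = \<kappa>" by (rule parameter_unique[OF D])
  qed (use \<kappa> mem in auto)
qed

lemma characteristic_function_eq:
  assumes D: "D = span_extension H T (gp \<ominus> \<kappa> \<odot> gm)"
    and \<kappa>: "cmod \<kappa> < 1" and z: "Im z > 0"
  shows "characteristic_function H T D A z
    = ((m z - \<i>) / (m z + \<i>) - \<kappa>) / (cnj \<kappa> * ((m z - \<i>) / (m z + \<i>)) - 1)"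
  unfolding characteristic_function_def Let_def
    von_neumann_parameter_eq[OF D \<kappa>] livsic_function_eq[OF z] ..

lemma characteristic_function_i:
  assumes D: "D = span_extension H T (gp \<ominus> \<kappa> \<odot> gm)"
    and \<kappa>: "cmod \<kappa> < 1"
  shows "characteristic_function H T D A \<i> = \<kappa>"
  by (simp add: characteristic_function_eq[OF D \<kappa>] m_i)

end

section \<open>Prime operators and the totality of the deficiency vectors\<close>

context inner_product_space
begin

text \<open>
  A Lipschitz estimate satisfied both by the deficiency vectors and by the functions \<open>1 / (t - z)\<close>. For
  both, \<open>g z - g w = (z - w) R w (g z)\<close> with a resolvent \<open>R w\<close> of norm at most \<open>1 / \<bar>Im w\<bar>\<close>.
\<close>

definition resolvent_family :: "(complex \<Rightarrow> 'a) \<Rightarrow> bool" where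
  "resolvent_family g \<longleftrightarrow> (\<forall>z. Im z \<noteq> 0 \<longrightarrow> g z \<in> V) \<and>
    (\<forall>z w. Im z \<noteq> 0 \<longrightarrow> Im w \<noteq> 0 \<longrightarrow> \<bar>Im w\<bar> * norm_H (g z \<ominus> g w) \<le> cmod (z - w) * norm_H (g z))"

lemma resolvent_family_closed: "\<lbrakk>resolvent_family g; Im z \<noteq> 0\<rbrakk> \<Longrightarrow> g z \<in> V"
  by (simp add: resolvent_family_def)

lemma eventually_nonreal:
  assumes "Im w \<noteq> 0"
  shows "\<forall>\<^sub>F z in at w. Im z \<noteq> 0 \<and> z \<noteq> w"
proof -
  have "(Im \<longlongrightarrow> Im w) (at w)" by (intro tendsto_intros)
  then have "\<forall>\<^sub>F z in at w. Im z \<noteq> 0" using assms by (rule tendsto_imp_eventually_ne)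
  then show ?thesis using eventually_neq_at_within[of w] by (rule eventually_conj)
qed

lemma resolvent_family_continuous:
  assumes g: "resolvent_family g" and w: "Im w \<noteq> 0" and x: "x \<in> V"
  shows "((\<lambda>z. \<langle>x, g z\<rangle>) \<longlongrightarrow> \<langle>x, g w\<rangle>) (at w)"
proof -
  let ?b = "\<lambda>z. norm_H x * (cmod (w - z) * norm_H (g w) / \<bar>Im z\<bar>)"
  have "(?b \<longlongrightarrow> norm_H x * (cmod (w - w) * norm_H (g w) / \<bar>Im w\<bar>)) (at w)"
    by (intro tendsto_intros) (use w in simp)
  then have lim: "(?b \<longlongrightarrow> 0) (at w)" by simp
  have "\<forall>\<^sub>F z in at w. norm (\<langle>x, g z\<rangle> - \<langle>x, g w\<rangle>) \<le> ?b z"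
    using eventually_nonreal[OF w]
  proof eventually_elim
    case (elim z)
    have V: "g z \<in> V" "g w \<in> V" using g w elim by (auto simp: resolvent_family_def)
    have "norm (\<langle>x, g z\<rangle> - \<langle>x, g w\<rangle>) \<le> norm_H x * norm_H (g z \<ominus> g w)"
      using cauchy_schwarz[of x "g z \<ominus> g w"] x V by (simp add: inner_diff_right)
    also have "norm_H (g z \<ominus> g w) = norm_H (g w \<ominus> g z)" by (rule norm_diff_sym[OF V])
    also have "\<dots> \<le> cmod (w - z) * norm_H (g w) / \<bar>Im z\<bar>"
      using g w elim by (simp add: resolvent_family_def pos_le_divide_eq mult.commute)
    finally show ?case using x by (simp add: mult_left_mono)
  qed
  then show ?thesis by (rule LIM_zero_cancel[OF Lim_null_comparison[OF _ lim]])
qed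

text \<open>
  Formulas for the family divide by a difference of parameters. This recovers the excluded point.
\<close>

lemma resolvent_family_punctured:
  assumes g: "resolvent_family g" and w: "Im w \<noteq> 0" and x: "x \<in> V"
    and z: "\<And>z. \<lbrakk>Im z \<noteq> 0; z \<noteq> w\<rbrakk> \<Longrightarrow> \<langle>x, g z\<rangle> = 0"
  shows "\<langle>x, g w\<rangle> = 0"
proof (rule tendsto_unique[OF _ resolvent_family_continuous[OF g w x]])
  show "((\<lambda>z. \<langle>x, g z\<rangle>) \<longlongrightarrow> 0) (at w)"
    by (rule tendsto_eventually) (use eventually_nonreal[OF w] z in \<open>auto elim: eventually_mono\<close>)
qed simp

end

context hilbert_space
begin

lemma closed_subspace_hilbert:
  assumes N: "closed_subspace H N"
  shows "hilbert_space (H\<lparr>hcarrier := N\<rparr>)"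
proof -
  have NV: "N \<subseteq> V" using N by (simp add: closed_subspace_def)
  then have mem: "x \<in> V" if "x \<in> N" for x using that by blast
  interpret N: inner_product_space "H\<lparr>hcarrier := N\<rparr>"
    using N by unfold_locales
      (auto simp: closed_subspace_def mem add_assoc add_zero add_neg scale_one scale_scale
        scale_add_right scale_add_left inner_add_left inner_scale_left inner_nonneg
        inner_definite intro: add_commute inner_commute)
  have n: "hnorm (H\<lparr>hcarrier := N\<rparr>) x = norm_H x" "hdiff (H\<lparr>hcarrier := N\<rparr>) x y = x \<ominus> y" for x y
    by (simp_all add: hnorm_def hdiff_def)
  show ?thesis
  proof (rule N.hilbert_spaceI)
    fix s :: "nat \<Rightarrow> 'a"
    assume s: "range s \<subseteq> hcarrier (H\<lparr>hcarrier := N\<rparr>)"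
      and cau: "\<And>e. e > 0 \<Longrightarrow> \<exists>M. \<forall>m\<ge>M. \<forall>n\<ge>M.
        hnorm (H\<lparr>hcarrier := N\<rparr>) (hdiff (H\<lparr>hcarrier := N\<rparr>) (s m) (s n)) < e"
    have sN: "range s \<subseteq> N" and sV: "range s \<subseteq> V" using s NV by auto
    obtain x where x: "converges s x"
      using cauchy_converges[OF sV] cau unfolding n by blast
    then have "limitin (htopology H) s x sequentially" using converges_limitin[OF sV] by simp
    then have "x \<in> N"
      by (rule limitin_closedin) (use N sN in \<open>auto simp: closed_subspace_def image_subset_iff\<close>)
    then have "N.converges s x"
      using x sN unfolding N.converges_def converges_def n by simp
    then show "\<exists>x. N.converges s x" by blast
  qed
qed

end

context deficiency_one
begin

lemma gamma_family: "resolvent_family \<gamma>"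
  unfolding resolvent_family_def
proof (intro conjI allI impI)
  fix z w assume zw: "Im z \<noteq> 0" "Im w \<noteq> 0"
  show "\<bar>Im w\<bar> * norm_H (\<gamma> z \<ominus> \<gamma> w) \<le> cmod (z - w) * norm_H (\<gamma> z)"
    using mult_left_mono[OF norm_resolvent_le[OF zw(2), of "\<gamma> z"], of "cmod (z - w)"] zw
    by (simp add: gamma_diff norm_scale mult.left_commute)
qed simp

lemma inner_resolvent_gamma:
  assumes "Im z \<noteq> 0" "Im w \<noteq> 0" "x \<in> V"
  shows "cnj (z - cnj w) * \<langle>R w x, \<gamma> z\<rangle> = \<langle>x, \<gamma> z\<rangle> - \<langle>x, \<gamma> (cnj w)\<rangle>"
  using gamma_diff[of z "cnj w"] inner_resolvent[of w x "\<gamma> z"] assms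
  by (simp add: inner_diff_right[symmetric] inner_scale_right)

text \<open>
  The vectors orthogonal to all \<open>\<gamma> z\<close> form a closed subspace invariant under the resolvents of \<open>A\<close>.
  It is orthogonal to \<open>gm\<close>, so \<open>A\<close> and \<open>T\<close> agree there and \<open>T\<close> has a self-adjoint part on it.
\<close>

lemma prime_total:
  assumes prime: "prime_operator H T"
    and x: "x \<in> V" "\<And>z. Im z \<noteq> 0 \<Longrightarrow> \<langle>x, \<gamma> z\<rangle> = 0"
  shows "x = hzero H"
proof -
  define L where "L = {x \<in> V. \<forall>z. Im z \<noteq> 0 \<longrightarrow> \<langle>x, \<gamma> z\<rangle> = 0}"
  have L0: "\<langle>x, \<gamma> z\<rangle> = 0" if "x \<in> L" "Im z \<noteq> 0" for x z using that by (simp add: L_def)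
  have LV: "L \<subseteq> V" by (auto simp: L_def)
  have cl: "closed_subspace H L"
    unfolding closed_subspace_def htopology_def metric.metric_closedin_iff_sequentially_closed
  proof (intro conjI allI impI ballI)
    fix s l assume s: "range s \<subseteq> L \<and> limitin metric.mtopology s l sequentially"
    then have "range s \<subseteq> V" using LV by blast
    then have "converges s l" using converges_limitin[of s l] s unfolding htopology_def by blast
    then have "\<langle>l, \<gamma> z\<rangle> = 0" if "Im z \<noteq> 0" for z
      using converges_inner_left[of s l "\<gamma> z"] s L0[OF _ that] that
      by (auto simp: image_subset_iff LIMSEQ_const_iff)
    then show "l \<in> L" using \<open>converges s l\<close> by (simp add: L_def converges_def)
  qed (auto simp: L_def inner_simps)
  interpret L: hilbert_space "H\<lparr>hcarrier := L\<rparr>" by (rule closed_subspace_hilbert[OF cl])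
  have inv: "R w x \<in> L" if w: "Im w \<noteq> 0" and x: "x \<in> L" for w x
  proof -
    have xV: "x \<in> V" using x LV by blast
    have ne: "\<langle>R w x, \<gamma> z\<rangle> = 0" if "Im z \<noteq> 0" "z \<noteq> cnj w" for z
      using inner_resolvent_gamma[OF that(1) w xV] L0[OF x that(1)] L0[OF x, of "cnj w"] w that(2) by auto
    moreover have "\<langle>R w x, \<gamma> (cnj w)\<rangle> = 0"
      by (rule resolvent_family_punctured[OF gamma_family]) (use w xV ne in auto)
    ultimately have "\<langle>R w x, \<gamma> z\<rangle> = 0" if "Im z \<noteq> 0" for z
      using that by (cases "z = cnj w") auto
    then show ?thesis using resolvent_closed[OF w xV] unfolding L_def by blast
  qed
  have Tinv: "g \<in> L" if f: "(f, g) \<in> T" "f \<in> L" for f g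
  proof -
    have "\<langle>g, \<gamma> z\<rangle> = 0" if z: "Im z \<noteq> 0" for z
      using adjointD(3)[OF gamma_adj[OF z] f(1)] L0[OF f(2) z] T_carrier[OF f(1)] z
      by (simp add: inner_scale_right)
    then show ?thesis using T_carrier[OF f(1)] by (simp add: L_def)
  qed
  let ?TL = "restrict_op T L"
  have sym: "symmetric_operator (H\<lparr>hcarrier := L\<rparr>) ?TL"
    unfolding symmetric_operator_def linear_operator_def
  proof (intro conjI)
    show "?TL \<subseteq> hcarrier (H\<lparr>hcarrier := L\<rparr>) \<times> hcarrier (H\<lparr>hcarrier := L\<rparr>)"
      using Tinv unfolding restrict_op_def by auto
    show "single_valued ?TL"
      using linear_unique[OF T_linear] unfolding single_valued_def restrict_op_def by blast
    show "(hzero (H\<lparr>hcarrier := L\<rparr>), hzero (H\<lparr>hcarrier := L\<rparr>)) \<in> ?TL"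
      using linear_zero[OF T_linear] L.zero_closed unfolding restrict_op_def by simp
    show "\<forall>(f, f')\<in>?TL. \<forall>(g, g')\<in>?TL.
        (hadd (H\<lparr>hcarrier := L\<rparr>) f g, hadd (H\<lparr>hcarrier := L\<rparr>) f' g') \<in> ?TL"
      using linear_add[OF T_linear] L.add_closed unfolding restrict_op_def by auto
    show "\<forall>c. \<forall>(f, f')\<in>?TL. (hscale (H\<lparr>hcarrier := L\<rparr>) c f, hscale (H\<lparr>hcarrier := L\<rparr>) c f') \<in> ?TL"
      using linear_scale[OF T_linear] L.scale_closed unfolding restrict_op_def by auto
    show "\<forall>(f, f')\<in>?TL. \<forall>(g, g')\<in>?TL.
        hinner (H\<lparr>hcarrier := L\<rparr>) f' g = hinner (H\<lparr>hcarrier := L\<rparr>) f g'"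
      using symmetricD[OF T_symmetric] unfolding restrict_op_def by auto
  qed
  have surj: "(R w y, y \<oplus> w \<odot> R w y) \<in> ?TL" if y: "y \<in> L" and w: "Im w \<noteq> 0" for y w
  proof -
    have yV: "y \<in> V" using y LV by blast
    have "\<langle>y, gm\<rangle> = 0" "\<langle>R w y, gm\<rangle> = 0"
      using L0[OF y, of "- \<i>"] L0[OF inv[OF w y], of "- \<i>"] by (simp_all add: gamma_minus_i)
    then have "\<langle>(y \<oplus> w \<odot> R w y) \<ominus> \<i> \<odot> R w y, gm\<rangle> = 0"
      using yV w by (simp add: inner_simps)
    then show ?thesis
      unfolding restrict_op_def using T_iff resolvent_in_A[OF w yV] inv[OF w y] by blast
  qed
  have "self_adjoint (H\<lparr>hcarrier := L\<rparr>) ?TL"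
  proof (rule L.self_adjointI_surjective[OF sym])
    show "\<exists>f. (f, hadd (H\<lparr>hcarrier := L\<rparr>) y (hscale (H\<lparr>hcarrier := L\<rparr>) \<i> f)) \<in> ?TL"
      if "y \<in> hcarrier (H\<lparr>hcarrier := L\<rparr>)" for y
      using surj[of y \<i>] that by (intro exI[of _ "R \<i> y"]) simp
    show "\<exists>f. (f, hadd (H\<lparr>hcarrier := L\<rparr>) y (hscale (H\<lparr>hcarrier := L\<rparr>) (- \<i>) f)) \<in> ?TL"
      if "y \<in> hcarrier (H\<lparr>hcarrier := L\<rparr>)" for y
      using surj[of y "- \<i>"] that by (intro exI[of _ "R (- \<i>) y"]) simp
  qed
  moreover have "\<forall>(f, g)\<in>T. f \<in> L \<longrightarrow> g \<in> L" using Tinv by blast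
  ultimately have "L = {hzero H}"
    using prime cl unfolding prime_operator_def by metis
  then show ?thesis using x unfolding L_def by blast
qed

end

section \<open>Unitary maps determined by Gram matrices\<close>

text \<open>
  Linear combinations of \<open>g\<close> and of \<open>h\<close> with the same coefficients. As a relation it is defined before
  it is known that vanishing combinations correspond to each other.
\<close>

inductive_set span_pairs ::
    "('a, 'b) hspace_scheme \<Rightarrow> ('c, 'd) hspace_scheme \<Rightarrow> 'i set \<Rightarrow> ('i \<Rightarrow> 'a) \<Rightarrow> ('i \<Rightarrow> 'c) \<Rightarrow> ('a \<times> 'c) set"
  for H K I g h where
    zero: "(hzero H, hzero K) \<in> span_pairs H K I g h"
  | add: "\<lbrakk>(x, y) \<in> span_pairs H K I g h; i \<in> I\<rbrakk>
      \<Longrightarrow> (hadd H (hscale H c (g i)) x, hadd K (hscale K c (h i)) y) \<in> span_pairs H K I g h"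

locale gram_equal = A: hilbert_space H + B: hilbert_space K
  for H :: "('a, 'b) hspace_scheme" and K :: "('c, 'd) hspace_scheme" +
  fixes I :: "'i set" and g :: "'i \<Rightarrow> 'a" and h :: "'i \<Rightarrow> 'c"
  assumes g_mem: "i \<in> I \<Longrightarrow> g i \<in> hcarrier H"
    and h_mem: "i \<in> I \<Longrightarrow> h i \<in> hcarrier K"
    and gram_eq: "\<lbrakk>i \<in> I; j \<in> I\<rbrakk> \<Longrightarrow> hinner H (g i) (g j) = hinner K (h i) (h j)"
    and g_total: "\<lbrakk>x \<in> hcarrier H; \<And>i. i \<in> I \<Longrightarrow> hinner H x (g i) = 0\<rbrakk> \<Longrightarrow> x = hzero H"
    and h_total: "\<lbrakk>y \<in> hcarrier K; \<And>i. i \<in> I \<Longrightarrow> hinner K y (h i) = 0\<rbrakk> \<Longrightarrow> y = hzero K"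
begin

abbreviation S where "S \<equiv> span_pairs H K I g h"

lemma S_closed: "(x, y) \<in> S \<Longrightarrow> x \<in> hcarrier H \<and> y \<in> hcarrier K"
  by (induction rule: span_pairs.induct) (simp_all add: g_mem h_mem)

lemma S_add: "\<lbrakk>(x, y) \<in> S; (x', y') \<in> S\<rbrakk> \<Longrightarrow> (hadd H x x', hadd K y y') \<in> S"
proof (induction arbitrary: x' y' rule: span_pairs.induct)
  case zero
  then show ?case using S_closed[OF zero] by (simp add: A.add_zero B.add_zero)
next
  case (add x y i c)
  then show ?case
    using span_pairs.add[OF add.IH[OF add.prems] add.hyps(2), of c] S_closed[OF add.hyps(1)]
      S_closed[OF add.prems]
    by (simp add: A.add_assoc B.add_assoc g_mem h_mem)
qed

lemma S_scale: "(x, y) \<in> S \<Longrightarrow> (hscale H k x, hscale K k y) \<in> S"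
proof (induction rule: span_pairs.induct)
  case zero
  have "hscale H k (hzero H) = hzero H"
    by (rule A.eqI_inner) (simp_all add: A.inner_simps)
  moreover have "hscale K k (hzero K) = hzero K"
    by (rule B.eqI_inner) (simp_all add: B.inner_simps)
  ultimately show ?case using span_pairs.zero[of H K] by simp
next
  case (add x y i c)
  then show ?case
    using span_pairs.add[OF add.IH add.hyps(2), of "k * c"] S_closed[OF add.hyps(1)]
    by (simp add: A.scale_add_right B.scale_add_right A.scale_scale B.scale_scale g_mem h_mem)
qed

lemma S_inner: "\<lbrakk>(x, y) \<in> S; (x', y') \<in> S\<rbrakk> \<Longrightarrow> hinner H x x' = hinner K y y'"
proof (induction arbitrary: x' y' rule: span_pairs.induct)
  case zero
  then show ?case using S_closed[OF zero] by simp
next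
  case (add x y i c)
  have "hinner H (g i) x' = hinner K (h i) y'"
    using add.prems add.hyps(2)
  proof (induction rule: span_pairs.induct)
    case zero
    then show ?case by (simp add: g_mem h_mem)
  next
    case (add x y j c)
    then show ?case
      using S_closed[OF add.hyps(1)]
      by (simp add: A.inner_add_right B.inner_add_right A.inner_scale_right B.inner_scale_right
          g_mem h_mem gram_eq)
  qed
  then show ?case
    using add.IH[OF add.prems] S_closed[OF add.hyps(1)] S_closed[OF add.prems] add.hyps(2)
    by (simp add: A.inner_add_left B.inner_add_left A.inner_scale_left B.inner_scale_left g_mem h_mem)
qed

lemma S_gen:
  assumes i: "i \<in> I"
  shows "(g i, h i) \<in> S"
proof -
  have "hadd H (hscale H 1 (g i)) (hzero H) = g i"
    using i by (intro A.eqI_inner) (simp_all add: A.inner_simps g_mem)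
  moreover have "hadd K (hscale K 1 (h i)) (hzero K) = h i"
    using i by (intro B.eqI_inner) (simp_all add: B.inner_simps h_mem)
  ultimately show ?thesis using span_pairs.add[OF span_pairs.zero i, where c = 1 and H = H and K = K and g = g and h = h] by simp
qed

text \<open>The closure of the paired combinations; it turns out to be the graph of the unitary map.\<close>

definition G :: "('a \<times> 'c) set" where
  "G = {(x, y). \<exists>s t. (\<forall>n. (s n, t n) \<in> S) \<and> A.converges s x \<and> B.converges t y}"

lemma GI: "\<lbrakk>\<And>n. (s n, t n) \<in> S; A.converges s x; B.converges t y\<rbrakk> \<Longrightarrow> (x, y) \<in> G"
  unfolding G_def by blast

lemma G_closed: "(x, y) \<in> G \<Longrightarrow> x \<in> hcarrier H \<and> y \<in> hcarrier K"
  unfolding G_def by (auto simp: A.converges_def B.converges_def)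

lemma S_sub_G: "(x, y) \<in> S \<Longrightarrow> (x, y) \<in> G"
  using S_closed by (intro GI[of "\<lambda>n. x" "\<lambda>n. y"]) (auto intro: A.converges_const B.converges_const)

lemma G_add: assumes "(x, y) \<in> G" "(x', y') \<in> G" shows "(hadd H x x', hadd K y y') \<in> G"
proof -
  obtain s t s' t' where *: "\<And>n. (s n, t n) \<in> S" "A.converges s x" "B.converges t y"
      "\<And>n. (s' n, t' n) \<in> S" "A.converges s' x'" "B.converges t' y'"
    using assms unfolding G_def by blast
  show ?thesis
    by (rule GI[OF S_add[OF *(1,4)] A.converges_add[OF *(2,5)] B.converges_add[OF *(3,6)]])
qed

lemma G_scale: assumes "(x, y) \<in> G" shows "(hscale H c x, hscale K c y) \<in> G"
proof -
  obtain s t where *: "\<And>n. (s n, t n) \<in> S" "A.converges s x" "B.converges t y"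
    using assms unfolding G_def by blast
  show ?thesis
    by (rule GI[OF S_scale[OF *(1)] A.converges_scale[OF *(2)] B.converges_scale[OF *(3)]])
qed

lemma G_inner: assumes "(x, y) \<in> G" "(x', y') \<in> G" shows "hinner H x x' = hinner K y y'"
proof -
  obtain s t s' t' where *: "\<And>n. (s n, t n) \<in> S" "A.converges s x" "B.converges t y"
      "\<And>n. (s' n, t' n) \<in> S" "A.converges s' x'" "B.converges t' y'"
    using assms unfolding G_def by blast
  have "(\<lambda>n. hinner H (s n) (s' n)) \<longlonglongrightarrow> hinner H x x'"
    by (rule A.converges_inner[OF *(2,5)])
  moreover have "(\<lambda>n. hinner H (s n) (s' n)) \<longlonglongrightarrow> hinner K y y'"
    using B.converges_inner[OF *(3,6)] S_inner[OF *(1,4)] by simp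
  ultimately show ?thesis by (rule LIMSEQ_unique)
qed

lemma S_norm_diff:
  assumes "(x, y) \<in> S" "(x', y') \<in> S"
  shows "hnorm H (hdiff H x x') = hnorm K (hdiff K y y')"
proof -
  have "(hdiff H x x', hdiff K y y') \<in> S"
    unfolding hdiff_def by (intro S_add S_scale assms)
  then show ?thesis using S_inner by (simp add: hnorm_def)
qed

lemma G_single: assumes "(x, y) \<in> G" "(x, y') \<in> G" shows "y = y'"
proof -
  have "hinner K y u = hinner K y' u" if "(v, u) \<in> G" for u v
    using G_inner[OF assms(1) that] G_inner[OF assms(2) that] by simp
  from this[OF assms(1)] this[OF assms(2)]
  have "hinner K (hdiff K y y') (hdiff K y y') = 0"
    using G_closed[OF assms(1)] G_closed[OF assms(2)] by (simp add: B.inner_simps)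
  then show ?thesis
    using B.inner_definite[of "hdiff K y y'"] G_closed[OF assms(1)] G_closed[OF assms(2)]
    by (simp add: B.diff_eq_zero_iff)
qed

text \<open>
  The combinations of \<open>g\<close> are dense, and a Cauchy sequence of them is paired with a Cauchy sequence
  because the pairing is isometric.
\<close>

lemma G_Domain: assumes x: "x \<in> hcarrier H" shows "\<exists>y. (x, y) \<in> G"
proof -
  have X: "A.subspace (Domain S)"
    unfolding A.subspace_def
    using S_closed S_add S_scale span_pairs.zero[of H K I g h] by (safe; blast)
  obtain s where s: "range s \<subseteq> Domain S" "A.converges s x"
  proof (rule A.dense_sequence[OF X _ x])
    fix v assume v: "v \<in> hcarrier H" "\<And>u. u \<in> Domain S \<Longrightarrow> hinner H v u = 0"
    have "hinner H v (g i) = 0" if "i \<in> I" for i using v(2) S_gen[OF that] by blast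
    then show "v = hzero H" using g_total v(1) by blast
  qed
  have "\<forall>n. \<exists>t. (s n, t) \<in> S" using s(1) by blast
  then obtain t where t: "\<And>n. (s n, t n) \<in> S" by metis
  have "\<exists>y. B.converges t y"
  proof (rule B.cauchy_converges)
    show "range t \<subseteq> hcarrier K" using S_closed[OF t] by blast
    show "\<exists>N. \<forall>m\<ge>N. \<forall>n\<ge>N. hnorm K (hdiff K (t m) (t n)) < e" if "e > 0" for e
      using A.converges_cauchy[OF s(2) that] S_norm_diff[OF t t] by simp
  qed
  then show ?thesis using GI[OF t s(2)] by blast
qed

end

lemma gram_equal_swap:
  assumes "gram_equal H K I g h"
  shows "gram_equal K H I h g"
proof -
  interpret gram_equal H K I g h by fact
  show ?thesis
    by unfold_locales (use g_mem h_mem gram_eq g_total h_total in auto)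
qed

lemma span_pairs_swap: "(x, y) \<in> span_pairs H K I g h \<Longrightarrow> (y, x) \<in> span_pairs K H I h g"
  by (induction rule: span_pairs.induct) (auto intro: span_pairs.intros)

text \<open>
  Equal Gram matrices make the pairing isometric, hence single-valued. Totality of \<open>g\<close> makes it defined
  everywhere, and by symmetry totality of \<open>h\<close> makes it onto.
\<close>

theorem (in gram_equal) unitary_extension:
  obtains U where "unitary_map H K U" "\<And>i. i \<in> I \<Longrightarrow> U (g i) = h i"
proof -
  interpret swap: gram_equal K H I h g by (rule gram_equal_swap) unfold_locales
  define U where "U x = (THE y. (x, y) \<in> G)" for x
  have U: "(x, U x) \<in> G" if "x \<in> hcarrier H" for x
  proof -
    have "\<exists>!y. (x, y) \<in> G" using G_Domain[OF that] G_single by blast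
    then show ?thesis unfolding U_def by (rule theI')
  qed
  have Ueq: "U x = y" if "(x, y) \<in> G" for x y
    using G_single[OF U that] G_closed[OF that] by blast
  have "unitary_map H K U" unfolding unitary_map_def
  proof (intro conjI ballI allI)
    show "U ` hcarrier H = hcarrier K"
    proof
      show "U ` hcarrier H \<subseteq> hcarrier K" using G_closed[OF U] by blast
      show "hcarrier K \<subseteq> U ` hcarrier H"
      proof
        fix y assume "y \<in> hcarrier K"
        then obtain x where "(y, x) \<in> swap.G" using swap.G_Domain by blast
        then have "(x, y) \<in> G"
          unfolding swap.G_def G_def by (blast intro: span_pairs_swap)
        then show "y \<in> U ` hcarrier H" using Ueq G_closed by blast
      qed
    qed
    show "U (hadd H f g) = hadd K (U f) (U g)" if "f \<in> hcarrier H" "g \<in> hcarrier H" for f g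
      by (rule Ueq[OF G_add[OF U[OF that(1)] U[OF that(2)]]])
    show "U (hscale H c f) = hscale K c (U f)" if "f \<in> hcarrier H" for c f
      by (rule Ueq[OF G_scale[OF U[OF that]]])
    show "hinner K (U f) (U g) = hinner H f g" if "f \<in> hcarrier H" "g \<in> hcarrier H" for f g
      using G_inner[OF U[OF that(1)] U[OF that(2)]] by simp
  qed
  moreover have "U (g i) = h i" if "i \<in> I" for i
    by (rule Ueq[OF S_sub_G[OF S_gen[OF that]]])
  ultimately show thesis using that by blast
qed

section \<open>Triples in terms of a resolvent family\<close>

text \<open>
  How a triple is recovered from the vectors \<open>\<gamma> z\<close> and the number \<open>\<kappa>\<close>. The map \<open>\<rho>\<close> is the resolvent of
  \<open>A\<close> at \<open>\<i>\<close>; its action is prescribed through the adjoint, the resolvent at \<open>- \<i>\<close>, which sends \<open>\<gamma> z\<close> to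
  \<open>(\<gamma> z - \<gamma> (- \<i>)) / (z + \<i>)\<close>.
\<close>

locale resolvent_model = hilbert_space H
  for H :: "('a, 'b) hspace_scheme" +
  fixes \<gamma> :: "complex \<Rightarrow> 'a" and \<rho> :: "'a \<Rightarrow> 'a" and \<kappa> :: complex and T D A :: "'a operator"
  assumes family: "resolvent_family \<gamma>"
    and total: "\<lbrakk>x \<in> hcarrier H; \<And>z. Im z \<noteq> 0 \<Longrightarrow> hinner H x (\<gamma> z) = 0\<rbrakk> \<Longrightarrow> x = hzero H"
    and rho_closed: "x \<in> hcarrier H \<Longrightarrow> \<rho> x \<in> hcarrier H"
    and rho_gamma: "\<lbrakk>x \<in> hcarrier H; Im z \<noteq> 0\<rbrakk> \<Longrightarrow>
      cnj (z + \<i>) * hinner H (\<rho> x) (\<gamma> z) = hinner H x (\<gamma> z) - hinner H x (\<gamma> (- \<i>))"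
    and A_eq: "A = {(\<rho> x, hadd H x (hscale H \<i> (\<rho> x))) | x. x \<in> hcarrier H}"
    and T_eq: "T = {(f, f'). (f, f') \<in> A \<and> hinner H (hdiff H f' (hscale H \<i> f)) (\<gamma> (- \<i>)) = 0}"
    and D_eq: "D = span_extension H T (hdiff H (\<gamma> \<i>) (hscale H \<kappa> (\<gamma> (- \<i>))))"
begin

lemma total_punctured:
  assumes x: "x \<in> V" and w: "Im w \<noteq> 0" and z: "\<And>z. \<lbrakk>Im z \<noteq> 0; z \<noteq> w\<rbrakk> \<Longrightarrow> \<langle>x, \<gamma> z\<rangle> = 0"
  shows "x = hzero H"
  using total[OF x] resolvent_family_punctured[OF family w x] z by blast

end

lemma unitary_map_diff:
  assumes "unitary_map H K U" "hilbert_space H" "f \<in> hcarrier H" "g \<in> hcarrier H"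
  shows "U (hdiff H f g) = hdiff K (U f) (U g)"
proof -
  interpret hilbert_space H by fact
  show ?thesis using assms by (simp add: unitary_map_def hdiff_def)
qed

lemma unitary_map_inj:
  assumes U: "unitary_map H K U" and H: "hilbert_space H" and K: "hilbert_space K"
    and fg: "f \<in> hcarrier H" "g \<in> hcarrier H" "U f = U g"
  shows "f = g"
proof -
  interpret H: hilbert_space H by fact
  interpret K: hilbert_space K by fact
  have "hinner H (hdiff H f g) (hdiff H f g) = hinner K (hdiff K (U f) (U g)) (hdiff K (U f) (U g))"
    using U fg unitary_map_diff[OF U H fg(1,2)] H.diff_closed[OF fg(1,2)] unfolding unitary_map_def by metis
  also have "\<dots> = 0"
  proof -
    have "U g \<in> hcarrier K" using U fg unfolding unitary_map_def by blast
    then have "hdiff K (U g) (U g) = hzero K" by (simp add: K.diff_eq_zero_iff)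
    then show ?thesis using fg by simp
  qed
  finally show ?thesis using H.inner_definite[of "hdiff H f g"] fg by (simp add: H.diff_eq_zero_iff)
qed

lemma adjoint_conjugate:
  assumes U: "unitary_map H K U" and T: "T \<subseteq> hcarrier H \<times> hcarrier H"
  shows "adjoint_op K (op_conjugate U T) = op_conjugate U (adjoint_op H T)"
proof -
  have surj: "U ` hcarrier H = hcarrier K"
    and inner: "\<And>f g. \<lbrakk>f \<in> hcarrier H; g \<in> hcarrier H\<rbrakk> \<Longrightarrow> hinner K (U f) (U g) = hinner H f g"
    using U unfolding unitary_map_def by blast+
  have *: "(U g, U h) \<in> adjoint_op K (op_conjugate U T) \<longleftrightarrow> (g, h) \<in> adjoint_op H T"
    if gh: "g \<in> hcarrier H" "h \<in> hcarrier H" for g h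
  proof -
    have "hinner K (U f') (U g) = hinner K (U f) (U h) \<longleftrightarrow> hinner H f' g = hinner H f h"
      if "(f, f') \<in> T" for f f'
      using that T gh inner by (metis (no_types, lifting) SigmaE2 subsetD)
    moreover have "U g \<in> hcarrier K" "U h \<in> hcarrier K" using gh surj by blast+
    ultimately show ?thesis
      using gh unfolding adjoint_op_def op_conjugate_def by blast
  qed
  show ?thesis
  proof
    show "adjoint_op K (op_conjugate U T) \<subseteq> op_conjugate U (adjoint_op H T)"
    proof clarify
      fix y k assume yk: "(y, k) \<in> adjoint_op K (op_conjugate U T)"
      then have "y \<in> U ` hcarrier H" "k \<in> U ` hcarrier H" unfolding surj adjoint_op_def by auto
      then show "(y, k) \<in> op_conjugate U (adjoint_op H T)"
        using yk * unfolding op_conjugate_def by blast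
    qed
    show "op_conjugate U (adjoint_op H T) \<subseteq> adjoint_op K (op_conjugate U T)"
      using * unfolding op_conjugate_def adjoint_op_def[of H] by blast
  qed
qed

text \<open>
  The unitary map with \<open>\<gamma> z \<mapsto> \<delta> z\<close> intertwines \<open>\<rho>\<close> and \<open>\<sigma>\<close>, because both have prescribed inner products
  with total families. It therefore intertwines everything that is built from them. The Gram matrices
  are compared where the Gram formula determines them, off \<open>z = cnj w\<close>.
\<close>

theorem resolvent_models_equivalent:
  assumes "resolvent_model H \<gamma> \<rho> \<kappa> T D A" and "resolvent_model K \<delta> \<sigma> \<kappa> T' D' A'"
    and gram: "\<And>z w. \<lbrakk>Im z \<noteq> 0; Im w \<noteq> 0; z \<noteq> cnj w\<rbrakk>
      \<Longrightarrow> hinner H (\<gamma> z) (\<gamma> w) = hinner K (\<delta> z) (\<delta> w)"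
  shows "triples_unitarily_equivalent H (T, D, A) K (T', D', A')"
proof -
  interpret H: resolvent_model H \<gamma> \<rho> \<kappa> T D A by fact
  interpret K: resolvent_model K \<delta> \<sigma> \<kappa> T' D' A' by fact
  have gV: "\<gamma> z \<in> hcarrier H" and dV: "\<delta> z \<in> hcarrier K" if "Im z \<noteq> 0" for z
    using that H.resolvent_family_closed[OF H.family] K.resolvent_family_closed[OF K.family] by auto
  \<comment> \<open>Continuity extends the equality to \<open>z = cnj w\<close>.\<close>
  have gram': "hinner H (\<gamma> z) (\<gamma> w) = hinner K (\<delta> z) (\<delta> w)" if z: "Im z \<noteq> 0" and w: "Im w \<noteq> 0" for z w
  proof (rule tendsto_unique[OF _ H.resolvent_family_continuous[OF H.family w gV[OF z]]])
    have "\<forall>\<^sub>F v in at w. hinner K (\<delta> z) (\<delta> v) = hinner H (\<gamma> z) (\<gamma> v)"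
    proof (cases "z = cnj w")
      case True
      show ?thesis using H.eventually_nonreal[OF w]
        by eventually_elim (use gram[OF z] True in auto)
    next
      case False
      have "((\<lambda>v. cnj v) \<longlongrightarrow> cnj w) (at w)" by (intro tendsto_intros)
      then have "\<forall>\<^sub>F v in at w. cnj v \<noteq> z" using False by (intro tendsto_imp_eventually_ne) auto
      with H.eventually_nonreal[OF w] show ?thesis
        by eventually_elim (use gram[OF z] in auto)
    qed
    then show "((\<lambda>v. hinner H (\<gamma> z) (\<gamma> v)) \<longlongrightarrow> hinner K (\<delta> z) (\<delta> w)) (at w)"
      using K.resolvent_family_continuous[OF K.family w dV[OF z]] by (rule Lim_transform_eventually[rotated])
  qed simp
  interpret gram_equal H K "{z. Im z \<noteq> 0}" \<gamma> \<delta>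
    by unfold_locales (use gV dV gram' H.total K.total in auto)
  obtain U where U: "unitary_map H K U" and Ug: "\<And>z. Im z \<noteq> 0 \<Longrightarrow> U (\<gamma> z) = \<delta> z"
    using unitary_extension by auto
  have surj: "U ` hcarrier H = hcarrier K"
    and Uadd: "\<And>f g. \<lbrakk>f \<in> hcarrier H; g \<in> hcarrier H\<rbrakk> \<Longrightarrow> U (hadd H f g) = hadd K (U f) (U g)"
    and Uscale: "\<And>c f. f \<in> hcarrier H \<Longrightarrow> U (hscale H c f) = hscale K c (U f)"
    and Uinner: "\<And>f g. \<lbrakk>f \<in> hcarrier H; g \<in> hcarrier H\<rbrakk> \<Longrightarrow> hinner K (U f) (U g) = hinner H f g"
    using U unfolding unitary_map_def by blast+
  have UV: "U f \<in> hcarrier K" if "f \<in> hcarrier H" for f using surj that by blast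
  note Udiff = unitary_map_diff[OF U H.hilbert_space_axioms]
  have Urho: "U (\<rho> x) = \<sigma> (U x)" if x: "x \<in> hcarrier H" for x
  proof -
    let ?d = "hdiff K (U (\<rho> x)) (\<sigma> (U x))"
    have V: "U (\<rho> x) \<in> hcarrier K" "\<sigma> (U x) \<in> hcarrier K"
      using x UV H.rho_closed K.rho_closed by auto
    have "?d = hzero K"
    proof (rule K.total_punctured[where w = "- \<i>"])
      fix z assume z: "Im z \<noteq> 0" "z \<noteq> - \<i>"
      have "cnj (z + \<i>) * hinner K (U (\<rho> x)) (\<delta> z) = cnj (z + \<i>) * hinner H (\<rho> x) (\<gamma> z)"
        using Uinner[OF H.rho_closed[OF x] gV[OF z(1)]] z by (simp add: Ug)
      also have "\<dots> = hinner H x (\<gamma> z) - hinner H x (\<gamma> (- \<i>))" by (rule H.rho_gamma[OF x z(1)])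
      also have "\<dots> = hinner K (U x) (\<delta> z) - hinner K (U x) (\<delta> (- \<i>))"
        using Uinner[OF x gV[OF z(1)]] Uinner[OF x gV[of "- \<i>"]] z by (simp add: Ug)
      also have "\<dots> = cnj (z + \<i>) * hinner K (\<sigma> (U x)) (\<delta> z)"
        by (rule K.rho_gamma[OF UV[OF x] z(1), symmetric])
      finally have "hinner K (U (\<rho> x)) (\<delta> z) = hinner K (\<sigma> (U x)) (\<delta> z)"
        using z(2) complex_cnj_zero_iff[of "z + \<i>"] by (auto simp: add_eq_0_iff2 simp del: complex_cnj_add)
      then show "hinner K ?d (\<delta> z) = 0" using V dV[OF z(1)] by (simp add: K.inner_diff_left)
    qed (use V in simp_all)
    then show ?thesis using V by (simp add: K.diff_eq_zero_iff)
  qed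
  have A: "A' = op_conjugate U A"
  proof -
    have "op_conjugate U A = {(\<sigma> (U x), hadd K (U x) (hscale K \<i> (\<sigma> (U x)))) | x. x \<in> hcarrier H}"
      unfolding op_conjugate_def H.A_eq using Urho H.rho_closed Uadd Uscale H.scale_closed
      by (auto; metis)
    also have "\<dots> = A'" unfolding K.A_eq surj[symmetric] by blast
    finally show ?thesis ..
  qed
  have AV: "A \<subseteq> hcarrier H \<times> hcarrier H"
    unfolding H.A_eq using H.rho_closed by auto
  have TA: "T \<subseteq> A" unfolding H.T_eq by blast
  have TV: "T \<subseteq> hcarrier H \<times> hcarrier H" using TA AV by blast
  have T: "T' = op_conjugate U T"
  proof -
    have *: "hinner K (hdiff K (U f') (hscale K \<i> (U f))) (\<delta> (- \<i>))
        = hinner H (hdiff H f' (hscale H \<i> f)) (\<gamma> (- \<i>))" if "(f, f') \<in> A" for f f'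
    proof -
      have V: "f \<in> hcarrier H" "f' \<in> hcarrier H" using that AV by auto
      then show ?thesis
        using Uinner[of "hdiff H f' (hscale H \<i> f)" "\<gamma> (- \<i>)"] gV[of "- \<i>"]
        by (simp add: Udiff Uscale Ug)
    qed
    show ?thesis
    proof
      show "T' \<subseteq> op_conjugate U T"
      proof clarify
        fix y y' assume y: "(y, y') \<in> T'"
        then have "(y, y') \<in> op_conjugate U A" unfolding A[symmetric] K.T_eq by blast
        then obtain f f' where f: "(f, f') \<in> A" "y = U f" "y' = U f'" unfolding op_conjugate_def by blast
        then have "(f, f') \<in> T" using y *[OF f(1)] unfolding K.T_eq H.T_eq by simp
        then show "(y, y') \<in> op_conjugate U T" using f unfolding op_conjugate_def by blast
      qed
      show "op_conjugate U T \<subseteq> T'"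
      proof clarify
        fix y y' assume "(y, y') \<in> op_conjugate U T"
        then obtain f f' where f: "(f, f') \<in> T" "y = U f" "y' = U f'" unfolding op_conjugate_def by blast
        then have fA: "(f, f') \<in> A" using TA by blast
        then have "(y, y') \<in> A'" unfolding A op_conjugate_def using f by blast
        then show "(y, y') \<in> T'" using f *[OF fA] unfolding K.T_eq H.T_eq by simp
      qed
    qed
  qed
  have D: "D' = op_conjugate U D"
  proof -
    let ?h = "hdiff H (\<gamma> \<i>) (hscale H \<kappa> (\<gamma> (- \<i>)))" and ?k = "hdiff K (\<delta> \<i>) (hscale K \<kappa> (\<delta> (- \<i>)))"
    have hV: "?h \<in> hcarrier H" using gV[of \<i>] gV[of "- \<i>"] by simp
    have Uh: "U ?h = ?k" using gV[of \<i>] gV[of "- \<i>"] by (simp add: Udiff Uscale Ug)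
    have Ucomb: "U (hadd H f0 (hscale H c ?h)) = hadd K (U f0) (hscale K c ?k)"
      if "f0 \<in> Domain T" for f0 c
    proof -
      have "f0 \<in> hcarrier H" using that TV by blast
      then show ?thesis using hV by (simp add: Uadd Uscale Uh)
    qed
    have DomT: "Domain T' = U ` Domain T" unfolding T op_conjugate_def by blast
    have Dom: "{hadd K f0 (hscale K c ?k) | f0 c. f0 \<in> Domain T'}
      = U ` {hadd H f0 (hscale H c ?h) | f0 c. f0 \<in> Domain T}" (is "?DK = U ` ?DH")
    proof
      show "?DK \<subseteq> U ` ?DH"
      proof
        fix y assume "y \<in> ?DK"
        then obtain f0 c where *: "f0 \<in> Domain T" "y = hadd K (U f0) (hscale K c ?k)"
          unfolding DomT by blast
        then have "y = U (hadd H f0 (hscale H c ?h))" using Ucomb by simp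
        then show "y \<in> U ` ?DH" using * by blast
      qed
      show "U ` ?DH \<subseteq> ?DK"
      proof clarify
        fix f0 k c assume "(f0, k) \<in> T"
        then have "f0 \<in> Domain T" by blast
        then show "\<exists>f0' c'. U (hadd H f0 (hscale H c ?h)) = hadd K f0' (hscale K c' ?k) \<and> f0' \<in> Domain T'"
          using Ucomb[of f0 c] DomT by blast
      qed
    qed
    have DHV: "?DH \<subseteq> hcarrier H" using TV hV by auto
    have TadjV: "adjoint_op H T \<subseteq> hcarrier H \<times> hcarrier H" unfolding adjoint_op_def by blast
    have "op_conjugate U (restrict_op (adjoint_op H T) ?DH)
        = restrict_op (op_conjugate U (adjoint_op H T)) (U ` ?DH)" (is "?L = ?R")
    proof
      show "?L \<subseteq> ?R" unfolding op_conjugate_def restrict_op_def by blast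
      show "?R \<subseteq> ?L"
      proof clarify
        fix y y' assume "(y, y') \<in> ?R"
        then obtain f f' g where f: "(f, f') \<in> adjoint_op H T" "y = U f" "y' = U f'" "y = U g" "g \<in> ?DH"
          unfolding op_conjugate_def restrict_op_def by blast
        have "f = g"
          using f DHV TadjV
          by (intro unitary_map_inj[OF U H.hilbert_space_axioms K.hilbert_space_axioms]) auto
        then show "(y, y') \<in> ?L" using f unfolding op_conjugate_def restrict_op_def by blast
      qed
    qed
    moreover have "adjoint_op K T' = op_conjugate U (adjoint_op H T)"
      unfolding T by (rule adjoint_conjugate[OF U TV])
    ultimately show ?thesis unfolding K.D_eq H.D_eq Dom by simp
  qed
  show ?thesis using U T D A by auto
qed

section \<open>The Hilbert space of square integrable functions\<close>

lemma l2_functionsD: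
  assumes "f \<in> l2_functions \<mu>"
  shows l2_measurable: "f \<in> borel_measurable \<mu>"
    and l2_integrable: "integrable \<mu> (\<lambda>t. (cmod (f t))\<^sup>2)"
  using assms by (simp_all add: l2_functions_def)

lemma l2_functionsI_bound:
  assumes "f \<in> borel_measurable \<mu>" "integrable \<mu> g" "\<And>t. (cmod (f t))\<^sup>2 \<le> g t"
  shows "f \<in> l2_functions \<mu>"
proof -
  have "norm ((cmod (f t))\<^sup>2) \<le> norm (g t)" for t using assms(3)[of t] by simp
  then have "integrable \<mu> (\<lambda>t. (cmod (f t))\<^sup>2)"
    using assms(1) by (intro Bochner_Integration.integrable_bound[OF assms(2)]) auto
  then show ?thesis using assms(1) by (simp add: l2_functions_def)
qed

lemma l2_add:
  assumes f: "f \<in> l2_functions \<mu>" and g: "g \<in> l2_functions \<mu>"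
  shows "(\<lambda>t. f t + g t) \<in> l2_functions \<mu>"
proof (rule l2_functionsI_bound)
  note [measurable] = l2_measurable[OF f] l2_measurable[OF g]
  show "(\<lambda>t. f t + g t) \<in> borel_measurable \<mu>" by measurable
  show "integrable \<mu> (\<lambda>t. 2 * (cmod (f t))\<^sup>2 + 2 * (cmod (g t))\<^sup>2)"
    using l2_integrable[OF f] l2_integrable[OF g] by simp
  show "(cmod (f t + g t))\<^sup>2 \<le> 2 * (cmod (f t))\<^sup>2 + 2 * (cmod (g t))\<^sup>2" for t
  proof -
    have "(cmod (f t + g t))\<^sup>2 \<le> (cmod (f t) + cmod (g t))\<^sup>2"
      by (intro power_mono norm_triangle_ineq) simp
    also have "\<dots> \<le> 2 * (cmod (f t))\<^sup>2 + 2 * (cmod (g t))\<^sup>2"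
      using sum_squares_bound[of "cmod (f t)" "cmod (g t)"] by (simp add: power2_sum)
    finally show ?thesis .
  qed
qed

lemma l2_mult_bounded:
  assumes f: "f \<in> l2_functions \<mu>" and g: "g \<in> borel_measurable \<mu>" and C: "\<And>t. cmod (g t) \<le> C"
  shows "(\<lambda>t. g t * f t) \<in> l2_functions \<mu>"
proof (rule l2_functionsI_bound)
  note [measurable] = l2_measurable[OF f] g
  show "(\<lambda>t. g t * f t) \<in> borel_measurable \<mu>" by measurable
  show "integrable \<mu> (\<lambda>t. C\<^sup>2 * (cmod (f t))\<^sup>2)" using l2_integrable[OF f] by simp
  show "(cmod (g t * f t))\<^sup>2 \<le> C\<^sup>2 * (cmod (f t))\<^sup>2" for t
    using C[of t] by (auto simp: norm_mult power_mult_distrib intro!: mult_right_mono power_mono)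
qed

lemma l2_scale: "f \<in> l2_functions \<mu> \<Longrightarrow> (\<lambda>t. c * f t) \<in> l2_functions \<mu>"
  by (rule l2_mult_bounded[where C = "cmod c"]) auto

lemma l2_diff:
  assumes "f \<in> l2_functions \<mu>" "g \<in> l2_functions \<mu>"
  shows "(\<lambda>t. f t - g t) \<in> l2_functions \<mu>"
  using l2_add[OF assms(1) l2_scale[OF assms(2), of "-1"]] by simp

lemma l2_zero: "(\<lambda>t. 0) \<in> l2_functions \<mu>"
  by (simp add: l2_functions_def)

lemma l2_product_integrable:
  assumes f: "f \<in> l2_functions \<mu>" and g: "g \<in> l2_functions \<mu>"
  shows "integrable \<mu> (\<lambda>t. f t * g t)"
proof (rule Bochner_Integration.integrable_bound)
  note [measurable] = l2_measurable[OF f] l2_measurable[OF g]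
  show "integrable \<mu> (\<lambda>t. (cmod (f t))\<^sup>2 + (cmod (g t))\<^sup>2)"
    using l2_integrable[OF f] l2_integrable[OF g] by simp
  show "(\<lambda>t. f t * g t) \<in> borel_measurable \<mu>" by measurable
  have "cmod (f t) * cmod (g t) \<le> (cmod (f t))\<^sup>2 + (cmod (g t))\<^sup>2" for t
  proof -
    have "0 \<le> cmod (f t) * cmod (g t)" by simp
    then show ?thesis using sum_squares_bound[of "cmod (f t)" "cmod (g t)"] by linarith
  qed
  then show "AE t in \<mu>. norm (f t * g t) \<le> norm ((cmod (f t))\<^sup>2 + (cmod (g t))\<^sup>2)"
    by (simp add: norm_mult)
qed

lemma l2_cnj:
  assumes f: "f \<in> l2_functions \<mu>"
  shows "(\<lambda>t. cnj (f t)) \<in> l2_functions \<mu>"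
proof -
  have "cnj \<in> borel_measurable borel"
    by (intro borel_measurable_continuous_onI continuous_intros)
  then have "(\<lambda>t. cnj (f t)) \<in> borel_measurable \<mu>"
    by (rule measurable_compose[OF l2_measurable[OF f]])
  then show ?thesis using l2_integrable[OF f] by (simp add: l2_functions_def)
qed

lemma l2_inner_integrable:
  "\<lbrakk>f \<in> l2_functions \<mu>; g \<in> l2_functions \<mu>\<rbrakk> \<Longrightarrow> integrable \<mu> (\<lambda>t. f t * cnj (g t))"
  by (intro l2_product_integrable l2_cnj)

lemma equiv_l2_rel: "equiv (l2_functions \<mu>) (l2_rel \<mu>)"
proof (rule equivI)
  show "l2_rel \<mu> \<subseteq> l2_functions \<mu> \<times> l2_functions \<mu>" "refl_on (l2_functions \<mu>) (l2_rel \<mu>)"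
    by (auto simp: l2_rel_def refl_on_def)
  show "sym (l2_rel \<mu>)" by (auto simp: l2_rel_def sym_def elim: eventually_mono)
  show "trans (l2_rel \<mu>)" unfolding trans_def l2_rel_def by (auto elim: eventually_elim2)
qed

lemma l2_class_eq_iff:
  assumes "f \<in> l2_functions \<mu>" "g \<in> l2_functions \<mu>"
  shows "l2_class \<mu> f = l2_class \<mu> g \<longleftrightarrow> (AE t in \<mu>. f t = g t)"
  using eq_equiv_class_iff[OF equiv_l2_rel assms] assms by (simp add: l2_class_def l2_rel_def)

lemma l2_class_mem: "f \<in> l2_functions \<mu> \<Longrightarrow> l2_class \<mu> f \<in> hcarrier (L2 \<mu>)"
  by (simp add: L2_def l2_class_def quotientI)

lemma l2_carrierE:
  assumes "X \<in> hcarrier (L2 \<mu>)"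
  obtains f where "f \<in> l2_functions \<mu>" "X = l2_class \<mu> f"
  using assms by (auto simp: L2_def l2_class_def elim: quotientE)

lemma l2_rep_class:
  assumes "f \<in> l2_functions \<mu>"
  shows l2_rep_mem: "l2_rep (l2_class \<mu> f) \<in> l2_functions \<mu>"
    and l2_rep_AE: "AE t in \<mu>. l2_rep (l2_class \<mu> f) t = f t"
proof -
  have "f \<in> l2_class \<mu> f" using assms by (simp add: l2_class_def l2_rel_def)
  then have "l2_rep (l2_class \<mu> f) \<in> l2_class \<mu> f" unfolding l2_rep_def by (rule someI[of "\<lambda>x. x \<in> l2_class \<mu> f"])
  then show "l2_rep (l2_class \<mu> f) \<in> l2_functions \<mu>" "AE t in \<mu>. l2_rep (l2_class \<mu> f) t = f t"
    by (auto simp: l2_class_def l2_rel_def elim: eventually_mono)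
qed

lemma L2_zero: "hzero (L2 \<mu>) = l2_class \<mu> (\<lambda>t. 0)"
  by (simp add: L2_def)

lemma L2_add:
  assumes f: "f \<in> l2_functions \<mu>" and g: "g \<in> l2_functions \<mu>"
  shows "hadd (L2 \<mu>) (l2_class \<mu> f) (l2_class \<mu> g) = l2_class \<mu> (\<lambda>t. f t + g t)"
proof -
  have "AE t in \<mu>. l2_rep (l2_class \<mu> f) t + l2_rep (l2_class \<mu> g) t = f t + g t"
    using l2_rep_AE[OF f] l2_rep_AE[OF g] by eventually_elim simp
  then show ?thesis
    by (simp add: L2_def l2_class_eq_iff l2_add l2_rep_mem f g)
qed

lemma L2_scale:
  assumes f: "f \<in> l2_functions \<mu>"
  shows "hscale (L2 \<mu>) c (l2_class \<mu> f) = l2_class \<mu> (\<lambda>t. c * f t)"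
proof -
  have "AE t in \<mu>. c * l2_rep (l2_class \<mu> f) t = c * f t"
    using l2_rep_AE[OF f] by eventually_elim simp
  then show ?thesis by (simp add: L2_def l2_class_eq_iff l2_scale l2_rep_mem f)
qed

lemma L2_diff:
  assumes f: "f \<in> l2_functions \<mu>" and g: "g \<in> l2_functions \<mu>"
  shows "hdiff (L2 \<mu>) (l2_class \<mu> f) (l2_class \<mu> g) = l2_class \<mu> (\<lambda>t. f t - g t)"
  using L2_add[OF f l2_scale[OF g, of "-1"]] by (simp add: hdiff_def L2_scale g)

lemma L2_inner:
  assumes f: "f \<in> l2_functions \<mu>" and g: "g \<in> l2_functions \<mu>"
  shows "hinner (L2 \<mu>) (l2_class \<mu> f) (l2_class \<mu> g) = (\<integral>t. f t * cnj (g t) \<partial>\<mu>)"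
proof -
  have "(\<integral>t. l2_rep (l2_class \<mu> f) t * cnj (l2_rep (l2_class \<mu> g) t) \<partial>\<mu>) = (\<integral>t. f t * cnj (g t) \<partial>\<mu>)"
  proof (rule integral_cong_AE)
    show "AE t in \<mu>. l2_rep (l2_class \<mu> f) t * cnj (l2_rep (l2_class \<mu> g) t) = f t * cnj (g t)"
      using l2_rep_AE[OF f] l2_rep_AE[OF g] by eventually_elim simp
  qed (use l2_inner_integrable l2_rep_mem f g in \<open>blast intro: borel_measurable_integrable\<close>)+
  then show ?thesis by (simp add: L2_def)
qed

lemma L2_inner_self:
  assumes f: "f \<in> l2_functions \<mu>"
  shows "hinner (L2 \<mu>) (l2_class \<mu> f) (l2_class \<mu> f) = of_real (\<integral>t. (cmod (f t))\<^sup>2 \<partial>\<mu>)"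
  unfolding L2_inner[OF f f] by (simp add: complex_norm_square[symmetric] del: of_real_power)

lemma L2_norm:
  assumes f: "f \<in> l2_functions \<mu>"
  shows "hnorm (L2 \<mu>) (l2_class \<mu> f) = sqrt (\<integral>t. (cmod (f t))\<^sup>2 \<partial>\<mu>)"
  by (simp add: hnorm_def L2_inner_self[OF f])

interpretation L2: inner_product_space "L2 \<mu>" for \<mu>
proof unfold_locales
  show "hzero (L2 \<mu>) \<in> hcarrier (L2 \<mu>)" by (simp add: L2_zero l2_class_mem l2_zero)
next
  fix X Y assume "X \<in> hcarrier (L2 \<mu>)" "Y \<in> hcarrier (L2 \<mu>)"
  then obtain f g where fg: "f \<in> l2_functions \<mu>" "X = l2_class \<mu> f" "g \<in> l2_functions \<mu>" "Y = l2_class \<mu> g"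
    by (elim l2_carrierE)
  show "hadd (L2 \<mu>) X Y \<in> hcarrier (L2 \<mu>)" using fg by (simp add: L2_add l2_class_mem l2_add)
  show "hadd (L2 \<mu>) X Y = hadd (L2 \<mu>) Y X" using fg by (simp add: L2_add add.commute)
  show "hscale (L2 \<mu>) c (hadd (L2 \<mu>) X Y) = hadd (L2 \<mu>) (hscale (L2 \<mu>) c X) (hscale (L2 \<mu>) c Y)" for c
    using fg by (simp add: L2_add L2_scale l2_add l2_scale distrib_left)
  show "hinner (L2 \<mu>) (hscale (L2 \<mu>) c X) Y = c * hinner (L2 \<mu>) X Y" for c
    using fg by (simp add: L2_scale L2_inner l2_scale mult.assoc)
  show "hinner (L2 \<mu>) X Y = cnj (hinner (L2 \<mu>) Y X)"
    using fg Bochner_Integration.integral_cnj[of \<mu> "\<lambda>t. g t * cnj (f t)"] by (simp add: L2_inner mult.commute)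
  fix Z assume "Z \<in> hcarrier (L2 \<mu>)"
  then obtain h where h: "h \<in> l2_functions \<mu>" "Z = l2_class \<mu> h" by (elim l2_carrierE)
  show "hadd (L2 \<mu>) (hadd (L2 \<mu>) X Y) Z = hadd (L2 \<mu>) X (hadd (L2 \<mu>) Y Z)"
    using fg h by (simp add: L2_add l2_add add.assoc)
  show "hinner (L2 \<mu>) (hadd (L2 \<mu>) X Y) Z = hinner (L2 \<mu>) X Z + hinner (L2 \<mu>) Y Z"
    using fg h by (simp add: L2_add L2_inner l2_add distrib_right l2_inner_integrable)
next
  fix X assume "X \<in> hcarrier (L2 \<mu>)"
  then obtain f where f: "f \<in> l2_functions \<mu>" "X = l2_class \<mu> f" by (elim l2_carrierE)
  show "hscale (L2 \<mu>) c X \<in> hcarrier (L2 \<mu>)" for c using f by (simp add: L2_scale l2_class_mem l2_scale)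
  show "hadd (L2 \<mu>) (hzero (L2 \<mu>)) X = X" using f by (simp add: L2_zero L2_add l2_zero)
  show "hadd (L2 \<mu>) X (hscale (L2 \<mu>) (- 1) X) = hzero (L2 \<mu>)"
    using f L2_add[OF f(1) l2_scale[OF f(1), of "-1"]] by (simp add: L2_zero L2_scale)
  show "hscale (L2 \<mu>) 1 X = X" using f by (simp add: L2_scale)
  show "hscale (L2 \<mu>) c (hscale (L2 \<mu>) d X) = hscale (L2 \<mu>) (c * d) X" for c d
    using f by (simp add: L2_scale l2_scale mult.assoc)
  show "hscale (L2 \<mu>) (c + d) X = hadd (L2 \<mu>) (hscale (L2 \<mu>) c X) (hscale (L2 \<mu>) d X)" for c d
    using f by (simp add: L2_scale L2_add l2_scale distrib_right)
  show "0 \<le> Re (hinner (L2 \<mu>) X X)" using f by (simp add: L2_inner_self)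
  assume "hinner (L2 \<mu>) X X = 0"
  then have "(\<integral>t. (cmod (f t))\<^sup>2 \<partial>\<mu>) = 0" using f by (simp add: L2_inner_self)
  then have "AE t in \<mu>. (cmod (f t))\<^sup>2 = 0"
    using integral_nonneg_eq_0_iff_AE[OF l2_integrable[OF f(1)]] by simp
  then show "X = hzero (L2 \<mu>)" using f by (simp add: L2_zero l2_class_eq_iff l2_zero)
qed

text \<open>
  The Riesz-Fischer theorem. Choose a subsequence whose increments \<open>d k\<close> satisfy \<open>\<parallel>d k\<parallel>\<^sup>2 \<le> (1/4) ^ k\<close>.
  Then \<open>\<Sum>k. 2 ^ k * \<bar>d k t\<bar>\<^sup>2\<close> is integrable, hence finite almost everywhere, and
  \<open>\<bar>d k t\<bar> \<le> 2 ^ k * \<bar>d k t\<bar>\<^sup>2 + (1/2) ^ k\<close> makes the subsequence converge there. Fatou's lemma turns the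
  pointwise limit into a limit in norm.
\<close>

theorem hilbert_space_L2: "hilbert_space (L2 \<mu>)"
proof (rule L2.hilbert_spaceI)
  fix X :: "nat \<Rightarrow> (real \<Rightarrow> complex) set"
  assume X: "range X \<subseteq> hcarrier (L2 \<mu>)"
    and cau: "\<And>e. e > 0 \<Longrightarrow> \<exists>N. \<forall>m\<ge>N. \<forall>n\<ge>N. hnorm (L2 \<mu>) (hdiff (L2 \<mu>) (X m) (X n)) < e"
  have "\<exists>f. f \<in> l2_functions \<mu> \<and> X n = l2_class \<mu> f" for n
    using X l2_carrierE[of "X n" \<mu>] by (metis rangeI subsetD)
  then obtain f where f: "\<And>n. f n \<in> l2_functions \<mu>" and Xf: "\<And>n. X n = l2_class \<mu> (f n)" by metis
  note [measurable] = l2_measurable[OF f]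
  define I where "I = (\<lambda>m n. \<integral>t. (cmod (f m t - f n t))\<^sup>2 \<partial>\<mu>)"
  have I_nn: "(\<integral>\<^sup>+t. ennreal ((cmod (f m t - f n t))\<^sup>2) \<partial>\<mu>) = ennreal (I m n)" for m n
    unfolding I_def by (rule nn_integral_eq_integral[OF l2_integrable[OF l2_diff[OF f f]]]) simp
  have I0: "0 \<le> I m n" for m n unfolding I_def by simp
  have cauI: "\<exists>N. \<forall>m\<ge>N. \<forall>n\<ge>N. I m n < e" if e: "e > 0" for e
  proof -
    obtain N where N: "\<forall>m\<ge>N. \<forall>n\<ge>N. hnorm (L2 \<mu>) (hdiff (L2 \<mu>) (X m) (X n)) < sqrt e"
      using cau[of "sqrt e"] e by auto
    then have "\<forall>m\<ge>N. \<forall>n\<ge>N. I m n < e"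
      by (simp add: Xf L2_diff f L2_norm l2_diff I_def)
    then show ?thesis by blast
  qed
  have "\<exists>N. \<forall>k. \<forall>m\<ge>N k. \<forall>n\<ge>N k. I m n < (1/4) ^ k"
    by (intro choice allI cauI) simp
  then obtain N where N: "\<And>k m n. m \<ge> N k \<Longrightarrow> n \<ge> N k \<Longrightarrow> I m n < (1/4) ^ k" by blast
  \<comment> \<open>Both \<open>r k\<close> and \<open>r (Suc k)\<close> are beyond \<open>N k\<close>, and \<open>r k\<close> tends to infinity.\<close>
  define r where "r = (\<lambda>k. k + (\<Sum>j\<le>k. N j))"
  have rN: "r k \<ge> N k" "r (Suc k) \<ge> N k" for k
    using member_le_sum[of k "{..k}" N] by (simp_all add: r_def)
  have rk: "r k \<ge> k" for k by (simp add: r_def)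
  have Ir: "I (r (Suc k)) (r k) \<le> (1/4) ^ k" for k using N rN less_imp_le by blast
  define d where "d = (\<lambda>k t. f (r (Suc k)) t - f (r k) t)"
  have d_meas [measurable]: "d k \<in> borel_measurable \<mu>" for k unfolding d_def by measurable
  have "(\<integral>\<^sup>+t. (\<Sum>k. ennreal (2 ^ k * (cmod (d k t))\<^sup>2)) \<partial>\<mu>)
      = (\<Sum>k. \<integral>\<^sup>+t. ennreal (2 ^ k * (cmod (d k t))\<^sup>2) \<partial>\<mu>)"
    by (rule nn_integral_suminf) measurable
  also have "\<dots> = (\<Sum>k. ennreal (2 ^ k * I (r (Suc k)) (r k)))"
  proof (intro suminf_cong)
    fix k
    have "(\<integral>\<^sup>+t. ennreal (2 ^ k * (cmod (d k t))\<^sup>2) \<partial>\<mu>) = (\<integral>\<^sup>+t. ennreal (2 ^ k) * ennreal ((cmod (d k t))\<^sup>2) \<partial>\<mu>)"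
      by (intro nn_integral_cong) (simp add: ennreal_mult)
    also have "\<dots> = ennreal (2 ^ k) * (\<integral>\<^sup>+t. ennreal ((cmod (d k t))\<^sup>2) \<partial>\<mu>)"
      by (rule nn_integral_cmult) measurable
    also have "\<dots> = ennreal (2 ^ k * I (r (Suc k)) (r k))"
      by (simp add: d_def I_nn ennreal_mult I0)
    finally show "(\<integral>\<^sup>+t. ennreal (2 ^ k * (cmod (d k t))\<^sup>2) \<partial>\<mu>) = ennreal (2 ^ k * I (r (Suc k)) (r k))" .
  qed
  also have "\<dots> \<le> (\<Sum>k. ennreal ((1/2) ^ k))"
  proof (intro suminf_le ennreal_leI)
    fix k
    have "2 ^ k * I (r (Suc k)) (r k) \<le> 2 ^ k * (1/4) ^ k" using Ir by (intro mult_left_mono) auto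
    also have "\<dots> = (1/2 :: real) ^ k" by (simp add: power_mult_distrib[symmetric])
    finally show "2 ^ k * I (r (Suc k)) (r k) \<le> (1/2) ^ k" .
  qed auto
  also have "\<dots> < \<infinity>"
    by (subst suminf_ennreal2) (auto simp: summable_geometric)
  finally have "AE t in \<mu>. (\<Sum>k. ennreal (2 ^ k * (cmod (d k t))\<^sup>2)) \<noteq> \<infinity>"
    by (intro nn_integral_PInf_AE) auto
  then have summ: "AE t in \<mu>. summable (\<lambda>k. d k t)"
  proof eventually_elim
    case (elim t)
    have "summable (\<lambda>k. 2 ^ k * (cmod (d k t))\<^sup>2)"
      by (rule summable_suminf_not_top) (use elim in \<open>auto simp: infinity_ennreal_def\<close>)
    then have "summable (\<lambda>k. 2 ^ k * (cmod (d k t))\<^sup>2 + (1/2) ^ k)"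
      by (intro summable_add summable_geometric) auto
    then show ?case
    proof (rule summable_comparison_test[rotated], intro exI allI impI)
      fix k :: nat
      let ?x = "cmod (d k t)"
      \<comment> \<open>The inequality \<open>2 x \<le> 2 ^ k * x\<^sup>2 + (1/2) ^ k\<close> between the means.\<close>
      have "0 \<le> (1/2) ^ k * (2 ^ k * ?x - 1)\<^sup>2" by simp
      also have "\<dots> = (1/2) ^ k * 2 ^ k * (2 ^ k * ?x\<^sup>2) - 2 * ((1/2) ^ k * 2 ^ k) * ?x + (1/2) ^ k"
        by (simp add: power2_eq_square algebra_simps)
      also have "(1/2 :: real) ^ k * 2 ^ k = 1" by (simp add: power_mult_distrib[symmetric])
      finally have "2 * ?x \<le> 2 ^ k * ?x\<^sup>2 + (1/2) ^ k" by simp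
      then show "norm (d k t) \<le> 2 ^ k * ?x\<^sup>2 + (1/2) ^ k" using norm_ge_zero[of "d k t"] by linarith
    qed
  qed
  define h where "h t = f (r 0) t + (\<Sum>k. d k t)" for t
  have h_meas [measurable]: "h \<in> borel_measurable \<mu>" unfolding h_def by measurable
  have lim: "AE t in \<mu>. (\<lambda>k. f (r k) t) \<longlonglongrightarrow> h t"
    using summ
  proof eventually_elim
    case (elim t)
    have "(\<lambda>n. f (r 0) t + (\<Sum>k<n. d k t)) \<longlonglongrightarrow> h t"
      unfolding h_def by (intro tendsto_intros summable_LIMSEQ elim)
    moreover have "f (r 0) t + (\<Sum>k<n. d k t) = f (r n) t" for n
      unfolding d_def by (subst sum_lessThan_telescope) simp
    ultimately show ?case by simp
  qed
  have fatou: "(\<integral>\<^sup>+t. ennreal ((cmod (h t - f n t))\<^sup>2) \<partial>\<mu>) \<le> ennreal e"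
    if M: "\<forall>m\<ge>M. \<forall>n\<ge>M. I m n < e" and n: "n \<ge> M" for e M n
  proof -
    have "(\<integral>\<^sup>+t. ennreal ((cmod (h t - f n t))\<^sup>2) \<partial>\<mu>)
        = (\<integral>\<^sup>+t. liminf (\<lambda>k. ennreal ((cmod (f (r k) t - f n t))\<^sup>2)) \<partial>\<mu>)"
    proof (rule nn_integral_cong_AE, use lim in eventually_elim)
      case (elim t)
      have "(\<lambda>k. ennreal ((cmod (f (r k) t - f n t))\<^sup>2)) \<longlonglongrightarrow> ennreal ((cmod (h t - f n t))\<^sup>2)"
        by (intro tendsto_ennrealI tendsto_intros elim)
      then show ?case by (intro lim_imp_Liminf[symmetric]) auto
    qed
    also have "\<dots> \<le> liminf (\<lambda>k. \<integral>\<^sup>+t. ennreal ((cmod (f (r k) t - f n t))\<^sup>2) \<partial>\<mu>)"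
      by (rule nn_integral_liminf) measurable
    also have "\<dots> = liminf (\<lambda>k. ennreal (I (r k) n))" by (simp add: I_nn)
    also have "\<dots> \<le> liminf (\<lambda>k. ennreal e)"
    proof (rule Liminf_mono)
      show "\<forall>\<^sub>F k in sequentially. ennreal (I (r k) n) \<le> ennreal e"
        using eventually_ge_at_top[of M]
      proof eventually_elim
        case (elim k)
        then have "r k \<ge> M" using rk order_trans by blast
        then show ?case using M n by (intro ennreal_leI) (auto intro: less_imp_le)
      qed
    qed
    finally show ?thesis by (simp add: Liminf_const)
  qed
  have hn: "(\<lambda>t. h t - f n t) \<in> l2_functions \<mu>" if "\<forall>m\<ge>M. \<forall>n\<ge>M. I m n < e" "n \<ge> M" for e M n
    unfolding l2_functions_def
    using fatou[OF that] by (auto simp: integrable_iff_bounded intro: le_less_trans ennreal_less_top)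
  obtain M where M: "\<forall>m\<ge>M. \<forall>n\<ge>M. I m n < 1" using cauI[of 1] by auto
  have h: "h \<in> l2_functions \<mu>" using l2_add[OF hn[OF M order_refl] f[of M]] by simp
  have "(\<lambda>n. hnorm (L2 \<mu>) (hdiff (L2 \<mu>) (X n) (l2_class \<mu> h))) \<longlonglongrightarrow> 0"
  proof (rule LIMSEQ_I)
    fix e :: real assume e: "e > 0"
    obtain M where M: "\<forall>m\<ge>M. \<forall>n\<ge>M. I m n < (e/2)\<^sup>2" using cauI[of "(e/2)\<^sup>2"] e by auto
    have "hnorm (L2 \<mu>) (hdiff (L2 \<mu>) (X n) (l2_class \<mu> h)) < e" if n: "n \<ge> M" for n
    proof -
      have "ennreal (\<integral>t. (cmod (h t - f n t))\<^sup>2 \<partial>\<mu>) \<le> ennreal ((e/2)\<^sup>2)"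
        using fatou[OF M n] nn_integral_eq_integral[OF l2_integrable[OF hn[OF M n]]] by simp
      then have "(\<integral>t. (cmod (h t - f n t))\<^sup>2 \<partial>\<mu>) \<le> (e/2)\<^sup>2" by (simp add: ennreal_le_iff)
      then have "sqrt (\<integral>t. (cmod (f n t - h t))\<^sup>2 \<partial>\<mu>) \<le> e / 2"
        using e real_sqrt_le_mono[of _ "(e/2)\<^sup>2"] by (simp add: norm_minus_commute)
      moreover have "hnorm (L2 \<mu>) (hdiff (L2 \<mu>) (X n) (l2_class \<mu> h)) = sqrt (\<integral>t. (cmod (f n t - h t))\<^sup>2 \<partial>\<mu>)"
        by (simp add: Xf L2_diff f h L2_norm l2_diff)
      ultimately show ?thesis using e by simp
    qed
    moreover have "0 \<le> hnorm (L2 \<mu>) (hdiff (L2 \<mu>) (X n) (l2_class \<mu> h))" for n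
      by (simp add: Xf L2_diff f h L2_norm l2_diff)
    ultimately show "\<exists>M. \<forall>n\<ge>M. norm (hnorm (L2 \<mu>) (hdiff (L2 \<mu>) (X n) (l2_class \<mu> h)) - 0) < e"
      by (intro exI[of _ M]) (simp only: diff_zero real_norm_def abs_of_nonneg, simp)
  qed
  then show "\<exists>x. L2.converges \<mu> X x"
    unfolding L2.converges_def using X l2_class_mem[OF h] by blast
qed

section \<open>Cauchy kernels and uniqueness of their transforms\<close>

text \<open>
  The derivative of the logarithm at 1 is 1, so \<open>n * Ln (1 + w / n)\<close> tends to \<open>w\<close>.
\<close>

lemma exp_limit_complex: "(\<lambda>n. (1 + w / of_nat n) ^ n) \<longlonglongrightarrow> exp (w :: complex)"
proof (cases "w = 0")
  case False
  have "(Ln has_field_derivative inverse 1) (at 1)"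
    by (rule has_field_derivative_Ln) (simp add: complex_nonpos_Reals_iff)
  then have d: "((\<lambda>h. Ln (1 + h) / h) \<longlongrightarrow> 1) (at 0)"
    by (simp add: DERIV_def)
  have inv: "(\<lambda>n. w / of_nat n) \<longlonglongrightarrow> 0"
    by (rule tendsto_divide_0[OF tendsto_const tendsto_of_nat])
  have "filterlim (\<lambda>n. w / of_nat n) (at 0) sequentially"
    unfolding filterlim_at using inv False eventually_gt_at_top[of 0]
    by (auto elim: eventually_mono)
  then have "(\<lambda>n. Ln (1 + w / of_nat n) / (w / of_nat n)) \<longlonglongrightarrow> 1"
    by (rule filterlim_compose[OF d])
  then have "(\<lambda>n. exp (w * (Ln (1 + w / of_nat n) / (w / of_nat n)))) \<longlonglongrightarrow> exp (w * 1)"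
    by (intro tendsto_intros)
  moreover have "\<forall>\<^sub>F n in sequentially.
      exp (w * (Ln (1 + w / of_nat n) / (w / of_nat n))) = (1 + w / of_nat n) ^ n"
  proof -
    have "(\<lambda>n. 1 + w / of_nat n) \<longlonglongrightarrow> 1 + 0" by (intro tendsto_intros inv)
    then have "\<forall>\<^sub>F n in sequentially. 1 + w / of_nat n \<noteq> 0"
      by (rule tendsto_imp_eventually_ne) simp
    then show ?thesis using eventually_gt_at_top[of 0]
    proof eventually_elim
      case (elim n)
      then have "w * (Ln (1 + w / of_nat n) / (w / of_nat n)) = of_nat n * Ln (1 + w / of_nat n)"
        using False by simp
      then show ?case using elim by (simp add: exp_of_nat_mult)
    qed
  qed
  ultimately show ?thesis using Lim_transform_eventually by fastforce
qed simp

lemma iexp_measurable: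
  fixes \<mu> :: "real measure"
  assumes "sets \<mu> = sets borel"
  shows "(\<lambda>t. iexp (s * t)) \<in> borel_measurable \<mu>"
proof -
  have "(\<lambda>t. iexp (s * t)) \<in> borel_measurable borel" by measurable
  then show ?thesis using assms by (simp cong: measurable_cong_sets)
qed

text \<open>
  Levy's uniqueness theorem for probability measures, applied to the densities given by the positive
  and the negative part of \<open>a\<close>. The function \<open>w\<close> is added to both so that their common integral is
  positive and can be normalised to 1.
\<close>

lemma fourier_injective_real:
  fixes \<mu> :: "real measure" and a w :: "real \<Rightarrow> real"
  assumes borel: "sets \<mu> = sets borel" and a: "integrable \<mu> a"
    and w: "integrable \<mu> w" "\<And>t. 0 \<le> w t" "0 < integral\<^sup>L \<mu> w"
    and ft: "\<And>s. (\<integral>t. a t *\<^sub>R iexp (s * t) \<partial>\<mu>) = 0"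
  shows "AE t in \<mu>. a t = 0"
proof -
  have [measurable]: "a \<in> borel_measurable \<mu>" "w \<in> borel_measurable \<mu>" using a w by auto
  have a0: "integral\<^sup>L \<mu> a = 0"
  proof -
    have "(\<integral>t. complex_of_real (a t) \<partial>\<mu>) = 0" using ft[of 0] by (simp add: scaleR_conv_of_real)
    then show ?thesis by simp
  qed
  define p where "p = (\<lambda>t. max (a t) 0 + w t)"
  define q where "q = (\<lambda>t. max (- a t) 0 + w t)"
  have pq: "p t - q t = a t" "0 \<le> p t" "0 \<le> q t" for t using w(2) by (auto simp: p_def q_def max_def)
  have int: "integrable \<mu> p" "integrable \<mu> q" unfolding p_def q_def using a w by auto
  note [measurable] = borel_measurable_integrable[OF int(1)] borel_measurable_integrable[OF int(2)]
  define c where "c = integral\<^sup>L \<mu> p"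
  have "integral\<^sup>L \<mu> p - integral\<^sup>L \<mu> q = integral\<^sup>L \<mu> a"
    using Bochner_Integration.integral_diff[OF int] pq by simp
  then have cq: "integral\<^sup>L \<mu> q = c" using a0 by (simp add: c_def)
  have "integral\<^sup>L \<mu> w \<le> c" unfolding c_def using int w
    by (intro integral_mono) (auto simp: p_def)
  then have c0: "c > 0" using w by linarith
  have dist: "real_distribution (density \<mu> (\<lambda>t. ennreal (u t / c)))"
    if u: "integrable \<mu> u" "\<And>t. 0 \<le> u t" "integral\<^sup>L \<mu> u = c" for u
  proof -
    have [measurable]: "u \<in> borel_measurable \<mu>" using u by simp
    have "emeasure (density \<mu> (\<lambda>t. ennreal (u t / c))) (space \<mu>) = (\<integral>\<^sup>+t. ennreal (u t / c) \<partial>\<mu>)"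
      by (subst emeasure_density) (auto intro!: nn_integral_cong)
    also have "\<dots> = ennreal (\<integral>t. u t / c \<partial>\<mu>)"
      by (rule nn_integral_eq_integral) (use u c0 in auto)
    also have "\<dots> = 1" using u c0 by simp
    finally have "prob_space (density \<mu> (\<lambda>t. ennreal (u t / c)))"
      by (intro prob_spaceI) simp
    then show ?thesis
      by (simp add: real_distribution_def real_distribution_axioms_def borel)
  qed
  have char: "char (density \<mu> (\<lambda>t. ennreal (u t / c))) s = (\<integral>t. (u t / c) *\<^sub>R iexp (s * t) \<partial>\<mu>)"
    if u: "integrable \<mu> u" "\<And>t. 0 \<le> u t" for u s
  proof -
    have [measurable]: "u \<in> borel_measurable \<mu>" using u by simp
    show ?thesis unfolding char_def using iexp_measurable[OF borel]
      by (intro integral_density) (use u c0 in auto)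
  qed
  have "char (density \<mu> (\<lambda>t. ennreal (p t / c))) = char (density \<mu> (\<lambda>t. ennreal (q t / c)))"
  proof
    fix s
    have i: "integrable \<mu> (\<lambda>t. (u t / c) *\<^sub>R iexp (s * t))" if u: "integrable \<mu> u" for u
      by (rule Bochner_Integration.integrable_bound[of \<mu> "\<lambda>t. u t / c"])
         (use u iexp_measurable[OF borel] in \<open>auto simp: norm_mult\<close>)
    have "(\<integral>t. (p t / c) *\<^sub>R iexp (s * t) \<partial>\<mu>) - (\<integral>t. (q t / c) *\<^sub>R iexp (s * t) \<partial>\<mu>)
        = (\<integral>t. (p t / c) *\<^sub>R iexp (s * t) - (q t / c) *\<^sub>R iexp (s * t) \<partial>\<mu>)"
      by (rule Bochner_Integration.integral_diff[symmetric, OF i[OF int(1)] i[OF int(2)]])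
    also have "\<dots> = (\<integral>t. (1 / c) *\<^sub>R (a t *\<^sub>R iexp (s * t)) \<partial>\<mu>)"
      by (intro Bochner_Integration.integral_cong refl)
        (simp add: pq(1)[symmetric] scaleR_conv_of_real diff_divide_distrib left_diff_distrib)
    also have "\<dots> = 0" by (simp only: integral_scaleR_right ft scaleR_zero_right)
    finally show "char (density \<mu> (\<lambda>t. ennreal (p t / c))) s = char (density \<mu> (\<lambda>t. ennreal (q t / c))) s"
      using char[OF int(1) pq(2)] char[OF int(2) pq(3)] by simp
  qed
  then have "density \<mu> (\<lambda>t. ennreal (p t / c)) = density \<mu> (\<lambda>t. ennreal (q t / c))"
    using dist[OF int(1) pq(2) c_def[symmetric]] dist[OF int(2) pq(3) cq] Levy_uniqueness by blast
  moreover have "(\<integral>\<^sup>+t. ennreal (p t / c) \<partial>\<mu>) \<noteq> \<infinity>"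
    using nn_integral_eq_integral[of \<mu> "\<lambda>t. p t / c"] int pq c0 by simp
  ultimately have "AE t in \<mu>. ennreal (p t / c) = ennreal (q t / c)"
    by (subst (asm) finite_density_unique) auto
  then show ?thesis
  proof eventually_elim
    case (elim t)
    then have "p t / c = q t / c" using pq c0 by (subst (asm) ennreal_inj) auto
    then show ?case using pq(1)[of t] c0 by simp
  qed
qed

text \<open>
  Conjugation replaces \<open>s\<close> by \<open>- s\<close>, so the real and the imaginary part have vanishing transforms too.
\<close>

lemma fourier_injective:
  fixes \<mu> :: "real measure" and h :: "real \<Rightarrow> complex" and w :: "real \<Rightarrow> real"
  assumes borel: "sets \<mu> = sets borel" and h: "integrable \<mu> h"
    and w: "integrable \<mu> w" "\<And>t. 0 \<le> w t" "0 < integral\<^sup>L \<mu> w"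
    and ft: "\<And>s. (\<integral>t. h t * iexp (s * t) \<partial>\<mu>) = 0"
  shows "AE t in \<mu>. h t = 0"
proof -
  have i: "integrable \<mu> (\<lambda>t. h t * iexp (s * t))" for s
    by (rule Bochner_Integration.integrable_bound[OF h]) (use h iexp_measurable[OF borel] in \<open>auto simp: norm_mult\<close>)
  have c: "cnj (h t * iexp (s * t)) = cnj (h t) * iexp ((- s) * t)" for s t
    by (simp add: exp_cnj)
  have ic: "integrable \<mu> (\<lambda>t. cnj (h t) * iexp (s * t))" for s
    using Bochner_Integration.integrable_cnj[OF i[of "- s"]] unfolding c by simp
  have ftc: "(\<integral>t. cnj (h t) * iexp (s * t) \<partial>\<mu>) = 0" for s
    using Bochner_Integration.integral_cnj[of \<mu> "\<lambda>t. h t * iexp ((- s) * t)"] ft[of "- s"]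
    unfolding c by simp
  have ft_Re: "(\<integral>t. Re (h t) *\<^sub>R iexp (s * t) \<partial>\<mu>) = 0" for s
  proof -
    have "(\<integral>t. Re (h t) *\<^sub>R iexp (s * t) \<partial>\<mu>) = (\<integral>t. (h t * iexp (s * t) + cnj (h t) * iexp (s * t)) / 2 \<partial>\<mu>)"
      by (intro Bochner_Integration.integral_cong refl)
        (simp add: scaleR_conv_of_real complex_add_cnj distrib_right[symmetric])
    also have "\<dots> = ((\<integral>t. h t * iexp (s * t) \<partial>\<mu>) + (\<integral>t. cnj (h t) * iexp (s * t) \<partial>\<mu>)) / 2"
      using i ic by simp
    finally show ?thesis using ft ftc by simp
  qed
  have re: "AE t in \<mu>. Re (h t) = 0"
    by (rule fourier_injective_real[OF borel _ w ft_Re]) (use h in auto)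
  have ft_Im: "(\<integral>t. Im (h t) *\<^sub>R iexp (s * t) \<partial>\<mu>) = 0" for s
  proof -
    have "(\<integral>t. Im (h t) *\<^sub>R iexp (s * t) \<partial>\<mu>) = (\<integral>t. (h t * iexp (s * t) - cnj (h t) * iexp (s * t)) / (2 * \<i>) \<partial>\<mu>)"
      by (intro Bochner_Integration.integral_cong refl)
        (simp add: scaleR_conv_of_real complex_diff_cnj left_diff_distrib[symmetric] mult.left_commute)
    also have "\<dots> = ((\<integral>t. h t * iexp (s * t) \<partial>\<mu>) - (\<integral>t. cnj (h t) * iexp (s * t) \<partial>\<mu>)) / (2 * \<i>)"
      using i ic by simp
    finally show ?thesis using ft ftc by simp
  qed
  have "AE t in \<mu>. Im (h t) = 0"
    by (rule fourier_injective_real[OF borel _ w ft_Im]) (use h in auto)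
  with re show ?thesis by eventually_elim (simp add: complex_eq_iff)
qed

definition cauchy_kernel :: "complex \<Rightarrow> real \<Rightarrow> complex" where
  "cauchy_kernel z t = 1 / (complex_of_real t - z)"

lemma kernel_denominator: "Im z \<noteq> 0 \<Longrightarrow> complex_of_real t - z \<noteq> 0"
  by (auto simp: complex_eq_iff)

lemma cmod_kernel_le: "Im z \<noteq> 0 \<Longrightarrow> cmod (cauchy_kernel z t) \<le> 1 / \<bar>Im z\<bar>"
proof -
  assume z: "Im z \<noteq> 0"
  have "\<bar>Im z\<bar> \<le> cmod (complex_of_real t - z)"
    using abs_Im_le_cmod[of "complex_of_real t - z"] by simp
  then show ?thesis
    using z by (simp add: cauchy_kernel_def norm_divide divide_simps kernel_denominator)
qed

lemma cnj_kernel: "cnj (cauchy_kernel z t) = cauchy_kernel (cnj z) t"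
  by (simp add: cauchy_kernel_def)

lemma kernel_diff:
  assumes "Im z \<noteq> 0" "Im w \<noteq> 0"
  shows "cauchy_kernel z t - cauchy_kernel w t = (z - w) * (cauchy_kernel z t * cauchy_kernel w t)"
  using assms kernel_denominator[of z t] kernel_denominator[of w t]
  by (simp add: cauchy_kernel_def divide_simps)

locale kernel_measure =
  fixes \<mu> :: "real measure"
  assumes borel: "sets \<mu> = sets borel"
    and weight: "(\<integral>\<^sup>+t. ennreal (1 / (1 + t\<^sup>2)) \<partial>\<mu>) = 1"
begin

sublocale hilbert_space "L2 \<mu>" by (rule hilbert_space_L2)

lemma borel_measurableI: "f \<in> borel_measurable borel \<Longrightarrow> f \<in> borel_measurable \<mu>"
  using borel by (simp cong: measurable_cong_sets)

lemma weight_integrable: "integrable \<mu> (\<lambda>t. 1 / (1 + t\<^sup>2))"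
proof (rule integrableI_nonneg)
  show "(\<lambda>t. 1 / (1 + t\<^sup>2)) \<in> borel_measurable \<mu>" by (rule borel_measurableI) measurable
qed (use weight in \<open>auto simp: less_top[symmetric]\<close>)

lemma weight_integral: "(\<integral>t. 1 / (1 + t\<^sup>2) \<partial>\<mu>) = 1"
  using nn_integral_eq_integral[OF weight_integrable] weight by simp

lemma kernel_measurable: "cauchy_kernel z \<in> borel_measurable \<mu>"
  unfolding cauchy_kernel_def by (rule borel_measurableI) measurable

lemma kernel_l2:
  assumes z: "Im z \<noteq> 0"
  shows "cauchy_kernel z \<in> l2_functions \<mu>"
proof (rule l2_functionsI_bound[OF kernel_measurable])
  \<comment> \<open>From \<open>\<bar>t\<bar> \<le> \<bar>t - z\<bar> + \<bar>z\<bar>\<close> and \<open>\<bar>Im z\<bar> \<le> \<bar>t - z\<bar>\<close> follows \<open>1 + t\<^sup>2 \<le> C * \<bar>t - z\<bar>\<^sup>2\<close>.\<close>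
  define C where "C = 2 + (1 + 2 * (cmod z)\<^sup>2) / (Im z)\<^sup>2"
  show "integrable \<mu> (\<lambda>t. C * (1 / (1 + t\<^sup>2)))"
    by (intro integrable_mult_right weight_integrable)
  fix t
  let ?d = "cmod (complex_of_real t - z)"
  have d: "\<bar>Im z\<bar> \<le> ?d" using abs_Im_le_cmod[of "complex_of_real t - z"] by simp
  then have d2: "(Im z)\<^sup>2 \<le> ?d\<^sup>2" using power_mono[OF d, of 2] by simp
  have "\<bar>t\<bar> \<le> ?d + cmod z" using norm_triangle_ineq[of "complex_of_real t - z" z] by simp
  then have "t\<^sup>2 \<le> (?d + cmod z)\<^sup>2" using power_mono[of "\<bar>t\<bar>" "?d + cmod z" 2] by simp
  also have "\<dots> \<le> 2 * ?d\<^sup>2 + 2 * (cmod z)\<^sup>2"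
    using sum_squares_bound[of ?d "cmod z"] by (simp add: power2_sum)
  finally have "1 + t\<^sup>2 \<le> 2 * ?d\<^sup>2 + (1 + 2 * (cmod z)\<^sup>2) * 1" by simp
  also have "\<dots> \<le> 2 * ?d\<^sup>2 + (1 + 2 * (cmod z)\<^sup>2) * (?d\<^sup>2 / (Im z)\<^sup>2)"
    using d2 z by (intro add_left_mono mult_left_mono) (auto simp: divide_simps)
  also have "\<dots> = C * ?d\<^sup>2" by (simp add: C_def algebra_simps)
  finally have "1 + t\<^sup>2 \<le> C * ?d\<^sup>2" .
  moreover have "0 < 1 + t\<^sup>2" by (simp add: add_pos_nonneg)
  moreover have "0 < ?d" using kernel_denominator[OF z] by simp
  ultimately show "(cmod (cauchy_kernel z t))\<^sup>2 \<le> C * (1 / (1 + t\<^sup>2))"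
    by (simp add: cauchy_kernel_def norm_divide power_divide divide_simps mult.commute)
qed

lemma kernel_mult_l2: "\<lbrakk>f \<in> l2_functions \<mu>; Im z \<noteq> 0\<rbrakk> \<Longrightarrow> (\<lambda>t. cauchy_kernel z t * f t) \<in> l2_functions \<mu>"
  by (rule l2_mult_bounded[OF _ kernel_measurable cmod_kernel_le])

definition kernel_class :: "complex \<Rightarrow> (real \<Rightarrow> complex) set" where
  "kernel_class z = l2_class \<mu> (cauchy_kernel z)"

lemma inner_kernel:
  "\<lbrakk>f \<in> l2_functions \<mu>; Im z \<noteq> 0\<rbrakk>
    \<Longrightarrow> hinner (L2 \<mu>) (l2_class \<mu> f) (kernel_class z) = (\<integral>t. f t * cauchy_kernel (cnj z) t \<partial>\<mu>)"
  by (simp add: kernel_class_def L2_inner kernel_l2 cnj_kernel)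

lemma kernel_family: "L2.resolvent_family \<mu> kernel_class"
  unfolding L2.resolvent_family_def
proof (intro conjI allI impI)
  show "kernel_class z \<in> hcarrier (L2 \<mu>)" if "Im z \<noteq> 0" for z
    using that by (simp add: kernel_class_def l2_class_mem kernel_l2)
  fix z w assume z: "Im z \<noteq> 0" and w: "Im w \<noteq> 0"
  have "(\<integral>t. (cmod (cauchy_kernel z t - cauchy_kernel w t))\<^sup>2 \<partial>\<mu>)
      \<le> (\<integral>t. (cmod (z - w) / \<bar>Im w\<bar>)\<^sup>2 * (cmod (cauchy_kernel z t))\<^sup>2 \<partial>\<mu>)"
  proof (rule integral_mono)
    fix t
    have "cmod (cauchy_kernel z t - cauchy_kernel w t)
        = cmod (z - w) * cmod (cauchy_kernel z t) * cmod (cauchy_kernel w t)"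
      by (simp add: kernel_diff z w norm_mult)
    also have "\<dots> \<le> cmod (z - w) * cmod (cauchy_kernel z t) * (1 / \<bar>Im w\<bar>)"
      by (intro mult_left_mono cmod_kernel_le w) simp
    finally have "cmod (cauchy_kernel z t - cauchy_kernel w t) \<le> cmod (z - w) / \<bar>Im w\<bar> * cmod (cauchy_kernel z t)"
      by simp
    from power_mono[OF this, of 2]
    show "(cmod (cauchy_kernel z t - cauchy_kernel w t))\<^sup>2
        \<le> (cmod (z - w) / \<bar>Im w\<bar>)\<^sup>2 * (cmod (cauchy_kernel z t))\<^sup>2"
      by (simp add: power_mult_distrib power_divide)
  qed (use z w l2_integrable[OF kernel_l2[OF z]] l2_integrable[OF l2_diff[OF kernel_l2[OF z] kernel_l2[OF w]]] in auto)
  then have "sqrt (\<integral>t. (cmod (cauchy_kernel z t - cauchy_kernel w t))\<^sup>2 \<partial>\<mu>)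
      \<le> sqrt ((cmod (z - w) / \<bar>Im w\<bar>)\<^sup>2 * (\<integral>t. (cmod (cauchy_kernel z t))\<^sup>2 \<partial>\<mu>))"
    by (simp del: real_sqrt_le_iff) (simp only: real_sqrt_le_iff)
  then have "hnorm (L2 \<mu>) (hdiff (L2 \<mu>) (kernel_class z) (kernel_class w)) \<le> cmod (z - w) / \<bar>Im w\<bar> * hnorm (L2 \<mu>) (kernel_class z)"
    by (simp add: kernel_class_def L2_diff L2_norm l2_diff kernel_l2 z w real_sqrt_mult)
  then show "\<bar>Im w\<bar> * hnorm (L2 \<mu>) (hdiff (L2 \<mu>) (kernel_class z) (kernel_class w)) \<le> cmod (z - w) * hnorm (L2 \<mu>) (kernel_class z)"
    using w by (simp add: field_simps)
qed

text \<open>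
  Partial fractions for \<open>z \<noteq> w\<close>, and continuity in \<open>z\<close> for \<open>z = w\<close>.
\<close>

lemma kernel_mult_orthogonal:
  assumes f: "f \<in> l2_functions \<mu>" and w: "Im w \<noteq> 0" and z: "Im z \<noteq> 0"
    and orth: "\<And>z. Im z \<noteq> 0 \<Longrightarrow> (\<integral>t. f t * cauchy_kernel z t \<partial>\<mu>) = 0"
  shows "(\<integral>t. (cauchy_kernel w t * f t) * cauchy_kernel z t \<partial>\<mu>) = 0"
proof -
  let ?X = "l2_class \<mu> (\<lambda>t. cauchy_kernel w t * f t)"
  have ne: "(\<integral>t. (cauchy_kernel w t * f t) * cauchy_kernel z t \<partial>\<mu>) = 0"
    if z: "Im z \<noteq> 0" "z \<noteq> w" for z
  proof -
    have "(z - w) * (\<integral>t. (cauchy_kernel w t * f t) * cauchy_kernel z t \<partial>\<mu>)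
        = (\<integral>t. f t * cauchy_kernel z t - f t * cauchy_kernel w t \<partial>\<mu>)"
    proof (subst integral_mult_right_zero[symmetric], rule Bochner_Integration.integral_cong[OF refl])
      fix t
      show "(z - w) * (cauchy_kernel w t * f t * cauchy_kernel z t)
          = f t * cauchy_kernel z t - f t * cauchy_kernel w t"
        using arg_cong[OF kernel_diff[OF z(1) w, of t], of "\<lambda>x. f t * x"] by (simp add: algebra_simps)
    qed
    also have "\<dots> = 0"
      using orth[OF z(1)] orth[OF w] l2_product_integrable[OF f kernel_l2[OF z(1)]]
        l2_product_integrable[OF f kernel_l2[OF w]] by simp
    finally show ?thesis using z(2) by simp
  qed
  have "hinner (L2 \<mu>) ?X (kernel_class (cnj w)) = 0"
  proof (rule L2.resolvent_family_punctured[OF kernel_family])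
    fix z assume "Im z \<noteq> 0" "z \<noteq> cnj w"
    moreover from this have "cnj z \<noteq> w" by auto
    ultimately show "hinner (L2 \<mu>) ?X (kernel_class z) = 0"
      using ne[of "cnj z"] f w by (auto simp: inner_kernel kernel_mult_l2)
  qed (use f w in \<open>auto simp: l2_class_mem kernel_mult_l2\<close>)
  then show ?thesis
    using ne z f w by (cases "z = w") (auto simp: inner_kernel kernel_mult_l2)
qed

lemma kernel_power_orthogonal:
  assumes f: "f \<in> l2_functions \<mu>" and w: "Im w \<noteq> 0"
    and orth: "\<And>z. Im z \<noteq> 0 \<Longrightarrow> (\<integral>t. f t * cauchy_kernel z t \<partial>\<mu>) = 0"
  shows "(\<lambda>t. cauchy_kernel w t ^ n * f t) \<in> l2_functions \<mu> \<and>
    (\<forall>z. Im z \<noteq> 0 \<longrightarrow> (\<integral>t. (cauchy_kernel w t ^ n * f t) * cauchy_kernel z t \<partial>\<mu>) = 0)"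
proof (induction n)
  case 0
  then show ?case using f orth by simp
next
  case (Suc n)
  then show ?case
    using kernel_mult_l2[of "\<lambda>t. cauchy_kernel w t ^ n * f t" w]
      kernel_mult_orthogonal[of "\<lambda>t. cauchy_kernel w t ^ n * f t" w] w by (simp add: mult.assoc)
qed

text \<open>
  If the integrals of \<open>f\<close> against all Cauchy kernels vanish, then so do those of \<open>f\<close> times a power of a
  kernel. One such power is a multiple of \<open>(1 - \<i> s t / n) powi (- n)\<close>. These functions are bounded by 1
  and converge to \<open>exp (\<i> s t)\<close>; so the Fourier transform of \<open>h\<close>, that is \<open>f\<close> times the kernel at \<open>\<i>\<close>,
  vanishes. The fixed kernel is there to make \<open>h\<close> integrable.
\<close>

lemma kernel_total:
  assumes f: "f \<in> l2_functions \<mu>"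
    and orth: "\<And>z. Im z \<noteq> 0 \<Longrightarrow> (\<integral>t. f t * cauchy_kernel z t \<partial>\<mu>) = 0"
  shows "AE t in \<mu>. f t = 0"
proof -
  define h where "h = (\<lambda>t. f t * cauchy_kernel \<i> t)"
  have h: "integrable \<mu> h" unfolding h_def by (rule l2_product_integrable[OF f kernel_l2]) simp
  have [measurable]: "h \<in> borel_measurable \<mu>" using h by simp
  have "(\<integral>t. h t * iexp (s * t) \<partial>\<mu>) = 0" for s
  proof (cases "s = 0")
    case True
    then show ?thesis using orth[of \<i>] by (simp add: h_def)
  next
    case False
    let ?e = "\<lambda>n t. inverse ((1 + (- \<i> * of_real (s * t)) / of_nat n) ^ n)"
    have e0: "(\<integral>t. h t * ?e (Suc n) t \<partial>\<mu>) = 0" for n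
    proof -
      \<comment> \<open>With these, \<open>1 - \<i> s t / Suc n = (t - w) / c\<close>.\<close>
      define w where "w = - \<i> * of_real (real (Suc n) / s)"
      define c where "c = \<i> * of_real (real (Suc n) / s)"
      have w: "Im w \<noteq> 0" using False by (simp add: w_def)
      have n0: "1 + complex_of_nat n \<noteq> 0"
        using of_nat_neq_0[of n, where 'a = complex] by (simp only: of_nat_Suc not_False_eq_True)
      have c: "c \<noteq> 0" using False n0 by (simp add: c_def)
      have e: "?e (Suc n) t = c ^ Suc n * cauchy_kernel w t ^ Suc n" for t
      proof -
        have "1 + (- \<i> * of_real (s * t)) / of_nat (Suc n) = (of_real t - w) / c"
        proof -
          have *: "1 + (- \<i> * (S * x)) / N = (x - - \<i> * (N / S)) / (\<i> * (N / S))"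
            if "N \<noteq> 0" "S \<noteq> 0" for N S x :: complex
            using that by (simp add: divide_simps) (simp add: algebra_simps)
          show ?thesis
            using *[of "of_nat (Suc n)" "of_real s" "of_real t"] False n0 by (simp add: w_def c_def)
        qed
        then have "inverse (1 + (- \<i> * of_real (s * t)) / of_nat (Suc n)) = c * cauchy_kernel w t"
          by (simp add: cauchy_kernel_def)
        then show ?thesis by (simp only: power_inverse[symmetric] power_mult_distrib)
      qed
      have "(\<integral>t. h t * ?e (Suc n) t \<partial>\<mu>)
          = (\<integral>t. c ^ Suc n * ((cauchy_kernel w t ^ Suc n * f t) * cauchy_kernel \<i> t) \<partial>\<mu>)"
        unfolding e h_def by (intro Bochner_Integration.integral_cong refl) (simp only: ac_simps)
      also have "\<dots> = 0"
        using kernel_power_orthogonal[OF f w orth, of "Suc n"]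
        by (simp only: integral_mult_right_zero) simp
      finally show ?thesis .
    qed
    have "(\<lambda>n. \<integral>t. h t * ?e (Suc n) t \<partial>\<mu>) \<longlonglongrightarrow> (\<integral>t. h t * iexp (s * t) \<partial>\<mu>)"
    proof (rule integral_dominated_convergence[where w = "\<lambda>t. norm (h t)"])
      show "(\<lambda>t. h t * iexp (s * t)) \<in> borel_measurable \<mu>"
        by (intro borel_measurable_times iexp_measurable borel) measurable
      show "(\<lambda>t. h t * ?e (Suc n) t) \<in> borel_measurable \<mu>" for n
        by (intro borel_measurable_times borel_measurableI[of "?e (Suc n)"]) measurable
      show "integrable \<mu> (\<lambda>t. norm (h t))" using h by simp
      show "AE t in \<mu>. (\<lambda>n. h t * ?e (Suc n) t) \<longlonglongrightarrow> h t * iexp (s * t)"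
      proof (rule AE_I2)
        fix t
        have "(\<lambda>n. (1 + (- \<i> * of_real (s * t)) / of_nat (Suc n)) ^ Suc n) \<longlonglongrightarrow> exp (- \<i> * of_real (s * t))"
          by (rule LIMSEQ_Suc[OF exp_limit_complex])
        then have "(\<lambda>n. h t * ?e (Suc n) t) \<longlonglongrightarrow> h t * inverse (exp (- \<i> * of_real (s * t)))"
          by (intro tendsto_intros) auto
        then show "(\<lambda>n. h t * ?e (Suc n) t) \<longlonglongrightarrow> h t * iexp (s * t)"
          by (simp add: exp_minus)
      qed
      show "AE t in \<mu>. norm (h t * ?e (Suc n) t) \<le> norm (h t)" for n
      proof (rule AE_I2)
        fix t
        let ?u = "1 + (- \<i> * of_real (s * t)) / of_nat (Suc n)"
        have "Re ?u = 1" by (simp del: of_nat_Suc)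
        then have "1 \<le> cmod ?u" using complex_Re_le_cmod[of ?u] by simp
        then have "1 \<le> cmod ?u ^ Suc n" by (rule one_le_power)
        then have "cmod (?e (Suc n) t) \<le> 1"
          by (simp only: norm_inverse norm_power inverse_le_1_iff) simp
        then have "cmod (h t) * cmod (?e (Suc n) t) \<le> cmod (h t) * 1" by (intro mult_left_mono) auto
        then show "norm (h t * ?e (Suc n) t) \<le> norm (h t)" by (simp only: norm_mult mult_1_right)
      qed
    qed
    then show ?thesis unfolding e0 using LIMSEQ_unique tendsto_const by blast
  qed
  then have "AE t in \<mu>. h t = 0"
    by (rule fourier_injective[OF borel h weight_integrable, rotated 2]) (auto simp: weight_integral)
  then show ?thesis
  proof eventually_elim
    case (elim t)
    then show ?case using kernel_denominator[of \<i> t] by (simp add: h_def cauchy_kernel_def)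
  qed
qed

end

section \<open>The model triple\<close>

context kernel_measure
begin

definition kernel_resolvent :: "(real \<Rightarrow> complex) set \<Rightarrow> (real \<Rightarrow> complex) set" where
  "kernel_resolvent X = l2_class \<mu> (\<lambda>t. cauchy_kernel \<i> t * l2_rep X t)"

lemma kernel_resolvent_class:
  assumes f: "f \<in> l2_functions \<mu>"
  shows "kernel_resolvent (l2_class \<mu> f) = l2_class \<mu> (\<lambda>t. cauchy_kernel \<i> t * f t)"
proof -
  have "AE t in \<mu>. cauchy_kernel \<i> t * l2_rep (l2_class \<mu> f) t = cauchy_kernel \<i> t * f t"
    using l2_rep_AE[OF f] by eventually_elim simp
  then show ?thesis
    unfolding kernel_resolvent_def by (simp add: l2_class_eq_iff kernel_mult_l2 l2_rep_mem f)
qed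

lemma multiplication_iff:
  assumes f: "f \<in> l2_functions \<mu>"
  shows "integrable \<mu> (\<lambda>t. t\<^sup>2 * (cmod (f t))\<^sup>2) \<longleftrightarrow> (\<lambda>t. of_real t * f t) \<in> l2_functions \<mu>"
proof -
  note [measurable] = l2_measurable[OF f] borel_measurableI[of complex_of_real]
  have "(\<lambda>t. of_real t * f t) \<in> borel_measurable \<mu>" by measurable
  then show ?thesis by (simp add: l2_functions_def norm_mult power_mult_distrib)
qed

text \<open>
  Multiplication by \<open>t - \<i>\<close> is inverse to multiplication by the kernel at \<open>\<i>\<close>.
\<close>

lemma model_A_eq:
  "model_A \<mu> = {(kernel_resolvent X, hadd (L2 \<mu>) X (hscale (L2 \<mu>) \<i> (kernel_resolvent X))) | X.
     X \<in> hcarrier (L2 \<mu>)}" (is "_ = ?R")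
proof
  have k: "cauchy_kernel \<i> t * ((of_real t - \<i>) * x) = x" for t x
    using kernel_denominator[of \<i> t] by (simp add: cauchy_kernel_def)
  show "model_A \<mu> \<subseteq> ?R"
  proof
    fix p assume "p \<in> model_A \<mu>"
    then obtain f where f: "f \<in> l2_functions \<mu>" "(\<lambda>t. of_real t * f t) \<in> l2_functions \<mu>"
      and p: "p = (l2_class \<mu> f, l2_class \<mu> (\<lambda>t. of_real t * f t))"
      unfolding model_A_def using multiplication_iff by blast
    define g where "g = (\<lambda>t. (of_real t - \<i>) * f t)"
    have g: "g \<in> l2_functions \<mu>"
      using l2_diff[OF f(2) l2_scale[OF f(1), of \<i>]] by (simp add: g_def left_diff_distrib)
    have "kernel_resolvent (l2_class \<mu> g) = l2_class \<mu> f"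
      unfolding kernel_resolvent_class[OF g] by (simp add: g_def k)
    moreover have "hadd (L2 \<mu>) (l2_class \<mu> g) (hscale (L2 \<mu>) \<i> (l2_class \<mu> f)) = l2_class \<mu> (\<lambda>t. of_real t * f t)"
      unfolding L2_scale[OF f(1)] L2_add[OF g l2_scale[OF f(1)]] by (simp add: g_def left_diff_distrib)
    ultimately show "p \<in> ?R" using p l2_class_mem[OF g] by auto
  qed
  show "?R \<subseteq> model_A \<mu>"
  proof
    fix p assume "p \<in> ?R"
    then obtain g where g: "g \<in> l2_functions \<mu>"
      and p: "p = (kernel_resolvent (l2_class \<mu> g), hadd (L2 \<mu>) (l2_class \<mu> g)
        (hscale (L2 \<mu>) \<i> (kernel_resolvent (l2_class \<mu> g))))"
      by (auto elim!: l2_carrierE)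
    define f where "f = (\<lambda>t. cauchy_kernel \<i> t * g t)"
    have f: "f \<in> l2_functions \<mu>" unfolding f_def by (rule kernel_mult_l2[OF g]) simp
    have tf: "(\<lambda>t. of_real t * f t) = (\<lambda>t. g t + \<i> * f t)"
    proof
      fix t
      have "(of_real t - \<i>) * f t = g t" using k[of t "g t"] by (simp add: f_def mult.left_commute)
      then show "of_real t * f t = g t + \<i> * f t" by (simp add: algebra_simps)
    qed
    have "p = (l2_class \<mu> f, l2_class \<mu> (\<lambda>t. of_real t * f t))"
      unfolding p tf kernel_resolvent_class[OF g] f_def[symmetric] L2_scale[OF f]
      by (simp add: L2_add g l2_scale f)
    moreover have "integrable \<mu> (\<lambda>t. t\<^sup>2 * (cmod (f t))\<^sup>2)"
      unfolding multiplication_iff[OF f] tf by (intro l2_add g l2_scale f)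
    ultimately show "p \<in> model_A \<mu>" unfolding model_A_def using f by blast
  qed
qed

text \<open>
  The kernel at \<open>- \<i>\<close> is \<open>1 / (t + \<i>)\<close>, so its inner product with \<open>(t - \<i>) f\<close> is the integral of \<open>f\<close>.
\<close>

lemma model_sym_eq:
  "model_sym \<mu> = {(F, F'). (F, F') \<in> model_A \<mu> \<and>
     hinner (L2 \<mu>) (hdiff (L2 \<mu>) F' (hscale (L2 \<mu>) \<i> F)) (kernel_class (- \<i>)) = 0}"
proof -
  have *: "F \<in> {l2_class \<mu> f | f. f \<in> l2_functions \<mu> \<and> (\<integral>t. f t \<partial>\<mu>) = 0} \<longleftrightarrow>
    hinner (L2 \<mu>) (hdiff (L2 \<mu>) F' (hscale (L2 \<mu>) \<i> F)) (kernel_class (- \<i>)) = 0" (is "?l \<longleftrightarrow> _")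
    if "(F, F') \<in> model_A \<mu>" for F F'
  proof -
    obtain f where f: "f \<in> l2_functions \<mu>" "(\<lambda>t. of_real t * f t) \<in> l2_functions \<mu>"
      and F: "F = l2_class \<mu> f" "F' = l2_class \<mu> (\<lambda>t. of_real t * f t)"
      using \<open>(F, F') \<in> model_A \<mu>\<close> unfolding model_A_def using multiplication_iff by blast
    have "?l \<longleftrightarrow> (\<integral>t. f t \<partial>\<mu>) = 0"
    proof
      assume ?l
      then obtain g where g: "g \<in> l2_functions \<mu>" "(\<integral>t. g t \<partial>\<mu>) = 0" "l2_class \<mu> f = l2_class \<mu> g"
        unfolding F by blast
      have "AE t in \<mu>. f t = g t" using g(3) l2_class_eq_iff[OF f(1) g(1)] by simp
      then have "(\<integral>t. f t \<partial>\<mu>) = (\<integral>t. g t \<partial>\<mu>)"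
        using l2_measurable[OF f(1)] l2_measurable[OF g(1)] by (intro integral_cong_AE) auto
      then show "(\<integral>t. f t \<partial>\<mu>) = 0" using g by simp
    qed (use f F in blast)
    moreover have "hinner (L2 \<mu>) (hdiff (L2 \<mu>) F' (hscale (L2 \<mu>) \<i> F)) (kernel_class (- \<i>)) = (\<integral>t. f t \<partial>\<mu>)"
    proof -
      have d: "hdiff (L2 \<mu>) F' (hscale (L2 \<mu>) \<i> F) = l2_class \<mu> (\<lambda>t. of_real t * f t - \<i> * f t)"
        unfolding F L2_scale[OF f(1)] by (rule L2_diff[OF f(2) l2_scale[OF f(1)]])
      have "hinner (L2 \<mu>) (hdiff (L2 \<mu>) F' (hscale (L2 \<mu>) \<i> F)) (kernel_class (- \<i>))
          = (\<integral>t. (of_real t * f t - \<i> * f t) * cauchy_kernel \<i> t \<partial>\<mu>)"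
        unfolding d by (subst inner_kernel) (auto intro!: l2_diff l2_scale f)
      also have "\<dots> = (\<integral>t. f t \<partial>\<mu>)"
      proof (intro Bochner_Integration.integral_cong refl)
        fix t
        show "(of_real t * f t - \<i> * f t) * cauchy_kernel \<i> t = f t"
          using kernel_denominator[of \<i> t] by (simp add: cauchy_kernel_def left_diff_distrib[symmetric])
      qed
      finally show ?thesis .
    qed
    ultimately show ?thesis by simp
  qed
  show ?thesis unfolding model_sym_def restrict_op_def using * by blast
qed

lemma model_diss_eq:
  "model_diss \<mu> S = span_extension (L2 \<mu>) (model_sym \<mu>)
      (hdiff (L2 \<mu>) (kernel_class \<i>)
        (hscale (L2 \<mu>) (S \<i>) (kernel_class (- \<i>))))"
proof -
  have "hdiff (L2 \<mu>) (kernel_class \<i>) (hscale (L2 \<mu>) (S \<i>) (kernel_class (- \<i>)))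
    = l2_class \<mu> (\<lambda>t. 1 / (of_real t - \<i>) - S \<i> * (1 / (of_real t + \<i>)))"
    unfolding kernel_class_def
    by (simp add: L2_scale L2_diff kernel_l2 l2_scale) (simp add: cauchy_kernel_def)
  then show ?thesis unfolding model_diss_def Let_def by simp
qed

lemma kernel_resolvent_model:
  "resolvent_model (L2 \<mu>) kernel_class kernel_resolvent (S \<i>) (model_sym \<mu>) (model_diss \<mu> S) (model_A \<mu>)"
proof unfold_locales
  show "L2.resolvent_family \<mu> kernel_class" by (rule kernel_family)
  show "model_A \<mu> = {(kernel_resolvent X, hadd (L2 \<mu>) X (hscale (L2 \<mu>) \<i> (kernel_resolvent X))) | X.
     X \<in> hcarrier (L2 \<mu>)}" by (rule model_A_eq)
  show "model_sym \<mu> = {(F, F'). (F, F') \<in> model_A \<mu> \<and>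
     hinner (L2 \<mu>) (hdiff (L2 \<mu>) F' (hscale (L2 \<mu>) \<i> F)) (kernel_class (- \<i>)) = 0}" by (rule model_sym_eq)
  show "model_diss \<mu> S = span_extension (L2 \<mu>) (model_sym \<mu>)
      (hdiff (L2 \<mu>) (kernel_class \<i>)
        (hscale (L2 \<mu>) (S \<i>) (kernel_class (- \<i>))))"
    by (rule model_diss_eq)
next
  fix X assume "X \<in> hcarrier (L2 \<mu>)"
  then obtain f where f: "f \<in> l2_functions \<mu>" "X = l2_class \<mu> f" by (rule l2_carrierE)
  have kf: "(\<lambda>t. cauchy_kernel \<i> t * f t) \<in> l2_functions \<mu>" using f by (simp add: kernel_mult_l2)
  show "kernel_resolvent X \<in> hcarrier (L2 \<mu>)"
    unfolding f kernel_resolvent_class[OF f(1)] by (rule l2_class_mem[OF kf])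
  show "cnj (z + \<i>) * hinner (L2 \<mu>) (kernel_resolvent X) (kernel_class z)
      = hinner (L2 \<mu>) X (kernel_class z) - hinner (L2 \<mu>) X (kernel_class (- \<i>))" if z: "Im z \<noteq> 0" for z
  proof -
    have i: "integrable \<mu> (\<lambda>t. f t * cauchy_kernel (cnj z) t)" "integrable \<mu> (\<lambda>t. f t * cauchy_kernel \<i> t)"
      using z by (auto intro!: l2_product_integrable f kernel_l2)
    have "cnj (z + \<i>) * hinner (L2 \<mu>) (kernel_resolvent X) (kernel_class z)
        = cnj (z + \<i>) * (\<integral>t. (cauchy_kernel \<i> t * f t) * cauchy_kernel (cnj z) t \<partial>\<mu>)"
      unfolding f kernel_resolvent_class[OF f(1)] inner_kernel[OF kf z] ..
    also have "\<dots> = (\<integral>t. cnj (z + \<i>) * ((cauchy_kernel \<i> t * f t) * cauchy_kernel (cnj z) t) \<partial>\<mu>)"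
      by (simp only: integral_mult_right_zero)
    also have "\<dots> = (\<integral>t. f t * cauchy_kernel (cnj z) t - f t * cauchy_kernel \<i> t \<partial>\<mu>)"
    proof (intro Bochner_Integration.integral_cong refl)
      fix t
      show "cnj (z + \<i>) * ((cauchy_kernel \<i> t * f t) * cauchy_kernel (cnj z) t)
          = f t * cauchy_kernel (cnj z) t - f t * cauchy_kernel \<i> t"
        using arg_cong[OF kernel_diff[of "cnj z" \<i> t], of "\<lambda>x. f t * x"] z by (simp add: algebra_simps)
    qed
    also have "\<dots> = (\<integral>t. f t * cauchy_kernel (cnj z) t \<partial>\<mu>) - (\<integral>t. f t * cauchy_kernel \<i> t \<partial>\<mu>)"
      by (rule Bochner_Integration.integral_diff[OF i])
    also have "\<dots> = hinner (L2 \<mu>) X (kernel_class z) - hinner (L2 \<mu>) X (kernel_class (- \<i>))"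
      unfolding f using z by (simp add: inner_kernel f)
    finally show ?thesis .
  qed
  assume orth: "\<And>z. Im z \<noteq> 0 \<Longrightarrow> hinner (L2 \<mu>) X (kernel_class z) = 0"
  have "(\<integral>t. f t * cauchy_kernel z t \<partial>\<mu>) = 0" if "Im z \<noteq> 0" for z
    using orth[of "cnj z"] that f by (simp add: inner_kernel)
  then have "AE t in \<mu>. f t = 0" by (rule kernel_total[OF f(1)])
  then show "X = hzero (L2 \<mu>)" using f by (simp add: L2_zero l2_class_eq_iff l2_zero)
qed

text \<open>
  The integrand in the representation of the Weyl-Titchmarsh function. The second term, which cancels
  in differences, makes it decay like \<open>1 / t\<^sup>2\<close>.
\<close>

definition nevanlinna_kernel :: "complex \<Rightarrow> real \<Rightarrow> complex" where
  "nevanlinna_kernel z t = 1 / (complex_of_real t - z) - complex_of_real (t / (1 + t\<^sup>2))"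

lemma nevanlinna_integrable:
  assumes z: "Im z \<noteq> 0"
  shows "integrable \<mu> (nevanlinna_kernel z)"
proof (rule Bochner_Integration.integrable_bound)
  \<comment> \<open>The integrand is \<open>((1 + z\<^sup>2) / (t - z) + z) / (1 + t\<^sup>2)\<close>.\<close>
  define C where "C = cmod (1 + z\<^sup>2) / \<bar>Im z\<bar> + cmod z"
  show "integrable \<mu> (\<lambda>t. C * (1 / (1 + t\<^sup>2)))" by (intro integrable_mult_right weight_integrable)
  show "nevanlinna_kernel z \<in> borel_measurable \<mu>"
    unfolding nevanlinna_kernel_def by (rule borel_measurableI) measurable
  have "cmod (nevanlinna_kernel z t) \<le> C * (1 / (1 + t\<^sup>2))" for t
  proof -
    have "0 < 1 + t\<^sup>2" by (simp add: add_pos_nonneg)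
    then have t: "1 + (complex_of_real t)\<^sup>2 \<noteq> 0"
      by (metis of_real_1 of_real_add of_real_eq_0_iff of_real_power less_irrefl)
    have e: "nevanlinna_kernel z t = ((1 + z\<^sup>2) * cauchy_kernel z t + z) * of_real (1 / (1 + t\<^sup>2))"
      using kernel_denominator[OF z, of t] t
      by (simp add: nevanlinna_kernel_def cauchy_kernel_def divide_simps)
        (simp add: algebra_simps power2_eq_square)
    have "cmod ((1 + z\<^sup>2) * cauchy_kernel z t + z) \<le> cmod (1 + z\<^sup>2) * (1 / \<bar>Im z\<bar>) + cmod z"
      by (intro order_trans[OF norm_triangle_ineq] add_right_mono)
        (simp only: norm_mult, intro mult_left_mono cmod_kernel_le z norm_ge_zero)
    then have "cmod ((1 + z\<^sup>2) * cauchy_kernel z t + z) \<le> C" by (simp add: C_def)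
    moreover have "0 \<le> C" by (simp add: C_def)
    ultimately show ?thesis
      unfolding e norm_mult norm_of_real using \<open>0 < 1 + t\<^sup>2\<close> by (intro mult_mono) auto
  qed
  then show "AE t in \<mu>. norm (nevanlinna_kernel z t) \<le> norm (C * (1 / (1 + t\<^sup>2)))"
    by (intro AE_I2) (metis abs_ge_self order_trans real_norm_def)
qed

lemma kernel_gram:
  assumes z: "Im z \<noteq> 0" and w: "Im w \<noteq> 0"
  shows "(z - cnj w) * hinner (L2 \<mu>) (kernel_class z) (kernel_class w)
    = (\<integral>t. nevanlinna_kernel z t \<partial>\<mu>) - (\<integral>t. nevanlinna_kernel (cnj w) t \<partial>\<mu>)"
proof -
  have w': "Im (cnj w) \<noteq> 0" using w by simp
  have "hinner (L2 \<mu>) (kernel_class z) (kernel_class w) = (\<integral>t. cauchy_kernel z t * cauchy_kernel (cnj w) t \<partial>\<mu>)"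
    unfolding kernel_class_def[of z] by (rule inner_kernel[OF kernel_l2[OF z] w])
  then have "(z - cnj w) * hinner (L2 \<mu>) (kernel_class z) (kernel_class w)
      = (\<integral>t. (z - cnj w) * (cauchy_kernel z t * cauchy_kernel (cnj w) t) \<partial>\<mu>)"
    by (simp only: integral_mult_right_zero)
  also have "\<dots> = (\<integral>t. nevanlinna_kernel z t - nevanlinna_kernel (cnj w) t \<partial>\<mu>)"
    unfolding kernel_diff[OF z w', symmetric] nevanlinna_kernel_def cauchy_kernel_def[symmetric]
    by (intro Bochner_Integration.integral_cong refl) (simp add: algebra_simps)
  also have "\<dots> = (\<integral>t. nevanlinna_kernel z t \<partial>\<mu>) - (\<integral>t. nevanlinna_kernel (cnj w) t \<partial>\<mu>)"
    by (rule Bochner_Integration.integral_diff[OF nevanlinna_integrable[OF z] nevanlinna_integrable[OF w']])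
  finally show ?thesis .
qed

lemma nevanlinna_cnj: "(\<integral>t. nevanlinna_kernel (cnj z) t \<partial>\<mu>) = cnj (\<integral>t. nevanlinna_kernel z t \<partial>\<mu>)"
  unfolding Bochner_Integration.integral_cnj[symmetric] by (simp add: nevanlinna_kernel_def)

end

section \<open>Unitary equivalence and the model\<close>

context deficiency_one
begin

lemma triple_resolvent_model:
  assumes prime: "prime_operator H T"
    and D: "D = span_extension H T (gp \<ominus> \<kappa> \<odot> gm)"
  shows "resolvent_model H \<gamma> (R \<i>) \<kappa> T D A"
proof unfold_locales
  show "A = {(R \<i> x, x \<oplus> \<i> \<odot> R \<i> x) | x. x \<in> V}" (is "_ = ?S")
  proof
    show "A \<subseteq> ?S"
    proof clarify
      fix f f' assume f: "(f, f') \<in> A"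
      have V: "f \<in> V" "f' \<in> V" using A_carrier[OF f] by auto
      have "R \<i> (f' \<ominus> \<i> \<odot> f) = f" using resolvent_of_graph[of \<i>] f by simp
      moreover have "(f' \<ominus> \<i> \<odot> f) \<oplus> \<i> \<odot> f = f'"
        using V by (intro eqI_inner) (simp_all add: inner_simps)
      ultimately show "\<exists>x. (f, f') = (R \<i> x, x \<oplus> \<i> \<odot> R \<i> x) \<and> x \<in> V"
        using V by (intro exI[of _ "f' \<ominus> \<i> \<odot> f"]) simp
    qed
    show "?S \<subseteq> A" using resolvent_in_A[of \<i>] by auto
  qed
  show "T = {(f, f'). (f, f') \<in> A \<and> \<langle>f' \<ominus> \<i> \<odot> f, \<gamma> (- \<i>)\<rangle> = 0}"
    using T_iff by (auto simp: gamma_minus_i)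
  show "D = span_extension H T (\<gamma> \<i> \<ominus> \<kappa> \<odot> \<gamma> (- \<i>))"
    unfolding gamma_i gamma_minus_i by (rule D)
  show "cnj (z + \<i>) * \<langle>R \<i> x, \<gamma> z\<rangle> = \<langle>x, \<gamma> z\<rangle> - \<langle>x, \<gamma> (- \<i>)\<rangle>" if "x \<in> V" "Im z \<noteq> 0" for x z
    using inner_resolvent_gamma[of z \<i> x] that by simp
qed (use gamma_family prime_total[OF prime] in auto)

end

lemma deficiency_one_exists:
  assumes "hilbert_space H" "symmetric_operator H T" "densely_defined H T" "closed_operator H T"
    "deficiency_indices_1_1 H T" "self_adjoint_extension H T A"
  obtains gp gm where "deficiency_one H A T gp gm"
proof -
  interpret self_adjoint_op H A
    using assms by (simp add: self_adjoint_op_def self_adjoint_op_axioms_def self_adjoint_extension_def)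
  obtain g where g: "g \<in> V" "g \<noteq> hzero H" "defect_space H T \<i> = range (\<lambda>c. c \<odot> g)"
    using assms(5) unfolding deficiency_indices_1_1_def one_dimensional_def by blast
  define gp where "gp = (1 / of_real (norm_H g)) \<odot> g"
  have "norm_H gp = 1" using g norm_eq_zero[of g] by (simp add: gp_def norm_scale norm_divide)
  moreover have "gp \<in> defect_space H T \<i>" unfolding g(3) gp_def by blast
  ultimately interpret deficiency_vector H A T gp
    using assms by unfold_locales (simp_all add: self_adjoint_extension_def)
  show thesis using that deficiency_one_gamma by blast
qed

lemma cayley_less_one: "Im m > 0 \<Longrightarrow> cmod ((m - \<i>) / (m + \<i>)) < 1"
proof -
  assume m: "Im m > 0"
  have "(cmod (m - \<i>))\<^sup>2 < (cmod (m + \<i>))\<^sup>2"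
    using m by (simp add: cmod_power2) (simp add: power2_eq_square algebra_simps)
  then have "cmod (m - \<i>) < cmod (m + \<i>)" by (rule power2_less_imp_less) simp
  moreover from this have "0 < cmod (m + \<i>)" by (rule le_less_trans[OF norm_ge_zero])
  ultimately show ?thesis by (simp add: norm_divide)
qed

lemma cayley_inject:
  assumes "Im m > 0" "Im m' > 0" "(m - \<i>) / (m + \<i>) = (m' - \<i>) / (m' + \<i>)"
  shows "m = m'"
proof -
  have "m + \<i> \<noteq> 0" "m' + \<i> \<noteq> 0" using assms(1,2) by (auto simp: complex_eq_iff)
  then have "(m - \<i>) * (m' + \<i>) = (m' - \<i>) * (m + \<i>)" using assms(3) by (simp add: divide_simps)
  then have "2 * \<i> * (m - m') = 0" by (simp add: algebra_simps)
  then show ?thesis by simp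
qed

text \<open>
  Cross-multiplication leaves \<open>(s' - s) (1 - \<bar>\<kappa>\<bar>\<^sup>2) = 0\<close>; the denominators do not vanish inside the disc.
\<close>

lemma moebius_inject:
  assumes \<kappa>: "cmod \<kappa> < 1" and s: "cmod s < 1" "cmod s' < 1"
    and eq: "(s - \<kappa>) / (cnj \<kappa> * s - 1) = (s' - \<kappa>) / (cnj \<kappa> * s' - 1)"
  shows "s = s'"
proof -
  have ne: "cnj \<kappa> * u - 1 \<noteq> 0" if "cmod u < 1" for u
  proof
    assume "cnj \<kappa> * u - 1 = 0"
    then have "cmod \<kappa> * cmod u = 1" by (metis complex_mod_cnj eq_iff_diff_eq_0 norm_mult norm_one)
    moreover have "cmod \<kappa> * cmod u \<le> cmod \<kappa> * 1" using that by (intro mult_left_mono) auto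
    ultimately show False using \<kappa> by simp
  qed
  have "(s - \<kappa>) * (cnj \<kappa> * s' - 1) = (s' - \<kappa>) * (cnj \<kappa> * s - 1)"
    using eq ne[OF s(1)] ne[OF s(2)] by (simp add: divide_simps)
  then have "(s' - s) * (1 - \<kappa> * cnj \<kappa>) = 0" by (simp add: algebra_simps)
  moreover have "1 - \<kappa> * cnj \<kappa> \<noteq> 0"
  proof
    assume "1 - \<kappa> * cnj \<kappa> = 0"
    then have "of_real ((cmod \<kappa>)\<^sup>2) = (1 :: complex)" using complex_norm_square[of \<kappa>] by simp
    then have "(cmod \<kappa>)\<^sup>2 = 1" by (simp only: of_real_eq_1_iff)
    then show False using \<kappa> norm_ge_zero[of \<kappa>] by (simp add: power2_eq_1_iff)
  qed
  ultimately show ?thesis by simp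
qed

text \<open>
  The characteristic function may be computed from any admissible pair of deficiency vectors, in
  particular from the image of a given pair.
\<close>

lemma deficiency_one_unitary:
  assumes "deficiency_one H A T gp gm" and K: "hilbert_space K" and U: "unitary_map H K U"
    and T': "symmetric_operator K T'" "densely_defined K T'" "closed_operator K T'"
      "deficiency_indices_1_1 K T'" "self_adjoint_extension K T' A'"
    and conj: "T' = op_conjugate U T" "A' = op_conjugate U A"
  shows "deficiency_one K A' T' (U gp) (U gm)"
    and "Im z \<noteq> 0 \<Longrightarrow> deficiency_vector.m K A' (U gp) z = deficiency_vector.m H A gp z"
proof -
  interpret H: deficiency_one H A T gp gm by fact
  interpret K: hilbert_space K by fact
  have Uscale: "\<And>c f. f \<in> hcarrier H \<Longrightarrow> U (hscale H c f) = hscale K c (U f)"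
    and Uadd: "\<And>f g. \<lbrakk>f \<in> hcarrier H; g \<in> hcarrier H\<rbrakk> \<Longrightarrow> U (hadd H f g) = hadd K (U f) (U g)"
    and Uinner: "\<And>f g. \<lbrakk>f \<in> hcarrier H; g \<in> hcarrier H\<rbrakk> \<Longrightarrow> hinner K (U f) (U g) = hinner H f g"
    and UV: "\<And>f. f \<in> hcarrier H \<Longrightarrow> U f \<in> hcarrier K"
    using U unfolding unitary_map_def by blast+
  have TV: "T \<subseteq> hcarrier H \<times> hcarrier H" using H.T_carrier by auto
  have adj: "(U f, U g) \<in> adjoint_op K T'" if "(f, g) \<in> adjoint_op H T" for f g
    using that unfolding conj adjoint_conjugate[OF U TV] by (auto simp: op_conjugate_def)
  have norm: "hnorm K (U f) = hnorm H f" if "f \<in> hcarrier H" for f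
    using Uinner that by (simp add: hnorm_def)
  show *: "deficiency_one K A' T' (U gp) (U gm)"
  proof unfold_locales
    show "U gp \<in> defect_space K T' \<i>"
      using adj[OF H.gp_adj] by (simp add: K.defect_space_iff Uscale)
    show "U gm \<in> defect_space K T' (- \<i>)"
      using adj[OF H.gm_adj] by (simp add: K.defect_space_iff Uscale)
    obtain k where "(hdiff H gp gm, k) \<in> A" using H.gp_gm by blast
    then have "(U (hdiff H gp gm), U k) \<in> A'" unfolding conj op_conjugate_def by blast
    then show "hdiff K (U gp) (U gm) \<in> Domain A'"
      using unitary_map_diff[OF U H.hilbert_space_axioms] by auto
  qed (use T' norm in \<open>auto simp: H.gp_norm H.gm_norm self_adjoint_extension_def\<close>)
  interpret K: deficiency_one K A' T' "U gp" "U gm" by fact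
  show "K.m z = H.m z" if z: "Im z \<noteq> 0"
  proof -
    have "(U (H.R z gp), U (hadd H gp (hscale H z (H.R z gp)))) \<in> A'"
      unfolding conj op_conjugate_def using H.resolvent_in_A[OF z H.gp_closed] by blast
    then have "K.R z (U gp) = U (H.R z gp)"
      using z by (intro K.resolvent_unique) (simp_all add: Uadd Uscale)
    then show ?thesis unfolding K.m_def H.m_def using z by (simp add: Uinner)
  qed
qed

theorem theorem4p1:
  fixes HA :: "'a hspace" and TA DA A :: "'a operator"
    and HB :: "'b hspace" and TB DB B :: "'b operator"
  assumes "hilbert_space HA" and "hilbert_space HB"
    and "symmetric_operator HA TA" and "symmetric_operator HB TB"
    and "densely_defined HA TA" and "densely_defined HB TB"
    and "closed_operator HA TA" and "closed_operator HB TB"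
    and "prime_operator HA TA" and "prime_operator HB TB"
    and "deficiency_indices_1_1 HA TA" and "deficiency_indices_1_1 HB TB"
    and "self_adjoint_extension HA TA A" and "self_adjoint_extension HB TB B"
    and "maximal_dissipative_extension HA TA DA"
    and "maximal_dissipative_extension HB TB DB"
    and "DA \<noteq> adjoint_op HA DA" and "DB \<noteq> adjoint_op HB DB"
  shows "(triples_unitarily_equivalent HA (TA, DA, A) HB (TB, DB, B) \<longleftrightarrow>
      (\<forall>z. Im z > 0 \<longrightarrow>
        characteristic_function HA TA DA A z = characteristic_function HB TB DB B z))
    \<and> (\<forall>\<mu>. representing_measure (weyl_function HA TA A) \<mu> \<longrightarrow>
      triples_unitarily_equivalent HA (TA, DA, A)
        (L2 \<mu>) (model_sym \<mu>, model_diss \<mu> (characteristic_function HA TA DA A), model_A \<mu>))"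
proof -
  obtain gp gm where "deficiency_one HA A TA gp gm"
    using deficiency_one_exists[OF assms(1,3,5,7,11,13)] .
  then interpret A: deficiency_one HA A TA gp gm .
  obtain \<kappa> where \<kappa>: "cmod \<kappa> < 1"
    and DA: "DA = span_extension HA TA (hdiff HA gp (hscale HA \<kappa> gm))"
    using A.maximal_dissipative_parameter[OF assms(15,17)] .
  note modelA = A.triple_resolvent_model[OF assms(9) DA]
  have "characteristic_function HA TA DA A z = characteristic_function HB TB DB B z"
    if equiv: "triples_unitarily_equivalent HA (TA, DA, A) HB (TB, DB, B)" and z: "Im z > 0" for z
  proof -
    obtain U where U: "unitary_map HA HB U" and conj: "TB = op_conjugate U TA" "B = op_conjugate U A"
      and conjD: "DB = op_conjugate U DA"
      using equiv by auto
    note trans = deficiency_one_unitary[OF A.deficiency_one_axioms assms(2) U assms(4,6,8,12,14) conj]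
    interpret B: deficiency_one HB B TB "U gp" "U gm" by (rule trans(1))
    obtain \<kappa>' where \<kappa>': "cmod \<kappa>' < 1"
      and DB: "DB = span_extension HB TB (hdiff HB (U gp) (hscale HB \<kappa>' (U gm)))"
      using B.maximal_dissipative_parameter[OF assms(16,18)] .
    have "hdiff HA gp (hscale HA \<kappa> gm) \<in> Domain DA"
    proof -
      have "hzero HA \<in> Domain TA" using A.linear_zero[OF A.T_linear] by blast
      moreover have "hdiff HA gp (hscale HA \<kappa> gm)
          = hadd HA (hzero HA) (hscale HA 1 (hdiff HA gp (hscale HA \<kappa> gm)))"
        by (simp add: A.add_zero A.scale_one)
      ultimately show ?thesis unfolding A.Domain_extension[OF DA] by blast
    qed
    then have "U (hdiff HA gp (hscale HA \<kappa> gm)) \<in> Domain DB"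
      unfolding conjD op_conjugate_def by blast
    moreover have "U (hdiff HA gp (hscale HA \<kappa> gm)) = hdiff HB (U gp) (hscale HB \<kappa> (U gm))"
      using U unitary_map_diff[OF U assms(1), of gp "hscale HA \<kappa> gm"] by (simp add: unitary_map_def)
    ultimately have "\<kappa> = \<kappa>'" using B.parameter_unique[OF DB] by simp
    then show ?thesis
      unfolding A.characteristic_function_eq[OF DA \<kappa> z] B.characteristic_function_eq[OF DB \<kappa>' z]
      using trans(2)[of z] z by simp
  qed
  moreover have "triples_unitarily_equivalent HA (TA, DA, A) HB (TB, DB, B)"
    if S: "\<forall>z. Im z > 0 \<longrightarrow> characteristic_function HA TA DA A z = characteristic_function HB TB DB B z"
  proof -
    obtain hp hm where "deficiency_one HB B TB hp hm"
      using deficiency_one_exists[OF assms(2,4,6,8,12,14)] .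
    then interpret B: deficiency_one HB B TB hp hm .
    obtain \<kappa>' where \<kappa>': "cmod \<kappa>' < 1"
      and DB: "DB = span_extension HB TB (hdiff HB hp (hscale HB \<kappa>' hm))"
      using B.maximal_dissipative_parameter[OF assms(16,18)] .
    note modelB = B.triple_resolvent_model[OF assms(10) DB]
    have \<kappa>\<kappa>': "\<kappa>' = \<kappa>"
      using S A.characteristic_function_i[OF DA \<kappa>] B.characteristic_function_i[OF DB \<kappa>'] by simp
    have upper: "A.m z = B.m z" if z: "Im z > 0" for z
    proof -
      have "(A.m z - \<i>) / (A.m z + \<i>) = (B.m z - \<i>) / (B.m z + \<i>)"
      proof (rule moebius_inject[OF \<kappa>])
        show "cmod ((A.m z - \<i>) / (A.m z + \<i>)) < 1" "cmod ((B.m z - \<i>) / (B.m z + \<i>)) < 1"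
          by (intro cayley_less_one A.Im_m_pos B.Im_m_pos z)+
        have "characteristic_function HA TA DA A z = characteristic_function HB TB DB B z"
          using S z by blast
        then show "((A.m z - \<i>) / (A.m z + \<i>) - \<kappa>) / (cnj \<kappa> * ((A.m z - \<i>) / (A.m z + \<i>)) - 1)
          = ((B.m z - \<i>) / (B.m z + \<i>) - \<kappa>) / (cnj \<kappa> * ((B.m z - \<i>) / (B.m z + \<i>)) - 1)"
          unfolding A.characteristic_function_eq[OF DA \<kappa> z]
            B.characteristic_function_eq[OF DB \<kappa>' z, unfolded \<kappa>\<kappa>'] .
      qed
      then show ?thesis by (rule cayley_inject[OF A.Im_m_pos[OF z] B.Im_m_pos[OF z]])
    qed
    have m: "A.m z = B.m z" if z: "Im z \<noteq> 0" for z
      using upper[of z] upper[of "cnj z"] A.m_cnj[OF z] B.m_cnj[OF z] z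
      by (cases "Im z > 0") auto
    show ?thesis
    proof (rule resolvent_models_equivalent[OF modelA modelB[unfolded \<kappa>\<kappa>']])
      fix z w assume zw: "Im z \<noteq> 0" "Im w \<noteq> 0" "z \<noteq> cnj w"
      have "(z - cnj w) * hinner HA (A.\<gamma> z) (A.\<gamma> w) = (z - cnj w) * hinner HB (B.\<gamma> z) (B.\<gamma> w)"
        using A.gram[OF zw(1,2)] B.gram[OF zw(1,2)] m[OF zw(1)] m[of "cnj w"] zw by simp
      then show "hinner HA (A.\<gamma> z) (A.\<gamma> w) = hinner HB (B.\<gamma> z) (B.\<gamma> w)"
        using zw by simp
    qed
  qed
  moreover have "triples_unitarily_equivalent HA (TA, DA, A)
      (L2 \<mu>) (model_sym \<mu>, model_diss \<mu> (characteristic_function HA TA DA A), model_A \<mu>)"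
    if rep: "representing_measure (weyl_function HA TA A) \<mu>" for \<mu>
  proof -
    interpret kernel_measure \<mu>
      using rep by (simp add: kernel_measure_def representing_measure_def)
    let ?F = "\<lambda>z. \<integral>t. nevanlinna_kernel z t \<partial>\<mu>"
    have upper: "A.m z = ?F z" if z: "Im z > 0" for z
      using rep z A.weyl_function_eq[of z] unfolding representing_measure_def nevanlinna_kernel_def by auto
    have m: "A.m z = ?F z" if z: "Im z \<noteq> 0" for z
      using upper[of z] upper[of "cnj z"] A.m_cnj[OF z] nevanlinna_cnj[of z] z
      by (cases "Im z > 0") auto
    have S: "characteristic_function HA TA DA A \<i> = \<kappa>" by (rule A.characteristic_function_i[OF DA \<kappa>])
    show ?thesis
    proof (rule resolvent_models_equivalent[OF modelA
          kernel_resolvent_model[of "characteristic_function HA TA DA A", unfolded S]])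
      fix z w assume zw: "Im z \<noteq> 0" "Im w \<noteq> 0" "z \<noteq> cnj w"
      have "(z - cnj w) * hinner HA (A.\<gamma> z) (A.\<gamma> w)
          = (z - cnj w) * hinner (L2 \<mu>) (kernel_class z) (kernel_class w)"
        using A.gram[OF zw(1,2)] kernel_gram[OF zw(1,2)] m[OF zw(1)] m[of "cnj w"] zw by simp
      then show "hinner HA (A.\<gamma> z) (A.\<gamma> w) = hinner (L2 \<mu>) (kernel_class z) (kernel_class w)"
        using zw by simp
    qed
  qed
  ultimately show ?thesis by blast
qed

end
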